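(* Let $G$ be a group and $B$ a central subgroup of $G$. Then the following natural sequences of abelian groups are exact: $$0\to\mathrm{Ker}(c_2)\xrightarrow{\;l_2\;}G/BG'\otimes G/BG'\xrightarrow{\;\mu_2\;}P_2(G,B)\xrightarrow{\;\rho_1\;}G^{ab}\to1,$$ $$0\to G/BG'\wedge G/BG'\xrightarrow{(c_2,-l_2)^t}BG'/\gamma_3(G)\oplus(G/BG'\otimes G/BG')\xrightarrow{(p_2i,\mu_2)}P_2(G,B)\xrightarrow{\;\rho_2\;}G/BG'\to1,$$ $$0\to B\gamma_3(G)/\gamma_3(G)\xrightarrow{\;p_2i\;}P_2(G,B)\xrightarrow{P_2(\pi)}P_2(G/B)\to0,$$ where $\rho_1p_2(a)=aG'$ and $\rho_2p_2(a)=aBG'$ for $a\in G$, $i$ denotes the injection of $BG'/\gamma_3(G)$ or of $B\gamma_3(G)/\gamma_3(G)$ into $G/\gamma_3(G)$, and $\pi\colon(G,B)\to(G/B,\{\bar1\})$ is the natural projection.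
   Context: $G'=[G,G]$, $\gamma_3(G)=[G,[G,G]]$, $G^{ab}=G/G'$; $A\wedge A$ denotes the exterior square of an abelian group $A$ over $\mathbb{Z}$. $I(G)$ is the augmentation ideal of the integral group ring $\mathbb{Z}(G)$, $I^k(G)$ its $k$-th power, $I(B)$ the augmentation ideal of $\mathbb{Z}(B)$. For a normal subgroup $B$, $P_2(G,B)=I(G)/(I(B)I(G)+I^3(G))$, a ring without unit, with quotient map $\rho$, and $P_2(G)=P_2(G,\{1\})=I(G)/I^3(G)$. $p_2\colon G\to P_2(G,B)$ is $p_2(a)=\rho(a-1)$; it factors through $G/\gamma_3(G)$, and the induced map $G/\gamma_3(G)\to P_2(G,B)$ is also denoted $p_2$. A homomorphism $f\colon G\to H$ with $f(B)\subset C$ induces $P_2(f)\colon P_2(G,B)\to P_2(H,C)$, $P_2(f)(\rho(a-1))=\rho(f(a)-1)$. For $B$ central: $\mu_2\colon G/BG'\otimes G/BG'\to P_2(G,B)$ is the homomorphism with $\mu_2(\bar a\otimes\bar b)=p_2(a)p_2(b)$; $c_2\colon G/BG'\wedge G/BG'\to BG'/\gamma_3(G)$ is the homomorphism $c_2(\bar a\wedge\bar b)=[a,b]\gamma_3(G)$ with $[a,b]=aba^{-1}b^{-1}$; $l_2\colon G/BG'\wedge G/BG'\to G/BG'\otimes G/BG'$ is the injective homomorphism $l_2(\bar a\wedge\bar b)=\bar a\otimes\bar b-\bar b\otimes\bar a$. $(c_2,-l_2)^t$ is the map $x\mapsto(c_2(x),-l_2(x))$ and $(p_2i,\mu_2)$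 is the map $(u,v)\mapsto p_2i(u)+\mu_2(v)$. Natural means natural with respect to homomorphisms $f\colon G\to H$ with $f(B)\subset C$, for pairs $(G,B)$, $(H,C)$ of groups with central subgroups. *)

theory Defs
  imports "HOL-Algebra.Free_Abelian_Groups" "HOL-Algebra.Generated_Groups" "HOL-Algebra.QuotRing"
    "HOL-Algebra.Ideal_Product"
begin

section \<open>Maps on quotients\<close>

text \<open>The map on cosets induced by a map \<open>h\<close> that is constant on each coset.  For a map of two
  arguments, a pair of cosets \<open>X, Y\<close> enters as the single set \<open>X \<times> Y\<close>.\<close>
definition coset_map :: "('a \<Rightarrow> 'b) \<Rightarrow> 'a set \<Rightarrow> 'b" where
  "coset_map h X = the_elem (h ` X)"

text \<open>The map \<open>G/M \<rightarrow> H/N\<close> induced by \<open>f : G \<rightarrow> H\<close> with \<open>f(M) \<subseteq> N\<close>.\<close>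
definition quot_map :: "('b, 'n) monoid_scheme \<Rightarrow> 'b set \<Rightarrow> ('a \<Rightarrow> 'b) \<Rightarrow> 'a set \<Rightarrow> 'b set" where
  "quot_map H N f = coset_map (\<lambda>x. N #>\<^bsub>H\<^esub> f x)"


section \<open>Tensor product and exterior square of abelian groups\<close>

text \<open>Abelian groups are multiplicatively written group records.\<close>

definition tensor_rels :: "('a, 'm) monoid_scheme \<Rightarrow> ('b, 'n) monoid_scheme \<Rightarrow> ('a \<times> 'b \<Rightarrow>\<^sub>0 int) set" where
  "tensor_rels A B =
     {frag_of (a \<otimes>\<^bsub>A\<^esub> a', b) - frag_of (a, b) - frag_of (a', b) | a a' b.
        a \<in> carrier A \<and> a' \<in> carrier A \<and> b \<in> carrier B} \<union>
     {frag_of (a, b \<otimes>\<^bsub>B\<^esub> b') - frag_of (a, b) - frag_of (a, b') | a b b'.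
        a \<in> carrier A \<and> b \<in> carrier B \<and> b' \<in> carrier B}"

definition tensor_ker :: "('a, 'm) monoid_scheme \<Rightarrow> ('b, 'n) monoid_scheme \<Rightarrow> ('a \<times> 'b \<Rightarrow>\<^sub>0 int) set" where
  "tensor_ker A B = generate (free_Abelian_group (carrier A \<times> carrier B)) (tensor_rels A B)"

definition tensor_product ::
  "('a, 'm) monoid_scheme \<Rightarrow> ('b, 'n) monoid_scheme \<Rightarrow> ('a \<times> 'b \<Rightarrow>\<^sub>0 int) set monoid" where
  "tensor_product A B = free_Abelian_group (carrier A \<times> carrier B) Mod tensor_ker A B"

definition tens ::
  "('a, 'm) monoid_scheme \<Rightarrow> ('b, 'n) monoid_scheme \<Rightarrow> 'a \<Rightarrow> 'b \<Rightarrow> ('a \<times> 'b \<Rightarrow>\<^sub>0 int) set" where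
  "tens A B a b =
     tensor_ker A B #>\<^bsub>free_Abelian_group (carrier A \<times> carrier B)\<^esub> frag_of (a, b)"

definition exterior_ker :: "('a, 'm) monoid_scheme \<Rightarrow> ('a \<times> 'a \<Rightarrow>\<^sub>0 int) set set" where
  "exterior_ker A = generate (tensor_product A A) {tens A A a a | a. a \<in> carrier A}"

definition exterior_square ::
  "('a, 'm) monoid_scheme \<Rightarrow> ('a \<times> 'a \<Rightarrow>\<^sub>0 int) set set monoid" where
  "exterior_square A = tensor_product A A Mod exterior_ker A"

definition wedge :: "('a, 'm) monoid_scheme \<Rightarrow> 'a \<Rightarrow> 'a \<Rightarrow> ('a \<times> 'a \<Rightarrow>\<^sub>0 int) set set" where
  "wedge A a b = exterior_ker A #>\<^bsub>tensor_product A A\<^esub> tens A A a b"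

text \<open>The homomorphism from the free abelian group extending \<open>f\<close>.\<close>
definition free_lift :: "('c, 'k) monoid_scheme \<Rightarrow> ('x \<Rightarrow> 'c) \<Rightarrow> ('x \<Rightarrow>\<^sub>0 int) \<Rightarrow> 'c" where
  "free_lift C f x =
     finprod C (\<lambda>a. f a [^]\<^bsub>C\<^esub> Poly_Mapping.lookup x a) (Poly_Mapping.keys x)"

text \<open>The homomorphisms \<open>a \<otimes> b \<mapsto> \<phi>(a, b)\<close> from \<open>A \<otimes> B\<close> and \<open>a \<and> b \<mapsto> \<phi>(a, b)\<close> from
  \<open>A \<and> A\<close> to \<open>C\<close>, for a bimultiplicative, respectively also alternating, \<open>\<phi>\<close>.\<close>
definition tensor_lift ::
  "('c, 'k) monoid_scheme \<Rightarrow> ('a \<times> 'b \<Rightarrow> 'c) \<Rightarrow> ('a \<times> 'b \<Rightarrow>\<^sub>0 int) set \<Rightarrow> 'c" where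
  "tensor_lift C \<phi> = coset_map (free_lift C \<phi>)"

definition exterior_lift ::
  "('c, 'k) monoid_scheme \<Rightarrow> ('a \<times> 'a \<Rightarrow> 'c) \<Rightarrow> ('a \<times> 'a \<Rightarrow>\<^sub>0 int) set set \<Rightarrow> 'c" where
  "exterior_lift C \<phi> = coset_map (tensor_lift C \<phi>)"

text \<open>\<open>f \<otimes> f\<close> and \<open>f \<and> f\<close> for \<open>f : A \<rightarrow> A'\<close>, given the target \<open>A'\<close>.\<close>
definition tensor_map ::
  "('b, 'n) monoid_scheme \<Rightarrow> ('a \<Rightarrow> 'b) \<Rightarrow> ('a \<times> 'a \<Rightarrow>\<^sub>0 int) set \<Rightarrow> ('b \<times> 'b \<Rightarrow>\<^sub>0 int) set" where
  "tensor_map A' f = tensor_lift (tensor_product A' A') (\<lambda>(a, b). tens A' A' (f a) (f b))"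

definition exterior_map ::
  "('b, 'n) monoid_scheme \<Rightarrow> ('a \<Rightarrow> 'b) \<Rightarrow> ('a \<times> 'a \<Rightarrow>\<^sub>0 int) set set \<Rightarrow> ('b \<times> 'b \<Rightarrow>\<^sub>0 int) set set" where
  "exterior_map A' f = exterior_lift (exterior_square A') (\<lambda>(a, b). wedge A' (f a) (f b))"


section \<open>Commutators and the lower central series\<close>

definition commutator :: "('a, 'm) monoid_scheme \<Rightarrow> 'a \<Rightarrow> 'a \<Rightarrow> 'a" where
  "commutator G a b = a \<otimes>\<^bsub>G\<^esub> b \<otimes>\<^bsub>G\<^esub> inv\<^bsub>G\<^esub> a \<otimes>\<^bsub>G\<^esub> inv\<^bsub>G\<^esub> b"

definition commutator_subgroup :: "('a, 'm) monoid_scheme \<Rightarrow> 'a set \<Rightarrow> 'a set \<Rightarrow> 'a set" where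
  "commutator_subgroup G S T = generate G {commutator G s t | s t. s \<in> S \<and> t \<in> T}"

abbreviation derived_subgroup :: "('a, 'm) monoid_scheme \<Rightarrow> 'a set" where
  "derived_subgroup G \<equiv> derived G (carrier G)"

definition gamma3 :: "('a, 'm) monoid_scheme \<Rightarrow> 'a set" where
  "gamma3 G = commutator_subgroup G (carrier G) (derived_subgroup G)"

abbreviation abelianization :: "('a, 'm) monoid_scheme \<Rightarrow> 'a set monoid" where
  "abelianization G \<equiv> G Mod derived_subgroup G"

definition central_subgroup :: "'a set \<Rightarrow> ('a, 'm) monoid_scheme \<Rightarrow> bool" where
  "central_subgroup B G \<longleftrightarrow>
     subgroup B G \<and> (\<forall>b\<in>B. \<forall>g\<in>carrier G. b \<otimes>\<^bsub>G\<^esub> g = g \<otimes>\<^bsub>G\<^esub> b)"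

definition BG' :: "('a, 'm) monoid_scheme \<Rightarrow> 'a set \<Rightarrow> 'a set" where
  "BG' G B = B <#>\<^bsub>G\<^esub> derived_subgroup G"

definition G_mod_BG' :: "('a, 'm) monoid_scheme \<Rightarrow> 'a set \<Rightarrow> 'a set monoid" where
  "G_mod_BG' G B = G Mod BG' G B"

definition BG'_mod_gamma3 :: "('a, 'm) monoid_scheme \<Rightarrow> 'a set \<Rightarrow> 'a set monoid" where
  "BG'_mod_gamma3 G B = G\<lparr>carrier := BG' G B\<rparr> Mod gamma3 G"

definition Bgamma3_mod_gamma3 :: "('a, 'm) monoid_scheme \<Rightarrow> 'a set \<Rightarrow> 'a set monoid" where
  "Bgamma3_mod_gamma3 G B = G\<lparr>carrier := B <#>\<^bsub>G\<^esub> gamma3 G\<rparr> Mod gamma3 G"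

definition tensor_square_quot ::
  "('a, 'm) monoid_scheme \<Rightarrow> 'a set \<Rightarrow> ('a set \<times> 'a set \<Rightarrow>\<^sub>0 int) set monoid" where
  "tensor_square_quot G B = tensor_product (G_mod_BG' G B) (G_mod_BG' G B)"

definition exterior_square_quot ::
  "('a, 'm) monoid_scheme \<Rightarrow> 'a set \<Rightarrow> ('a set \<times> 'a set \<Rightarrow>\<^sub>0 int) set set monoid" where
  "exterior_square_quot G B = exterior_square (G_mod_BG' G B)"


section \<open>The integral group ring and \<open>P\<^sub>2(G,B)\<close>\<close>

definition group_ring :: "('a, 'm) monoid_scheme \<Rightarrow> ('a \<Rightarrow>\<^sub>0 int) ring" where
  "group_ring G =
     \<lparr>carrier = {x. Poly_Mapping.keys x \<subseteq> carrier G},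
      mult = (\<lambda>x y. frag_extend (\<lambda>a. frag_extend (\<lambda>b. frag_of (a \<otimes>\<^bsub>G\<^esub> b)) y) x),
      one = frag_of \<one>\<^bsub>G\<^esub>,
      zero = 0,
      add = (+)\<rparr>"

definition augmentation :: "('a \<Rightarrow>\<^sub>0 int) \<Rightarrow> int" where
  "augmentation x = (\<Sum>a\<in>Poly_Mapping.keys x. Poly_Mapping.lookup x a)"

definition aug_ideal :: "('a, 'm) monoid_scheme \<Rightarrow> ('a \<Rightarrow>\<^sub>0 int) set" where
  "aug_ideal G = {x \<in> carrier (group_ring G). augmentation x = 0}"

primrec aug_power :: "('a, 'm) monoid_scheme \<Rightarrow> nat \<Rightarrow> ('a \<Rightarrow>\<^sub>0 int) set" where
  "aug_power G 0 = carrier (group_ring G)"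
| "aug_power G (Suc k) = ideal_prod (group_ring G) (aug_power G k) (aug_ideal G)"

text \<open>\<open>I(B) I(G) + I\<^sup>3(G)\<close>.  Here \<open>I(B)\<close> is only a subset of \<open>\<int>(G)\<close>, not an ideal of it;
  \<^const>\<open>ideal_prod\<close> still yields the additive group of finite sums of products.\<close>
definition P2_ker :: "('a, 'm) monoid_scheme \<Rightarrow> 'a set \<Rightarrow> ('a \<Rightarrow>\<^sub>0 int) set" where
  "P2_ker G B =
     ideal_prod (group_ring G) (aug_ideal (G\<lparr>carrier := B\<rparr>)) (aug_ideal G)
       <+>\<^bsub>group_ring G\<^esub> aug_power G 3"

text \<open>The ring has no unit: the \<open>one\<close> field of this record is not an element of the carrier
  in general and is never used.\<close>
definition P2_ring :: "('a, 'm) monoid_scheme \<Rightarrow> 'a set \<Rightarrow> ('a \<Rightarrow>\<^sub>0 int) set ring" where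
  "P2_ring G B = (group_ring G)\<lparr>carrier := aug_ideal G\<rparr> Quot P2_ker G B"

definition P2 :: "('a, 'm) monoid_scheme \<Rightarrow> 'a set \<Rightarrow> ('a \<Rightarrow>\<^sub>0 int) set monoid" where
  "P2 G B = add_monoid (P2_ring G B)"

definition p2 :: "('a, 'm) monoid_scheme \<Rightarrow> 'a set \<Rightarrow> 'a \<Rightarrow> ('a \<Rightarrow>\<^sub>0 int) set" where
  "p2 G B a = P2_ker G B +>\<^bsub>group_ring G\<^esub> (frag_of a - frag_of \<one>\<^bsub>G\<^esub>)"

text \<open>The map induced by \<^const>\<open>p2\<close> on \<open>G/\<gamma>\<^sub>3(G)\<close>.  The elements of \<open>BG'/\<gamma>\<^sub>3(G)\<close> and of
  \<open>B\<gamma>\<^sub>3(G)/\<gamma>\<^sub>3(G)\<close> are themselves cosets of \<open>\<gamma>\<^sub>3(G)\<close> in \<open>G\<close>, so that the injections \<open>i\<close> are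
  identity maps and \<open>p\<^sub>2 i\<close> is \<open>p2_bar\<close> on these subgroups.\<close>
definition p2_bar :: "('a, 'm) monoid_scheme \<Rightarrow> 'a set \<Rightarrow> 'a set \<Rightarrow> ('a \<Rightarrow>\<^sub>0 int) set" where
  "p2_bar G B = coset_map (p2 G B)"

text \<open>\<open>P\<^sub>2(f)\<close>, with the target \<open>P\<^sub>2(H,C)\<close> given: induced by the linear extension of \<open>f\<close>.\<close>
definition P2_map ::
  "('b, 'n) monoid_scheme \<Rightarrow> 'b set \<Rightarrow> ('a \<Rightarrow> 'b) \<Rightarrow> ('a \<Rightarrow>\<^sub>0 int) set \<Rightarrow> ('b \<Rightarrow>\<^sub>0 int) set" where
  "P2_map H C f =
     coset_map (\<lambda>x. P2_ker H C +>\<^bsub>group_ring H\<^esub> frag_extend (\<lambda>a. frag_of (f a)) x)"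


section \<open>The maps of the exact sequences\<close>

definition mu2 ::
  "('a, 'm) monoid_scheme \<Rightarrow> 'a set \<Rightarrow> ('a set \<times> 'a set \<Rightarrow>\<^sub>0 int) set \<Rightarrow> ('a \<Rightarrow>\<^sub>0 int) set" where
  "mu2 G B = tensor_lift (P2 G B)
     (\<lambda>(X, Y). coset_map (\<lambda>(a, b). p2 G B a \<otimes>\<^bsub>P2_ring G B\<^esub> p2 G B b) (X \<times> Y))"

definition c2 ::
  "('a, 'm) monoid_scheme \<Rightarrow> 'a set \<Rightarrow> ('a set \<times> 'a set \<Rightarrow>\<^sub>0 int) set set \<Rightarrow> 'a set" where
  "c2 G B = exterior_lift (BG'_mod_gamma3 G B)
     (\<lambda>(X, Y). coset_map (\<lambda>(a, b). gamma3 G #>\<^bsub>G\<^esub> commutator G a b) (X \<times> Y))"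

definition l2 ::
  "('a, 'm) monoid_scheme \<Rightarrow> 'a set
     \<Rightarrow> ('a set \<times> 'a set \<Rightarrow>\<^sub>0 int) set set \<Rightarrow> ('a set \<times> 'a set \<Rightarrow>\<^sub>0 int) set" where
  "l2 G B = (let A = G_mod_BG' G B; T = tensor_square_quot G B in
     exterior_lift T (\<lambda>(X, Y). tens A A X Y \<otimes>\<^bsub>T\<^esub> inv\<^bsub>T\<^esub> tens A A Y X))"

definition Ker_c2 ::
  "('a, 'm) monoid_scheme \<Rightarrow> 'a set \<Rightarrow> ('a set \<times> 'a set \<Rightarrow>\<^sub>0 int) set set monoid" where
  "Ker_c2 G B = (exterior_square_quot G B)
     \<lparr>carrier := kernel (exterior_square_quot G B) (BG'_mod_gamma3 G B) (c2 G B)\<rparr>"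

definition c2_l2 ::
  "('a, 'm) monoid_scheme \<Rightarrow> 'a set
     \<Rightarrow> ('a set \<times> 'a set \<Rightarrow>\<^sub>0 int) set set \<Rightarrow> 'a set \<times> ('a set \<times> 'a set \<Rightarrow>\<^sub>0 int) set" where
  "c2_l2 G B x = (c2 G B x, inv\<^bsub>tensor_square_quot G B\<^esub> l2 G B x)"

definition p2i_mu2 ::
  "('a, 'm) monoid_scheme \<Rightarrow> 'a set
     \<Rightarrow> 'a set \<times> ('a set \<times> 'a set \<Rightarrow>\<^sub>0 int) set \<Rightarrow> ('a \<Rightarrow>\<^sub>0 int) set" where
  "p2i_mu2 G B = (\<lambda>(u, v). p2_bar G B u \<otimes>\<^bsub>P2 G B\<^esub> mu2 G B v)"

text \<open>The maps \<open>\<rho>\<^sub>1\<close> and \<open>\<rho>\<^sub>2\<close> are induced by \<open>\<Sum> n\<^sub>a a \<mapsto> \<Prod> (aN)^(n\<^sub>a)\<close>, with \<open>N = G'\<close> and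
  \<open>N = BG'\<close> respectively.\<close>

definition rho1 :: "('a, 'm) monoid_scheme \<Rightarrow> 'a set \<Rightarrow> ('a \<Rightarrow>\<^sub>0 int) set \<Rightarrow> 'a set" where
  "rho1 G B = coset_map (free_lift (abelianization G) (\<lambda>a. derived_subgroup G #>\<^bsub>G\<^esub> a))"

definition rho2 :: "('a, 'm) monoid_scheme \<Rightarrow> 'a set \<Rightarrow> ('a \<Rightarrow>\<^sub>0 int) set \<Rightarrow> 'a set" where
  "rho2 G B = coset_map (free_lift (G_mod_BG' G B) (\<lambda>a. BG' G B #>\<^bsub>G\<^esub> a))"


section \<open>Exactness and commutative squares\<close>

text \<open>\<open>exact_seq\<close> of the library is not used because it requires all groups to have elements of
  one type.\<close>
definition exact_at ::
  "('a, 'k) monoid_scheme \<Rightarrow> ('b, 'l) monoid_scheme \<Rightarrow> ('c, 'm) monoid_scheme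
     \<Rightarrow> ('a \<Rightarrow> 'b) \<Rightarrow> ('b \<Rightarrow> 'c) \<Rightarrow> bool" where
  "exact_at K M N f g \<longleftrightarrow> f \<in> hom K M \<and> g \<in> hom M N \<and> f ` carrier K = kernel M N g"

text \<open>\<open>0 \<rightarrow> K \<rightarrow> M \<rightarrow> N \<rightarrow> 0\<close> and \<open>0 \<rightarrow> K \<rightarrow> L \<rightarrow> M \<rightarrow> N \<rightarrow> 0\<close>.\<close>
definition exact3 ::
  "('a, 'k) monoid_scheme \<Rightarrow> ('b, 'l) monoid_scheme \<Rightarrow> ('c, 'm) monoid_scheme
     \<Rightarrow> ('a \<Rightarrow> 'b) \<Rightarrow> ('b \<Rightarrow> 'c) \<Rightarrow> bool" where
  "exact3 K M N f g \<longleftrightarrow> comm_group K \<and> comm_group M \<and> comm_group N \<and>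
     f \<in> mon K M \<and> exact_at K M N f g \<and> g \<in> epi M N"

definition exact4 ::
  "('a, 'k) monoid_scheme \<Rightarrow> ('d, 'j) monoid_scheme \<Rightarrow> ('b, 'l) monoid_scheme \<Rightarrow> ('c, 'm) monoid_scheme
     \<Rightarrow> ('a \<Rightarrow> 'd) \<Rightarrow> ('d \<Rightarrow> 'b) \<Rightarrow> ('b \<Rightarrow> 'c) \<Rightarrow> bool" where
  "exact4 K L M N f g h \<longleftrightarrow> comm_group K \<and> comm_group L \<and> comm_group M \<and> comm_group N \<and>
     f \<in> mon K L \<and> exact_at K L M f g \<and> exact_at L M N g h \<and> h \<in> epi M N"

text \<open>The square with horizontal arrows \<open>f : K \<rightarrow> M\<close>, \<open>f' : K' \<rightarrow> M'\<close> and vertical arrows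
  \<open>u : K \<rightarrow> K'\<close>, \<open>v : M \<rightarrow> M'\<close> commutes.\<close>
definition commutes ::
  "('a, 'k) monoid_scheme \<Rightarrow> ('b, 'l) monoid_scheme \<Rightarrow> ('c, 'm) monoid_scheme \<Rightarrow> ('d, 'n) monoid_scheme
     \<Rightarrow> ('a \<Rightarrow> 'b) \<Rightarrow> ('c \<Rightarrow> 'd) \<Rightarrow> ('a \<Rightarrow> 'c) \<Rightarrow> ('b \<Rightarrow> 'd) \<Rightarrow> bool" where
  "commutes K M K' M' f f' u v \<longleftrightarrow> u \<in> hom K K' \<and> v \<in> hom M M' \<and>
     (\<forall>x\<in>carrier K. v (f x) = f' (u x))"

end

theory Submission imports Defs
begin

text \<open>
  The function \<open>p\<^sub>2\<close> satisfies \<open>p\<^sub>2(ab) = p\<^sub>2(a) + p\<^sub>2(b) + p\<^sub>2(a) p\<^sub>2(b)\<close>, the product \<open>p\<^sub>2(a) p\<^sub>2(b)\<close> is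
  bimultiplicative in \<open>a\<close> and \<open>b\<close> and vanishes for \<open>a \<in> B\<close>, and \<open>P\<^sub>2(G,B)\<close> is universal among the
  abelian groups with such a function (\<open>P2_universal\<close>).  The homomorphisms out of \<open>P\<^sub>2(G,B)\<close> come from
  this property, and identities between homomorphisms, in particular naturality, are checked on
  the generators \<open>p\<^sub>2(a)\<close>, \<open>a \<otimes> b\<close> and \<open>a \<and> b\<close>, where elements of \<open>G\<close> also denote their classes in
  \<open>G/BG'\<close>.

  Expanding \<open>p\<^sub>2\<close> on both sides of \<open>[a, b]ba = ab\<close> gives \<open>p\<^sub>2[a, b] = p\<^sub>2(a) p\<^sub>2(b) - p\<^sub>2(b) p\<^sub>2(a)\<close>, that
  is, \<open>p\<^sub>2 i c\<^sub>2 = \<mu>\<^sub>2 l\<^sub>2\<close>.  Conversely, let \<open>p\<^sub>2(u) + \<mu>\<^sub>2(t) = 0\<close> with \<open>u \<in> BG'\<close>.  Let \<open>E\<close> be the extension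
  of \<open>G\<close> by the tensor square with the multiplication \<open>(a, s)(b, t) = (ab, s + t - a \<otimes> b)\<close>.  In the
  abelianization of \<open>E\<close>, the map \<open>a \<mapsto> (a, 0)\<close> has the properties of \<open>p\<^sub>2\<close>, with \<open>(1, a \<otimes> b)\<close> in place
  of \<open>p\<^sub>2(a) p\<^sub>2(b)\<close>.  By the universal property, \<open>(u, t)\<close> is trivial in the abelianization of \<open>E\<close>.  The
  commutators of \<open>E\<close> are the pairs \<open>([a, b], -l\<^sub>2(a \<and> b))\<close>, so \<open>(u, t)\<close>, with \<open>u\<close> taken modulo
  \<open>\<gamma>\<^sub>3(G)\<close>, lies in the image of \<open>(c\<^sub>2, -l\<^sub>2)\<^sup>t\<close> (\<open>relation_from_P2\<close>).  Together with the injectivity of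
  \<open>l\<^sub>2\<close>, this gives the left parts of the three sequences.  Exactness at \<open>P\<^sub>2(G,B)\<close> holds in the first two
  because every element of \<open>P\<^sub>2(G,B)\<close> has the form \<open>p\<^sub>2(a) + \<mu>\<^sub>2(t)\<close> (\<open>p2_decomp\<close>), and in the third one
  because \<open>p\<^sub>2\<close> modulo \<open>p\<^sub>2(B)\<close> factors through \<open>G/B\<close>.

  The injectivity of \<open>l\<^sub>2\<close> holds for every abelian group \<open>A\<close>.  Instead of reducing it to direct sums of
  cyclic groups, the proof works with integer matrices \<open>w\<close> indexed by finitely many elements \<open>a\<^sub>i\<close> of
  \<open>A\<close>: if \<open>\<Sum>\<^sub>j (w\<^sub>i\<^sub>j - w\<^sub>j\<^sub>i) a\<^sub>j = 0\<close> for all \<open>i\<close>, then \<open>\<Sum> w\<^sub>i\<^sub>j a\<^sub>i \<and> a\<^sub>j = 0\<close>.  For a tridiagonal alternating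
  matrix \<open>w - w\<^sup>T\<close> with the entries \<open>m\<^sub>1, m\<^sub>2, \<dots>\<close> above the diagonal, the hypothesis reads \<open>m\<^sub>1 a\<^sub>2 = 0\<close> and
  \<open>m\<^sub>k a\<^sub>k\<^sub>+\<^sub>1 = m\<^sub>k\<^sub>-\<^sub>1 a\<^sub>k\<^sub>-\<^sub>1\<close>, and the conclusion holds because each \<open>m\<^sub>k a\<^sub>k \<and> a\<^sub>k\<^sub>+\<^sub>1\<close> vanishes by induction,
  being \<open>a\<^sub>k \<and> m\<^sub>k\<^sub>-\<^sub>1 a\<^sub>k\<^sub>-\<^sub>1 = - m\<^sub>k\<^sub>-\<^sub>1 a\<^sub>k\<^sub>-\<^sub>1 \<and> a\<^sub>k\<close>.  The Euclidean algorithm brings every alternating matrix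
  to this form (\<open>alternating_core\<close>).
\<close>

section \<open>Additive subgroups and biadditive maps\<close>

text \<open>Additive subgroups of a type, used for subgroups of free abelian groups.  Closure under
  subtraction is the form that fits induction over free abelian groups.\<close>
definition add_subgroup :: "'a::ab_group_add set \<Rightarrow> bool" where
  "add_subgroup S \<longleftrightarrow> 0 \<in> S \<and> (\<forall>x\<in>S. \<forall>y\<in>S. x - y \<in> S)"

lemma add_subgroupI:
  assumes "0 \<in> S" and "\<And>x y. x \<in> S \<Longrightarrow> y \<in> S \<Longrightarrow> x - y \<in> S"
  shows "add_subgroup S"
  using assms by (auto simp: add_subgroup_def)

lemma add_subgroup_zero: "add_subgroup S \<Longrightarrow> 0 \<in> S"
  by (simp add: add_subgroup_def)

lemma add_subgroup_diff: "add_subgroup S \<Longrightarrow> x \<in> S \<Longrightarrow> y \<in> S \<Longrightarrow> x - y \<in> S"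
  by (simp add: add_subgroup_def)

lemma add_subgroup_minus: "add_subgroup S \<Longrightarrow> x \<in> S \<Longrightarrow> - x \<in> S"
  using add_subgroup_diff[of S 0 x] by (simp add: add_subgroup_zero)

lemma add_subgroup_add: "add_subgroup S \<Longrightarrow> x \<in> S \<Longrightarrow> y \<in> S \<Longrightarrow> x + y \<in> S"
  using add_subgroup_diff[of S x "- y"] by (simp add: add_subgroup_minus)

lemma add_subgroup_sum:
  "add_subgroup S \<Longrightarrow> (\<And>i. i \<in> I \<Longrightarrow> f i \<in> S) \<Longrightarrow> sum f I \<in> S"
  by (induction I rule: infinite_finite_induct) (auto simp: add_subgroup_zero add_subgroup_add)

lemma add_subgroup_cmul:
  "add_subgroup S \<Longrightarrow> x \<in> S \<Longrightarrow> frag_cmul k x \<in> S"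
  by (rule frag_closure_minus_cmul) (auto simp: add_subgroup_zero add_subgroup_diff)

lemma add_subgroup_keys: "add_subgroup {x :: 'a \<Rightarrow>\<^sub>0 int. Poly_Mapping.keys x \<subseteq> S}"
  by (rule add_subgroupI) (auto dest: subsetD[OF keys_diff])

lemma add_subgroup_generate:
  assumes "X \<subseteq> carrier (free_Abelian_group S)"
  shows "add_subgroup (generate (free_Abelian_group S) X)"
proof -
  interpret F: group "free_Abelian_group S" by simp
  have sub: "subgroup (generate (free_Abelian_group S) X) (free_Abelian_group S)"
    by (rule F.generate_is_subgroup[OF assms])
  show ?thesis
  proof (rule add_subgroupI)
    show "0 \<in> generate (free_Abelian_group S) X"
      using subgroup.one_closed[OF sub] by simp
  next
    fix x y assume x: "x \<in> generate (free_Abelian_group S) X" and y: "y \<in> generate (free_Abelian_group S) X"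
    from y have "inv\<^bsub>free_Abelian_group S\<^esub> y \<in> generate (free_Abelian_group S) X"
      by (rule subgroup.m_inv_closed[OF sub])
    moreover have "Poly_Mapping.keys y \<subseteq> S"
      using subgroup.mem_carrier[OF sub y] by simp
    ultimately have "- y \<in> generate (free_Abelian_group S) X" by simp
    from subgroup.m_closed[OF sub x this] show "x - y \<in> generate (free_Abelian_group S) X" by simp
  qed
qed

lemma generate_free_subset:
  assumes "X \<subseteq> carrier (free_Abelian_group S)" and "add_subgroup J" and "X \<subseteq> J"
  shows "generate (free_Abelian_group S) X \<subseteq> J"
proof
  fix x assume "x \<in> generate (free_Abelian_group S) X"
  then show "x \<in> J"
  proof induction
    case (inv h)
    then have "h \<in> carrier (free_Abelian_group S)" using assms(1) by blast
    then show ?case using inv assms by (auto simp: add_subgroup_minus)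
  qed (use assms in \<open>auto intro: add_subgroup_zero add_subgroup_add\<close>)
qed

text \<open>The biadditive extension of \<open>f\<close> from the bases to the free abelian groups.\<close>
definition biextend :: "('a \<Rightarrow> 'b \<Rightarrow> 'c \<Rightarrow>\<^sub>0 int) \<Rightarrow> ('a \<Rightarrow>\<^sub>0 int) \<Rightarrow> ('b \<Rightarrow>\<^sub>0 int) \<Rightarrow> 'c \<Rightarrow>\<^sub>0 int" where
  "biextend f x y = frag_extend (\<lambda>a. frag_extend (f a) y) x"

lemma biextend_of [simp]: "biextend f (frag_of a) (frag_of b) = f a b"
  by (simp add: biextend_def)

lemma biextend_zero [simp]: "biextend f 0 y = 0" "biextend f x 0 = 0"
  by (simp_all add: biextend_def frag_extend_eq_0)

lemma biextend_diff_left: "biextend f (x - x') y = biextend f x y - biextend f x' y"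
  by (simp add: biextend_def frag_extend_diff)

lemma frag_cmul_diff_right: "frag_cmul k (x - y) = frag_cmul k x - frag_cmul k y"
  by (rule poly_mapping_eqI) (simp add: lookup_minus algebra_simps)

lemma frag_extend_fun_diff:
  "frag_extend (\<lambda>a. g a - h a) x = frag_extend g x - frag_extend h x"
  by (rule frag_induction[of x UNIV]) (auto simp: frag_extend_diff)

lemma biextend_diff_right: "biextend f x (y - y') = biextend f x y - biextend f x y'"
  by (simp add: biextend_def frag_extend_diff frag_extend_fun_diff)

lemma biextend_minus: "biextend f (- x) y = - biextend f x y" "biextend f x (- y) = - biextend f x y"
  using biextend_diff_left[of f 0 x y] biextend_diff_right[of f x 0 y] by simp_all

lemma biextend_add: "biextend f (x + x') y = biextend f x y + biextend f x' y"
   "biextend f x (y + y') = biextend f x y + biextend f x y'"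
  using biextend_diff_left[of f x "- x'" y] biextend_diff_right[of f x y "- y'"]
  by (simp_all add: biextend_minus)

lemma biextend_sum: "biextend f (sum g I) y = (\<Sum>i\<in>I. biextend f (g i) y)"
   "biextend f x (sum h I) = (\<Sum>i\<in>I. biextend f x (h i))"
  by (induction I rule: infinite_finite_induct) (simp_all add: biextend_add)

lemma biextend_cmul: "biextend f (frag_cmul k x) y = frag_cmul k (biextend f x y)"
   "biextend f x (frag_cmul k y) = frag_cmul k (biextend f x y)"
proof -
  show "biextend f (frag_cmul k x) y = frag_cmul k (biextend f x y)"
    by (simp add: biextend_def frag_extend_cmul)
  show "biextend f x (frag_cmul k y) = frag_cmul k (biextend f x y)"
    by (rule frag_induction[of x UNIV])
      (auto simp: biextend_def frag_extend_cmul frag_extend_diff frag_cmul_diff_right)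
qed

section \<open>Alternating integer matrices\<close>

text \<open>The tensor product of elements of free abelian groups, written as a matrix.\<close>
abbreviation outer :: "('a \<Rightarrow>\<^sub>0 int) \<Rightarrow> ('b \<Rightarrow>\<^sub>0 int) \<Rightarrow> ('a \<times> 'b \<Rightarrow>\<^sub>0 int)" where
  "outer \<equiv> biextend (\<lambda>a b. frag_of (a, b))"

lemma sum_split_one:
  fixes f :: "'i \<Rightarrow> 'b::ab_group_add"
  assumes "finite I" "i \<in> I"
  shows "sum f I = f i + sum f (I - {i})"
  using assms by (simp add: sum.remove)

text \<open>The heart of the injectivity of \<open>a \<and> b \<mapsto> a \<otimes> b - b \<otimes> a\<close>.  With \<open>h = 0\<close> and \<open>r = 0\<close> it says
  that if all rows of the alternating matrix \<open>w - w\<^sup>T\<close> give relations \<open>\<Sum>\<^sub>j (w\<^sub>i\<^sub>j - w\<^sub>j\<^sub>i) e\<^sub>j = 0\<close>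
  modulo \<open>R\<close>, then \<open>\<Sum> w\<^sub>i\<^sub>j e\<^sub>i \<and> e\<^sub>j = 0\<close>, where \<open>K\<close> stands for the relations of the exterior square.
  Doubling this sum shows only that it is 2-torsion.  The proof brings \<open>w - w\<^sup>T\<close> to tridiagonal form
  by the Euclidean algorithm.  The element \<open>h\<close> is the \<open>e\<^sub>i\<close> split off last and \<open>r\<close> its row in
  \<open>w - w\<^sup>T\<close>.  Transvections of the \<open>e\<^sub>i\<close> shrink \<open>r\<close> until at most one coefficient \<open>r\<^sub>i\<close> is left.  Then
  \<open>e\<^sub>i\<close> is split off in turn, because the terms with \<open>e\<^sub>i\<close> contribute \<open>e\<^sub>i \<and> r\<^sub>i h\<close>, which vanishes.\<close>
lemma alternating_core:
  fixes e :: "'i \<Rightarrow> ('a \<Rightarrow>\<^sub>0 int)" and w :: "'i \<Rightarrow> 'i \<Rightarrow> int" and r :: "'i \<Rightarrow> int"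
  assumes F: "add_subgroup F" and R: "add_subgroup R" and K: "add_subgroup K"
    and FR: "\<And>f g. f \<in> F \<Longrightarrow> g \<in> R \<Longrightarrow> outer f g \<in> K"
    and FF: "\<And>f. f \<in> F \<Longrightarrow> outer f f \<in> K"
    and "finite I" and "e \<in> I \<rightarrow> F" and "h \<in> F"
    and "\<And>i. i \<in> I \<Longrightarrow> (\<Sum>j\<in>I. frag_cmul (w i j - w j i) (e j)) - frag_cmul (r i) h \<in> R"
    and "outer (\<Sum>i\<in>I. frag_cmul (r i) (e i)) h \<in> K"
  shows "(\<Sum>i\<in>I. \<Sum>j\<in>I. frag_cmul (w i j) (outer (e i) (e j))) \<in> K"
proof -
  have anti: "outer f g + outer g f \<in> K" if "f \<in> F" "g \<in> F" for f g
  proof -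
    have "outer (f + g) (f + g) - outer f f - outer g g \<in> K"
      using that F K by (intro add_subgroup_diff FF) (auto intro: add_subgroup_add)
    then show ?thesis by (simp add: biextend_add algebra_simps)
  qed
  \<comment> \<open>Induction on the size of \<open>I\<close> and, for fixed size, on the sum of the \<open>\<bar>r\<^sub>i\<bar>\<close>.\<close>
  define m where "m I r = (card I, \<Sum>i\<in>I. nat \<bar>r i\<bar>)" for I :: "'i set" and r :: "'i \<Rightarrow> int"
  have wf: "wf (inv_image (less_than <*lex*> less_than) (\<lambda>(I, r, e, h, w). m I r))"
    by auto
  let ?P = "\<lambda>(I, r, e, h, w). finite I \<longrightarrow> e \<in> I \<rightarrow> F \<longrightarrow> h \<in> F \<longrightarrow>
     (\<forall>i\<in>I. (\<Sum>j\<in>I. frag_cmul (w i j - w j i) (e j)) - frag_cmul (r i) h \<in> R) \<longrightarrow>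
     outer (\<Sum>i\<in>I. frag_cmul (r i) (e i)) h \<in> K \<longrightarrow>
     (\<Sum>i\<in>I. \<Sum>j\<in>I. frag_cmul (w i j) (outer (e i) (e j))) \<in> K"
  have "?P (I, r, e, h, w)"
  proof (induction "(I, r, e, h, w)" arbitrary: I r e h w rule: wf_induct_rule[OF wf])
    case (1 I r e h w)
    have IH: "(\<Sum>i\<in>I'. \<Sum>j\<in>I'. frag_cmul (w' i j) (outer (e' i) (e' j))) \<in> K"
      if "(m I' r', m I r) \<in> less_than <*lex*> less_than" "finite I'" "e' \<in> I' \<rightarrow> F" "h' \<in> F"
       "\<And>i. i \<in> I' \<Longrightarrow> (\<Sum>j\<in>I'. frag_cmul (w' i j - w' j i) (e' j)) - frag_cmul (r' i) h' \<in> R"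
       "outer (\<Sum>i\<in>I'. frag_cmul (r' i) (e' i)) h' \<in> K" for I' r' e' h' w'
      using 1[of I' r' e' h' w'] that by auto
    show ?case
    proof (clarsimp)
      assume fin: "finite I" and e: "e \<in> I \<rightarrow> F" and h: "h \<in> F"
        and row: "\<forall>i\<in>I. (\<Sum>j\<in>I. frag_cmul (w i j - w j i) (e j)) - frag_cmul (r i) h \<in> R"
        and head: "outer (\<Sum>i\<in>I. frag_cmul (r i) (e i)) h \<in> K"
      let ?S = "\<Sum>i\<in>I. \<Sum>j\<in>I. frag_cmul (w i j) (outer (e i) (e j))"
      consider "I = {}" | i j where "i \<in> I" "j \<in> I" "i \<noteq> j" "r i \<noteq> 0" "r j \<noteq> 0" "\<bar>r j\<bar> \<le> \<bar>r i\<bar>"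
        | i where "i \<in> I" "\<And>j. j \<in> I \<Longrightarrow> j \<noteq> i \<Longrightarrow> r j = 0"
        by (metis all_not_in_conv linorder_linear)
      then show "?S \<in> K"
      proof cases
        case 1 then show ?thesis by (simp add: add_subgroup_zero K)
      next
        case (2 i j)
        define c where "c = sgn (r i) * sgn (r j)"
        define e' where "e' = e(j := e j + frag_cmul c (e i))"
        define r' where "r' = r(i := r i - c * r j)"
        define w1 where "w1 k l = w k l - (if k = i then c * w j l else 0)" for k l
        define w' where "w' k l = w1 k l - (if l = i then c * w1 k j else 0)" for k l
        \<comment> \<open>The \<open>e'\<close> are the new vectors and \<open>lin\<close> gives the dual change of coefficients, which leads
          to \<open>w'\<close> when it is applied to the columns and to the rows of \<open>w\<close>.\<close>
        have lin: "(\<Sum>k\<in>I. frag_cmul (x k - (if k = i then c * x j else 0)) (e' k)) = (\<Sum>k\<in>I. frag_cmul (x k) (e k))"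
          for x
        proof -
          have ij: "i \<in> I - {j}" using 2 by auto
          have eq: "(\<Sum>k\<in>I - {j} - {i}. frag_cmul (x k - (if k = i then c * x j else 0)) (e' k))
             = (\<Sum>k\<in>I - {j} - {i}. frag_cmul (x k) (e k))"
            by (rule sum.cong) (auto simp: e'_def)
          show ?thesis
            using 2 fin unfolding sum_split_one[OF fin \<open>j \<in> I\<close>] sum_split_one[OF finite_Diff[OF fin] ij] eq
            by (simp add: e'_def frag_cmul_distrib2 frag_cmul_diff_distrib algebra_simps)
        qed
        have S': "(\<Sum>k\<in>I. \<Sum>l\<in>I. frag_cmul (w' k l) (outer (e' k) (e' l))) = ?S"
        proof -
          have "(\<Sum>k\<in>I. \<Sum>l\<in>I. frag_cmul (w' k l) (outer (e' k) (e' l)))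
              = (\<Sum>k\<in>I. outer (e' k) (\<Sum>l\<in>I. frag_cmul (w' k l) (e' l)))"
            by (simp add: biextend_sum biextend_cmul)
          also have "\<dots> = (\<Sum>k\<in>I. outer (e' k) (\<Sum>l\<in>I. frag_cmul (w1 k l) (e l)))"
            unfolding w'_def by (simp only: lin)
          also have "\<dots> = (\<Sum>k\<in>I. \<Sum>l\<in>I. frag_cmul (w1 k l) (outer (e' k) (e l)))"
            by (simp add: biextend_sum biextend_cmul)
          also have "\<dots> = (\<Sum>l\<in>I. \<Sum>k\<in>I. frag_cmul (w1 k l) (outer (e' k) (e l)))"
            by (rule sum.swap)
          also have "\<dots> = (\<Sum>l\<in>I. outer (\<Sum>k\<in>I. frag_cmul (w1 k l) (e' k)) (e l))"
            by (simp add: biextend_sum biextend_cmul)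
          also have "\<dots> = (\<Sum>l\<in>I. outer (\<Sum>k\<in>I. frag_cmul (w k l) (e k)) (e l))"
            unfolding w1_def by (simp only: lin[of "\<lambda>k. w k _"])
          also have "\<dots> = (\<Sum>l\<in>I. \<Sum>k\<in>I. frag_cmul (w k l) (outer (e k) (e l)))"
            by (simp add: biextend_sum biextend_cmul)
          also have "\<dots> = ?S" by (rule sum.swap)
          finally show ?thesis .
        qed
        have rows: "(\<Sum>l\<in>I. frag_cmul (w' k l - w' l k) (e' l)) - frag_cmul (r' k) h \<in> R" if k: "k \<in> I" for k
        proof -
          define row where "row k = (\<Sum>j\<in>I. frag_cmul (w k j - w j k) (e j))" for k
          have "(\<Sum>l\<in>I. frag_cmul (w' k l) (e' l)) = (\<Sum>l\<in>I. frag_cmul (w1 k l) (e l))"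
            unfolding w'_def by (simp only: lin)
          also have "\<dots> = (\<Sum>l\<in>I. frag_cmul (w k l) (e l))
              - (if k = i then frag_cmul c (\<Sum>l\<in>I. frag_cmul (w j l) (e l)) else 0)"
            by (simp add: w1_def frag_cmul_diff_distrib sum_subtractf frag_cmul_sum)
          finally have a: "(\<Sum>l\<in>I. frag_cmul (w' k l) (e' l)) = \<dots>" .
          have b1: "(\<Sum>l\<in>I. frag_cmul (w1 l k) (e' l)) = (\<Sum>l\<in>I. frag_cmul (w l k) (e l))" for k
            unfolding w1_def by (simp only: lin[of "\<lambda>l. w l k"])
          have b: "(\<Sum>l\<in>I. frag_cmul (w' l k) (e' l)) = (\<Sum>l\<in>I. frag_cmul (w l k) (e l))
              - (if k = i then frag_cmul c (\<Sum>l\<in>I. frag_cmul (w l j) (e l)) else 0)"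
            unfolding b1[symmetric]
            by (simp add: w'_def frag_cmul_diff_distrib sum_subtractf frag_cmul_sum)
          have "(\<Sum>l\<in>I. frag_cmul (w' k l - w' l k) (e' l))
              = row k - (if k = i then frag_cmul c (row j) else 0)"
            by (simp add: frag_cmul_diff_distrib sum_subtractf a b row_def frag_cmul_diff_right)
          moreover have "frag_cmul (r' k) h = frag_cmul (r k) h - (if k = i then frag_cmul c (frag_cmul (r j) h) else 0)"
            by (simp add: r'_def frag_cmul_diff_distrib)
          ultimately have eq: "(\<Sum>l\<in>I. frag_cmul (w' k l - w' l k) (e' l)) - frag_cmul (r' k) h
              = (row k - frag_cmul (r k) h) - (if k = i then frag_cmul c (row j - frag_cmul (r j) h) else 0)"
            by (simp add: frag_cmul_diff_right)
          have rowR: "row k - frag_cmul (r k) h \<in> R" if "k \<in> I" for k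
            using row that by (simp add: row_def)
          show ?thesis unfolding eq
            by (rule add_subgroup_diff[OF R])
              (use rowR 2 k in \<open>auto intro: add_subgroup_cmul[OF R] add_subgroup_zero[OF R]\<close>)
        qed
        have "(\<Sum>k\<in>I. nat \<bar>r' k\<bar>) < (\<Sum>k\<in>I. nat \<bar>r k\<bar>)"
        proof (rule sum_strict_mono_ex1)
          have less: "\<bar>r i - c * r j\<bar> < \<bar>r i\<bar>"
            using 2 by (auto simp: c_def sgn_if abs_if split: if_splits)
          then show "\<forall>k\<in>I. nat \<bar>r' k\<bar> \<le> nat \<bar>r k\<bar>" "\<exists>k\<in>I. nat \<bar>r' k\<bar> < nat \<bar>r k\<bar>"
            using 2 by (auto simp: r'_def intro!: bexI[of _ i])
        qed (rule fin)
        then have meas: "(m I r', m I r) \<in> less_than <*lex*> less_than" by (simp add: m_def)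
        have e'F: "e' \<in> I \<rightarrow> F"
          using e 2 F by (auto simp: e'_def Pi_iff intro!: add_subgroup_add add_subgroup_cmul)
        have r': "r' k = r k - (if k = i then c * r j else 0)" for k by (simp add: r'_def)
        have head': "outer (\<Sum>k\<in>I. frag_cmul (r' k) (e' k)) h \<in> K"
          unfolding r' by (simp only: lin head)
        show ?thesis
          using IH[OF meas fin e'F h rows head'] by (simp only: S')
      next
        case (3 i)
        \<comment> \<open>Split off \<open>e\<^sub>i\<close>, which becomes the new \<open>h\<close>, with the row \<open>w\<^sub>i\<^sub>k - w\<^sub>k\<^sub>i\<close> as the new \<open>r\<close>.\<close>
        define I' where "I' = I - {i}"
        define x where "x = (\<Sum>l\<in>I'. frag_cmul (w i l - w l i) (e l))"
        have finI': "finite I'" and eI': "e \<in> I' \<rightarrow> F" and ei: "e i \<in> F"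
          using fin e 3 by (auto simp: I'_def)
        have xF: "x \<in> F"
          unfolding x_def using eI' F by (auto intro!: add_subgroup_sum add_subgroup_cmul)
        note split = sum_split_one[OF fin \<open>i \<in> I\<close>, folded I'_def]
        have "(\<Sum>k\<in>I'. frag_cmul (r k) (e k)) = 0"
          using 3 by (auto intro!: sum.neutral simp: I'_def)
        with head have riK: "frag_cmul (r i) (outer (e i) h) \<in> K"
          by (simp add: split biextend_cmul)
        have xR: "x - frag_cmul (r i) h \<in> R"
          using row 3 by (auto simp: split x_def)
        have ixK: "outer (e i) x \<in> K"
          using add_subgroup_add[OF K FR[OF ei xR] riK] by (simp add: biextend_diff_right biextend_cmul)
        then have xiK: "outer x (e i) \<in> K"
          using add_subgroup_diff[OF K anti[OF xF ei] ixK] by simp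
        have rows: "(\<Sum>j\<in>I'. frag_cmul (w k j - w j k) (e j)) - frag_cmul (w i k - w k i) (e i) \<in> R"
          if "k \<in> I'" for k
        proof -
          have "k \<in> I" "r k = 0" using that 3 by (auto simp: I'_def)
          with row have "(\<Sum>j\<in>I. frag_cmul (w k j - w j k) (e j)) \<in> R" by auto
          then show ?thesis by (simp add: split frag_cmul_diff_distrib algebra_simps)
        qed
        have "card I' < card I" using card_Diff1_less[OF fin 3(1)] by (simp add: I'_def)
        then have "(m I' (\<lambda>k. w i k - w k i), m I r) \<in> less_than <*lex*> less_than"
          by (simp add: m_def)
        from IH[OF this finI' eI' ei rows xiK[unfolded x_def]]
        have rest: "(\<Sum>k\<in>I'. \<Sum>j\<in>I'. frag_cmul (w k j) (outer (e k) (e j))) \<in> K" .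
        have cross: "(\<Sum>k\<in>I'. frag_cmul (w k i) (outer (e i) (e k) + outer (e k) (e i))) \<in> K"
          using anti eI' ei by (intro add_subgroup_sum add_subgroup_cmul K) auto
        have "?S = frag_cmul (w i i) (outer (e i) (e i)) + outer (e i) x
            + (\<Sum>k\<in>I'. frag_cmul (w k i) (outer (e i) (e k) + outer (e k) (e i)))
            + (\<Sum>k\<in>I'. \<Sum>j\<in>I'. frag_cmul (w k j) (outer (e k) (e j)))"
          by (simp add: split sum.distrib x_def biextend_diff_right biextend_sum biextend_cmul frag_cmul_diff_distrib
              sum_subtractf frag_cmul_distrib2 algebra_simps)
        then show ?thesis
          using rest cross ixK FF[OF ei] K by (auto intro!: add_subgroup_add add_subgroup_cmul)
      qed
    qed
  qed
  then show ?thesis using assms(6-) by auto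
qed

section \<open>Homomorphisms out of quotients, free abelian groups and tensor products\<close>

lemma coset_mapI: "X \<noteq> {} \<Longrightarrow> (\<And>x. x \<in> X \<Longrightarrow> h x = y) \<Longrightarrow> coset_map h X = y"
  unfolding coset_map_def by (metis image_constant_conv image_cong the_elem_eq)

lemma r_coset_memE:
  assumes "y \<in> N #>\<^bsub>G\<^esub> x"
  obtains n where "n \<in> N" "y = n \<otimes>\<^bsub>G\<^esub> x"
  using assms by (auto simp: r_coset_def)

lemma (in subgroup) r_coset_nonempty: "H #> x \<noteq> {}"
  using one_closed unfolding r_coset_def by blast

lemma (in group) r_coset_eq_iff:
  assumes "subgroup N G" "x \<in> carrier G" "y \<in> carrier G"
  shows "N #> x = N #> y \<longleftrightarrow> x \<otimes> inv y \<in> N"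
proof -
  interpret N: subgroup N G by fact
  show ?thesis
    using assms by (metis N.rcos_module is_group rcos_self repr_independence)
qed

lemma (in group) r_coset_eq_self_iff:
  assumes "subgroup N G" "x \<in> carrier G"
  shows "N #> x = N \<longleftrightarrow> x \<in> N"
  using r_coset_eq_iff[OF assms one_closed] assms subgroup.subset[OF assms(1)] by simp

lemma carrier_FactGroupE:
  assumes "X \<in> carrier (G Mod N)"
  obtains x where "x \<in> carrier G" "X = N #>\<^bsub>G\<^esub> x"
  using assms by (auto simp: carrier_FactGroup)

lemma coset_map_rcoset:
  assumes "N \<lhd> G" "group H" "h \<in> hom G H" "\<And>n. n \<in> N \<Longrightarrow> h n = \<one>\<^bsub>H\<^esub>" "x \<in> carrier G"
  shows "coset_map h (N #>\<^bsub>G\<^esub> x) = h x"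
proof (rule coset_mapI)
  interpret N: normal N G by fact
  interpret H: group H by fact
  show "N #>\<^bsub>G\<^esub> x \<noteq> {}" by (rule N.r_coset_nonempty)
  fix y assume "y \<in> N #>\<^bsub>G\<^esub> x"
  then obtain n where "n \<in> N" "y = n \<otimes>\<^bsub>G\<^esub> x" by (rule r_coset_memE)
  then show "h y = h x"
    using assms hom_mult[OF assms(3), of n x] hom_in_carrier[OF assms(3,5)]
    by (simp add: N.mem_carrier)
qed

lemma coset_map_hom:
  assumes "N \<lhd> G" "group H" "h \<in> hom G H" "\<And>n. n \<in> N \<Longrightarrow> h n = \<one>\<^bsub>H\<^esub>"
  shows "coset_map h \<in> hom (G Mod N) H"
proof (rule homI)
  interpret N: normal N G by fact
  note eq = coset_map_rcoset[OF assms]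
  fix X assume "X \<in> carrier (G Mod N)"
  then obtain x where x: "x \<in> carrier G" "X = N #>\<^bsub>G\<^esub> x" by (rule carrier_FactGroupE)
  then show "coset_map h X \<in> carrier H" by (simp add: eq hom_in_carrier[OF assms(3)])
  fix Y assume "Y \<in> carrier (G Mod N)"
  then obtain y where y: "y \<in> carrier G" "Y = N #>\<^bsub>G\<^esub> y" by (rule carrier_FactGroupE)
  show "coset_map h (X \<otimes>\<^bsub>G Mod N\<^esub> Y) = coset_map h X \<otimes>\<^bsub>H\<^esub> coset_map h Y"
    using x y by (simp add: N.rcos_sum eq hom_mult[OF assms(3)])
qed

lemma quot_map_rcoset:
  assumes "N \<lhd> G" "M \<lhd> H" "f \<in> hom G H" "f ` N \<subseteq> M" "x \<in> carrier G"
  shows "quot_map H M f (N #>\<^bsub>G\<^esub> x) = M #>\<^bsub>H\<^esub> f x"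
    and "quot_map H M f \<in> hom (G Mod N) (H Mod M)"
proof -
  interpret M: normal M H by fact
  have h: "(\<lambda>x. M #>\<^bsub>H\<^esub> f x) \<in> hom G (H Mod M)"
    using hom_compose[OF assms(3) M.r_coset_hom_Mod] by (simp add: o_def)
  have 1: "M #>\<^bsub>H\<^esub> f n = \<one>\<^bsub>H Mod M\<^esub>" if "n \<in> N" for n
    using assms(4) that by (simp add: M.rcos_const[OF M.is_group] image_subset_iff)
  show "quot_map H M f (N #>\<^bsub>G\<^esub> x) = M #>\<^bsub>H\<^esub> f x"
    unfolding quot_map_def
    by (rule coset_map_rcoset[OF assms(1) M.factorgroup_is_group h 1 assms(5)])
  show "quot_map H M f \<in> hom (G Mod N) (H Mod M)"
    unfolding quot_map_def
    by (rule coset_map_hom[OF assms(1) M.factorgroup_is_group h 1])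
qed

subsection \<open>Generating sets\<close>

text \<open>\<open>X\<close> generates \<open>G\<close>: no proper subgroup contains it.\<close>
definition gens :: "('a, 'm) monoid_scheme \<Rightarrow> 'a set \<Rightarrow> bool" where
  "gens G X \<longleftrightarrow> X \<subseteq> carrier G \<and> (\<forall>J. subgroup J G \<longrightarrow> X \<subseteq> J \<longrightarrow> carrier G \<subseteq> J)"

lemma gens_subgroup: "gens G X \<Longrightarrow> subgroup J G \<Longrightarrow> X \<subseteq> J \<Longrightarrow> x \<in> carrier G \<Longrightarrow> x \<in> J"
  by (auto simp: gens_def)

lemma group_homI: "group G \<Longrightarrow> group H \<Longrightarrow> f \<in> hom G H \<Longrightarrow> group_hom G H f"
  by (simp add: group_hom_def group_hom_axioms_def)

lemma gens_epi:
  assumes "group G" "group H" "gens G X" "h \<in> epi G H"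
  shows "gens H (h ` X)"
proof -
  have h: "h \<in> hom G H" "h ` carrier G = carrier H" using assms(4) by (auto simp: epi_def)
  interpret h: group_hom G H h by (rule group_homI[OF assms(1,2) h(1)])
  show ?thesis unfolding gens_def
  proof (intro conjI allI impI)
    have X: "X \<subseteq> carrier G" using assms(3) by (simp add: gens_def)
    show "h ` X \<subseteq> carrier H" using assms(3) h by (auto simp: gens_def)
    fix J assume J: "subgroup J H" "h ` X \<subseteq> J"
    have sub: "subgroup {x \<in> carrier G. h x \<in> J} G"
      using J(1) by (intro subgroup.intro)
        (auto simp: subgroup.m_closed subgroup.m_inv_closed subgroup.one_closed)
    have "h x \<in> J" if "x \<in> carrier G" for x
    proof -
      have "X \<subseteq> {x \<in> carrier G. h x \<in> J}" using J(2) X by auto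
      from gens_subgroup[OF assms(3) sub this that] show ?thesis by simp
    qed
    then show "carrier H \<subseteq> J" unfolding h(2)[symmetric] by (rule image_subsetI)
  qed
qed

lemma (in normal) r_coset_epi: "(\<lambda>x. H #> x) \<in> epi G (G Mod H)"
  using r_coset_hom_Mod by (simp add: epi_def carrier_FactGroup)

lemma gens_FactGroup:
  assumes "N \<lhd> G" "gens G X"
  shows "gens (G Mod N) ((\<lambda>x. N #>\<^bsub>G\<^esub> x) ` X)"
proof -
  interpret N: normal N G by fact
  show ?thesis
    by (rule gens_epi[OF N.is_group N.factorgroup_is_group assms(2) N.r_coset_epi])
qed

lemma hom_eq_on_gens:
  assumes "group G" "group H" "f \<in> hom G H" "g \<in> hom G H" "gens G X"
    and "\<And>x. x \<in> X \<Longrightarrow> f x = g x" "x \<in> carrier G"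
  shows "f x = g x"
proof -
  interpret f: group_hom G H f by (rule group_homI[OF assms(1,2,3)])
  interpret g: group_hom G H g by (rule group_homI[OF assms(1,2,4)])
  have "subgroup {x \<in> carrier G. f x = g x} G"
    by (rule subgroup.intro) auto
  from gens_subgroup[OF assms(5) this _ assms(7)] show ?thesis
    using assms(5,6) by (auto simp: gens_def)
qed

lemma gens_free: "gens (free_Abelian_group S) (frag_of ` S)"
  unfolding gens_def
proof (intro conjI allI impI)
  fix J assume J: "subgroup J (free_Abelian_group S)" "frag_of ` S \<subseteq> J"
  interpret J: subgroup J "free_Abelian_group S" by fact
  have "x \<in> J" if "Poly_Mapping.keys x \<subseteq> S" for x
  proof (rule free_Abelian_group_induct[OF that])
    fix x y assume xy: "Poly_Mapping.keys x \<subseteq> S" "Poly_Mapping.keys y \<subseteq> S" "x \<in> J" "y \<in> J"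
    from J.m_closed[OF xy(3) J.m_inv_closed[OF xy(4)]] show "x - y \<in> J" using xy by simp
  qed (use J J.one_closed in auto)
  then show "carrier (free_Abelian_group S) \<subseteq> J" by auto
qed auto

subsection \<open>Universal properties\<close>

lemma free_lift_hom:
  assumes "comm_group C" "f \<in> S \<rightarrow> carrier C"
  shows "free_lift C f \<in> hom (free_Abelian_group S) C"
proof (rule homI)
  interpret C: comm_group C by fact
  have ext: "free_lift C f x = finprod C (\<lambda>a. f a [^]\<^bsub>C\<^esub> Poly_Mapping.lookup x a) T"
    if "finite T" "Poly_Mapping.keys x \<subseteq> T" "T \<subseteq> S" for x T
    unfolding free_lift_def using that assms(2)
    by (intro C.finprod_mono_neutral_cong_left) (auto simp: in_keys_iff)
  fix x assume x: "x \<in> carrier (free_Abelian_group S)"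
  then show "free_lift C f x \<in> carrier C"
    unfolding free_lift_def using assms(2) by (intro C.finprod_closed) auto
  fix y assume y: "y \<in> carrier (free_Abelian_group S)"
  let ?T = "Poly_Mapping.keys x \<union> Poly_Mapping.keys y"
  have T: "?T \<subseteq> S" using x y by auto
  have "free_lift C f (x + y) = finprod C (\<lambda>a. f a [^]\<^bsub>C\<^esub> Poly_Mapping.lookup (x + y) a) ?T"
    by (rule ext) (use T keys_add[of x y] in auto)
  also have "\<dots> = finprod C (\<lambda>a. f a [^]\<^bsub>C\<^esub> Poly_Mapping.lookup x a \<otimes>\<^bsub>C\<^esub> f a [^]\<^bsub>C\<^esub> Poly_Mapping.lookup y a) ?T"
  proof (rule C.finprod_cong')
    have "f i \<in> carrier C" if "i \<in> ?T" for i using T assms(2) that by auto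
    then show "(\<lambda>a. f a [^]\<^bsub>C\<^esub> Poly_Mapping.lookup x a \<otimes>\<^bsub>C\<^esub> f a [^]\<^bsub>C\<^esub> Poly_Mapping.lookup y a) \<in> ?T \<rightarrow> carrier C"
      "\<And>i. i \<in> ?T \<Longrightarrow> f i [^]\<^bsub>C\<^esub> Poly_Mapping.lookup (x + y) i
         = f i [^]\<^bsub>C\<^esub> Poly_Mapping.lookup x i \<otimes>\<^bsub>C\<^esub> f i [^]\<^bsub>C\<^esub> Poly_Mapping.lookup y i"
      by (auto simp: lookup_add C.int_pow_mult)
  qed simp
  also have "\<dots> = finprod C (\<lambda>a. f a [^]\<^bsub>C\<^esub> Poly_Mapping.lookup x a) ?T
      \<otimes>\<^bsub>C\<^esub> finprod C (\<lambda>a. f a [^]\<^bsub>C\<^esub> Poly_Mapping.lookup y a) ?T"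
    using T assms(2) by (intro C.finprod_multf) auto
  also have "\<dots> = free_lift C f x \<otimes>\<^bsub>C\<^esub> free_lift C f y"
    using ext[of ?T x] ext[of ?T y] T by simp
  finally show "free_lift C f (x \<otimes>\<^bsub>free_Abelian_group S\<^esub> y) = free_lift C f x \<otimes>\<^bsub>C\<^esub> free_lift C f y"
    by simp
qed

lemma free_lift_of:
  assumes "comm_group C" "f a \<in> carrier C"
  shows "free_lift C f (frag_of a) = f a"
proof -
  interpret C: comm_group C by fact
  show ?thesis using assms(2) by (simp add: free_lift_def C.int_pow_1)
qed

text \<open>Bimultiplicative maps, on pairs as they are needed for \<^const>\<open>tensor_lift\<close>.\<close>
definition bimult ::
  "('a, 'm) monoid_scheme \<Rightarrow> ('b, 'n) monoid_scheme \<Rightarrow> ('c, 'k) monoid_scheme \<Rightarrow> ('a \<times> 'b \<Rightarrow> 'c) \<Rightarrow> bool" where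
  "bimult A B C \<phi> \<longleftrightarrow>
     (\<forall>a\<in>carrier A. \<forall>b\<in>carrier B. \<phi> (a, b) \<in> carrier C) \<and>
     (\<forall>a\<in>carrier A. \<forall>a'\<in>carrier A. \<forall>b\<in>carrier B.
        \<phi> (a \<otimes>\<^bsub>A\<^esub> a', b) = \<phi> (a, b) \<otimes>\<^bsub>C\<^esub> \<phi> (a', b)) \<and>
     (\<forall>a\<in>carrier A. \<forall>b\<in>carrier B. \<forall>b'\<in>carrier B.
        \<phi> (a, b \<otimes>\<^bsub>B\<^esub> b') = \<phi> (a, b) \<otimes>\<^bsub>C\<^esub> \<phi> (a, b'))"

lemma bimultI:
  assumes "\<And>a b. a \<in> carrier A \<Longrightarrow> b \<in> carrier B \<Longrightarrow> f a b \<in> carrier C"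
    and "\<And>a a' b. a \<in> carrier A \<Longrightarrow> a' \<in> carrier A \<Longrightarrow> b \<in> carrier B \<Longrightarrow>
      f (a \<otimes>\<^bsub>A\<^esub> a') b = f a b \<otimes>\<^bsub>C\<^esub> f a' b"
    and "\<And>a b b'. a \<in> carrier A \<Longrightarrow> b \<in> carrier B \<Longrightarrow> b' \<in> carrier B \<Longrightarrow>
      f a (b \<otimes>\<^bsub>B\<^esub> b') = f a b \<otimes>\<^bsub>C\<^esub> f a b'"
  shows "bimult A B C (\<lambda>(a, b). f a b)"
  using assms by (simp add: bimult_def)

lemma bimultD:
  assumes "bimult A B C \<phi>"
  shows "a \<in> carrier A \<Longrightarrow> b \<in> carrier B \<Longrightarrow> \<phi> (a, b) \<in> carrier C"
    and "a \<in> carrier A \<Longrightarrow> a' \<in> carrier A \<Longrightarrow> b \<in> carrier B \<Longrightarrow>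
      \<phi> (a \<otimes>\<^bsub>A\<^esub> a', b) = \<phi> (a, b) \<otimes>\<^bsub>C\<^esub> \<phi> (a', b)"
    and "a \<in> carrier A \<Longrightarrow> b \<in> carrier B \<Longrightarrow> b' \<in> carrier B \<Longrightarrow>
      \<phi> (a, b \<otimes>\<^bsub>B\<^esub> b') = \<phi> (a, b) \<otimes>\<^bsub>C\<^esub> \<phi> (a, b')"
  using assms by (auto simp: bimult_def)

lemma bimult_hom:
  assumes "bimult A B C \<phi>"
  shows "b \<in> carrier B \<Longrightarrow> (\<lambda>a. \<phi> (a, b)) \<in> hom A C"
    and "a \<in> carrier A \<Longrightarrow> (\<lambda>b. \<phi> (a, b)) \<in> hom B C"
  using assms by (auto simp: bimult_def hom_def)

lemma bimult_one:
  assumes "bimult A B C \<phi>" "group A" "group B" "group C"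
  shows "b \<in> carrier B \<Longrightarrow> \<phi> (\<one>\<^bsub>A\<^esub>, b) = \<one>\<^bsub>C\<^esub>"
    and "a \<in> carrier A \<Longrightarrow> \<phi> (a, \<one>\<^bsub>B\<^esub>) = \<one>\<^bsub>C\<^esub>"
  using hom_one[OF bimult_hom(1)[OF assms(1)] assms(2,4)]
    hom_one[OF bimult_hom(2)[OF assms(1)] assms(3,4)] by auto

lemma id_hom: "(\<lambda>x. x) \<in> hom A A"
  by (simp add: hom_def)

lemma bimult_compose:
  assumes "bimult A B C \<phi>" "h \<in> hom C D" "f \<in> hom A' A" "g \<in> hom B' B"
  shows "bimult A' B' D (\<lambda>(a, b). h (\<phi> (f a, g b)))"
  using assms by (auto simp: bimult_def hom_def Pi_iff)

lemma tensor_relsI: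
  "a \<in> carrier A \<Longrightarrow> a' \<in> carrier A \<Longrightarrow> b \<in> carrier B \<Longrightarrow>
    frag_of (a \<otimes>\<^bsub>A\<^esub> a', b) - frag_of (a, b) - frag_of (a', b) \<in> tensor_rels A B"
  "a \<in> carrier A \<Longrightarrow> b \<in> carrier B \<Longrightarrow> b' \<in> carrier B \<Longrightarrow>
    frag_of (a, b \<otimes>\<^bsub>B\<^esub> b') - frag_of (a, b) - frag_of (a, b') \<in> tensor_rels A B"
  unfolding tensor_rels_def by blast+

lemma diff_in_free_Abelian_group:
  "x \<in> carrier (free_Abelian_group S) \<Longrightarrow> y \<in> carrier (free_Abelian_group S) \<Longrightarrow>
    x - y \<in> carrier (free_Abelian_group S)"
  using keys_diff[of x y] unfolding carrier_free_Abelian_group_iff by blast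

lemma tensor_rels_carrier:
  assumes "group A" "group B"
  shows "tensor_rels A B \<subseteq> carrier (free_Abelian_group (carrier A \<times> carrier B))"
proof -
  interpret A: group A by fact
  interpret B: group B by fact
  show ?thesis
    unfolding tensor_rels_def
    by (auto simp del: carrier_free_Abelian_group_iff simp: frag_of_in_free_Abelian_group
        intro!: diff_in_free_Abelian_group)
qed

lemma tensor_ker_normal:
  assumes "group A" "group B"
  shows "tensor_ker A B \<lhd> free_Abelian_group (carrier A \<times> carrier B)"
proof -
  interpret F: comm_group "free_Abelian_group (carrier A \<times> carrier B)"
    by (rule abelian_free_Abelian_group)
  show ?thesis unfolding tensor_ker_def
    by (intro F.subgroup_imp_normal F.generate_is_subgroup tensor_rels_carrier assms)
qed

lemma comm_group_tensor_product:
  assumes "group A" "group B"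
  shows "comm_group (tensor_product A B)"
proof -
  interpret F: comm_group "free_Abelian_group (carrier A \<times> carrier B)"
    by (rule abelian_free_Abelian_group)
  show ?thesis unfolding tensor_product_def
    by (rule F.abelian_FactGroup[OF normal_imp_subgroup[OF tensor_ker_normal[OF assms]]])
qed

lemma tens_bimult:
  assumes "group A" "group B"
  shows "bimult A B (tensor_product A B) (\<lambda>(a, b). tens A B a b)"
proof -
  interpret A: group A by fact
  interpret B: group B by fact
  let ?F = "free_Abelian_group (carrier A \<times> carrier B)"
  interpret K: normal "tensor_ker A B" ?F by (rule tensor_ker_normal[OF assms])
  have eq: "tensor_ker A B #>\<^bsub>?F\<^esub> x = tensor_ker A B #>\<^bsub>?F\<^esub> (y + z)"
    if "x - y - z \<in> tensor_rels A B" "x \<in> carrier ?F" "y \<in> carrier ?F" "z \<in> carrier ?F" for x y z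
  proof -
    have "x - y - z \<in> tensor_ker A B" unfolding tensor_ker_def by (rule generate.incl[OF that(1)])
    moreover have yz: "y + z \<in> carrier ?F" using K.m_closed[OF that(3,4)] by simp
    moreover have calc: "x \<otimes>\<^bsub>?F\<^esub> inv\<^bsub>?F\<^esub> (y + z) = x - y - z"
      using yz by (simp add: algebra_simps)
    ultimately show ?thesis
      using K.r_coset_eq_iff[OF K.subgroup_axioms that(2) yz] by (simp only: calc)
  qed
  have mult: "(tensor_ker A B #>\<^bsub>?F\<^esub> x) \<otimes>\<^bsub>tensor_product A B\<^esub> (tensor_ker A B #>\<^bsub>?F\<^esub> y)
      = tensor_ker A B #>\<^bsub>?F\<^esub> (x + y)" if "x \<in> carrier ?F" "y \<in> carrier ?F" for x y
    using K.rcos_sum[OF that] by (simp add: tensor_product_def)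
  show ?thesis
  proof (rule bimultI)
    fix a b assume "a \<in> carrier A" "b \<in> carrier B"
    then show "tens A B a b \<in> carrier (tensor_product A B)"
      by (auto simp: tens_def tensor_product_def carrier_FactGroup)
  next
    fix a a' b assume "a \<in> carrier A" "a' \<in> carrier A" "b \<in> carrier B"
    then show "tens A B (a \<otimes>\<^bsub>A\<^esub> a') b = tens A B a b \<otimes>\<^bsub>tensor_product A B\<^esub> tens A B a' b"
      by (simp add: tens_def mult, intro eq) (auto intro: tensor_relsI)
  next
    fix a b b' assume "a \<in> carrier A" "b \<in> carrier B" "b' \<in> carrier B"
    then show "tens A B a (b \<otimes>\<^bsub>B\<^esub> b') = tens A B a b \<otimes>\<^bsub>tensor_product A B\<^esub> tens A B a b'"
      by (simp add: tens_def mult, intro eq) (auto intro: tensor_relsI)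
  qed
qed

lemma gens_tensor:
  assumes "group A" "group B"
  shows "gens (tensor_product A B) {tens A B a b | a b. a \<in> carrier A \<and> b \<in> carrier B}"
proof -
  have "gens (tensor_product A B) ((\<lambda>x. tensor_ker A B #>\<^bsub>free_Abelian_group (carrier A \<times> carrier B)\<^esub> x) `
     frag_of ` (carrier A \<times> carrier B))"
    unfolding tensor_product_def by (rule gens_FactGroup[OF tensor_ker_normal[OF assms] gens_free])
  also have "((\<lambda>x. tensor_ker A B #>\<^bsub>free_Abelian_group (carrier A \<times> carrier B)\<^esub> x) `
     frag_of ` (carrier A \<times> carrier B)) = {tens A B a b | a b. a \<in> carrier A \<and> b \<in> carrier B}"
    by (auto simp: tens_def image_iff)
  finally show ?thesis .
qed

lemma free_lift_tensor_ker:
  assumes "group A" "group B" "comm_group C" "bimult A B C \<phi>" "x \<in> tensor_ker A B"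
  shows "free_lift C \<phi> x = \<one>\<^bsub>C\<^esub>"
proof -
  interpret A: group A by fact
  interpret B: group B by fact
  interpret C: comm_group C by fact
  let ?F = "free_Abelian_group (carrier A \<times> carrier B)"
  have \<phi>: "\<phi> \<in> carrier A \<times> carrier B \<rightarrow> carrier C" using assms(4) by (auto simp: bimult_def)
  interpret h: group_hom ?F C "free_lift C \<phi>"
    using free_lift_hom[OF assms(3) \<phi>] by (simp add: group_homI)
  have ker: "free_lift C \<phi> (frag_of x - frag_of y - frag_of z) = \<one>\<^bsub>C\<^esub>"
    if "x \<in> carrier A \<times> carrier B" "y \<in> carrier A \<times> carrier B" "z \<in> carrier A \<times> carrier B"
      "\<phi> x = \<phi> y \<otimes>\<^bsub>C\<^esub> \<phi> z" for x y z
  proof -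
    have "frag_of x - frag_of y - frag_of z = frag_of x \<otimes>\<^bsub>?F\<^esub> inv\<^bsub>?F\<^esub> (frag_of y \<otimes>\<^bsub>?F\<^esub> frag_of z)"
      using that keys_add[of "frag_of y" "frag_of z"] by (subst inv_free_Abelian_group) auto
    moreover have "\<phi> x \<in> carrier C" "\<phi> y \<in> carrier C" "\<phi> z \<in> carrier C"
      using that \<phi> by (auto simp: Pi_iff)
    then have "free_lift C \<phi> (frag_of x \<otimes>\<^bsub>?F\<^esub> inv\<^bsub>?F\<^esub> (frag_of y \<otimes>\<^bsub>?F\<^esub> frag_of z)) = \<one>\<^bsub>C\<^esub>"
      using that by (simp add: free_lift_of[OF assms(3)]
          del: mult_free_Abelian_group inv_free_Abelian_group carrier_free_Abelian_group_iff)
    ultimately show ?thesis by metis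
  qed
  have "tensor_ker A B \<subseteq> kernel ?F C (free_lift C \<phi>)"
    unfolding tensor_ker_def
  proof (rule h.G.generate_subgroup_incl[OF _ h.subgroup_kernel])
    show "tensor_rels A B \<subseteq> kernel ?F C (free_lift C \<phi>)"
    proof
      fix x assume x: "x \<in> tensor_rels A B"
      then have "free_lift C \<phi> x = \<one>\<^bsub>C\<^esub>"
        using bimultD[OF assms(4)] by (auto simp: tensor_rels_def intro!: ker)
      with x show "x \<in> kernel ?F C (free_lift C \<phi>)"
        using subsetD[OF tensor_rels_carrier[OF assms(1,2)] x] by (simp add: kernel_def)
    qed
  qed
  with assms(5) show ?thesis by (auto simp: kernel_def)
qed

lemma tensor_lift:
  assumes "group A" "group B" "comm_group C" "bimult A B C \<phi>"
  shows "tensor_lift C \<phi> \<in> hom (tensor_product A B) C"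
    and "a \<in> carrier A \<Longrightarrow> b \<in> carrier B \<Longrightarrow> tensor_lift C \<phi> (tens A B a b) = \<phi> (a, b)"
proof -
  interpret C: comm_group C by fact
  have \<phi>: "\<phi> \<in> carrier A \<times> carrier B \<rightarrow> carrier C" using assms(4) by (auto simp: bimult_def)
  note L = tensor_ker_normal[OF assms(1,2)] C.is_group free_lift_hom[OF assms(3) \<phi>] free_lift_tensor_ker[OF assms]
  show "tensor_lift C \<phi> \<in> hom (tensor_product A B) C"
    unfolding tensor_lift_def tensor_product_def by (rule coset_map_hom[OF L])
  show "tensor_lift C \<phi> (tens A B a b) = \<phi> (a, b)" if "a \<in> carrier A" "b \<in> carrier B"
    unfolding tensor_lift_def tens_def using that
    by (subst coset_map_rcoset[OF L]) (auto simp: free_lift_of[OF assms(3)] bimultD(1)[OF assms(4)])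
qed

lemma exterior_ker_normal:
  assumes "group A"
  shows "exterior_ker A \<lhd> tensor_product A A"
proof -
  interpret T: comm_group "tensor_product A A" by (rule comm_group_tensor_product[OF assms assms])
  show ?thesis unfolding exterior_ker_def
    using bimultD(1)[OF tens_bimult[OF assms assms]]
    by (intro T.subgroup_imp_normal T.generate_is_subgroup) auto
qed

lemma comm_group_exterior_square:
  assumes "group A"
  shows "comm_group (exterior_square A)"
proof -
  interpret T: comm_group "tensor_product A A" by (rule comm_group_tensor_product[OF assms assms])
  show ?thesis unfolding exterior_square_def
    by (rule T.abelian_FactGroup[OF normal_imp_subgroup[OF exterior_ker_normal[OF assms]]])
qed

lemma wedge_bimult:
  assumes "group A"
  shows "bimult A A (exterior_square A) (\<lambda>(a, b). wedge A a b)"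
  using bimult_compose[OF tens_bimult[OF assms assms]
      normal.r_coset_hom_Mod[OF exterior_ker_normal[OF assms]] id_hom id_hom]
  by (simp add: exterior_square_def wedge_def)

lemma wedge_self:
  assumes "group A" "a \<in> carrier A"
  shows "wedge A a a = \<one>\<^bsub>exterior_square A\<^esub>"
proof -
  interpret K: normal "exterior_ker A" "tensor_product A A" by (rule exterior_ker_normal[OF assms(1)])
  have "tens A A a a \<in> exterior_ker A"
    using assms(2) by (auto simp: exterior_ker_def intro!: generate.incl)
  then show ?thesis
    using K.rcos_const[OF K.is_group] by (simp add: wedge_def exterior_square_def)
qed

lemma gens_exterior:
  assumes "group A"
  shows "gens (exterior_square A) {wedge A a b | a b. a \<in> carrier A \<and> b \<in> carrier A}"
proof -
  have "gens (exterior_square A) ((\<lambda>x. exterior_ker A #>\<^bsub>tensor_product A A\<^esub> x) `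
     {tens A A a b | a b. a \<in> carrier A \<and> b \<in> carrier A})"
    unfolding exterior_square_def
    by (rule gens_FactGroup[OF exterior_ker_normal[OF assms] gens_tensor[OF assms assms]])
  also have "((\<lambda>x. exterior_ker A #>\<^bsub>tensor_product A A\<^esub> x) `
     {tens A A a b | a b. a \<in> carrier A \<and> b \<in> carrier A}) = {wedge A a b | a b. a \<in> carrier A \<and> b \<in> carrier A}"
    by (auto simp: wedge_def image_iff)
  finally show ?thesis .
qed

lemma exterior_lift:
  assumes "group A" "comm_group C" "bimult A A C \<phi>"
    and "\<And>a. a \<in> carrier A \<Longrightarrow> \<phi> (a, a) = \<one>\<^bsub>C\<^esub>"
  shows "exterior_lift C \<phi> \<in> hom (exterior_square A) C"
    and "t \<in> carrier (tensor_product A A) \<Longrightarrow>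
      exterior_lift C \<phi> (exterior_ker A #>\<^bsub>tensor_product A A\<^esub> t) = tensor_lift C \<phi> t"
    and "a \<in> carrier A \<Longrightarrow> b \<in> carrier A \<Longrightarrow> exterior_lift C \<phi> (wedge A a b) = \<phi> (a, b)"
proof -
  interpret C: comm_group C by fact
  note TL = tensor_lift[OF assms(1,1,2,3)]
  interpret h: group_hom "tensor_product A A" C "tensor_lift C \<phi>"
    using TL comm_group.axioms(2)[OF comm_group_tensor_product[OF assms(1,1)]] by (simp add: group_homI)
  have ker: "tensor_lift C \<phi> n = \<one>\<^bsub>C\<^esub>" if "n \<in> exterior_ker A" for n
  proof -
    have "exterior_ker A \<subseteq> kernel (tensor_product A A) C (tensor_lift C \<phi>)"
      unfolding exterior_ker_def
      by (rule h.G.generate_subgroup_incl[OF _ h.subgroup_kernel])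
        (use bimultD(1)[OF tens_bimult[OF assms(1,1)]] in \<open>auto simp: kernel_def TL assms(4)\<close>)
    with that show ?thesis by (auto simp: kernel_def)
  qed
  note L = exterior_ker_normal[OF assms(1)] C.is_group TL(1) ker
  show "exterior_lift C \<phi> \<in> hom (exterior_square A) C"
    unfolding exterior_lift_def exterior_square_def by (rule coset_map_hom[OF L])
  show *: "exterior_lift C \<phi> (exterior_ker A #>\<^bsub>tensor_product A A\<^esub> t) = tensor_lift C \<phi> t"
    if "t \<in> carrier (tensor_product A A)" for t
    unfolding exterior_lift_def by (rule coset_map_rcoset[OF L that])
  show "exterior_lift C \<phi> (wedge A a b) = \<phi> (a, b)" if "a \<in> carrier A" "b \<in> carrier A"
    unfolding wedge_def using that bimultD(1)[OF tens_bimult[OF assms(1,1)]] by (simp add: * TL)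
qed

section \<open>Antisymmetrization is injective\<close>

text \<open>Elements of the free abelian group on \<open>A \<times> B\<close> are viewed as integer matrices with finitely many
  nonzero entries.\<close>

text \<open>The row with index \<open>a\<close>.\<close>
definition mat_row :: "'a \<Rightarrow> ('a \<times> 'b \<Rightarrow>\<^sub>0 int) \<Rightarrow> ('b \<Rightarrow>\<^sub>0 int)" where
  "mat_row a = frag_extend (\<lambda>(a', b). if a' = a then frag_of b else 0)"

definition mat_transpose :: "('a \<times> 'b \<Rightarrow>\<^sub>0 int) \<Rightarrow> ('b \<times> 'a \<Rightarrow>\<^sub>0 int)" where
  "mat_transpose = frag_extend (\<lambda>(a, b). frag_of (b, a))"

lemma mat_row_diff: "mat_row a (x - y) = mat_row a x - mat_row a y"
  by (simp add: mat_row_def frag_extend_diff)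

lemma mat_row_of [simp]: "mat_row a (frag_of (a', b)) = (if a' = a then frag_of b else 0)"
  by (simp add: mat_row_def)

lemma mat_row_zero [simp]: "mat_row a 0 = 0"
  by (simp add: mat_row_def)

lemma mat_transpose_diff: "mat_transpose (x - y) = mat_transpose x - mat_transpose y"
  by (simp add: mat_transpose_def frag_extend_diff)

lemma mat_transpose_add: "mat_transpose (x + y) = mat_transpose x + mat_transpose y"
  by (simp add: mat_transpose_def frag_extend_add)

lemma mat_transpose_zero [simp]: "mat_transpose 0 = 0"
  by (simp add: mat_transpose_def)

lemma mat_transpose_of [simp]: "mat_transpose (frag_of (a, b)) = frag_of (b, a)"
  by (simp add: mat_transpose_def)

lemma lookup_mat_row: "Poly_Mapping.lookup (mat_row a x) b = Poly_Mapping.lookup x (a, b)"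
  by (rule frag_induction[of x UNIV])
    (auto simp: mat_row_diff lookup_minus split: if_splits)

lemma lookup_mat_transpose: "Poly_Mapping.lookup (mat_transpose x) (b, a) = Poly_Mapping.lookup x (a, b)"
  by (rule frag_induction[of x UNIV]) (auto simp: mat_transpose_diff lookup_minus split: if_splits)

lemma mat_transpose_transpose [simp]: "mat_transpose (mat_transpose x) = x"
  by (rule poly_mapping_eqI) (metis lookup_mat_transpose surj_pair)

lemma keys_mat_transpose: "Poly_Mapping.keys x \<subseteq> S \<times> T \<Longrightarrow> Poly_Mapping.keys (mat_transpose x) \<subseteq> T \<times> S"
  by (auto simp: in_keys_iff lookup_mat_transpose subset_iff)

lemma lookup_sum_frag_of:
  assumes "finite I"
  shows "Poly_Mapping.lookup (\<Sum>i\<in>I. frag_cmul (c i) (frag_of i)) k = (if k \<in> I then c k else 0)"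
  using assms by (simp add: lookup_sum if_distrib[of "\<lambda>x. _ * x"] sum.delta cong: if_cong)

lemma mat_row_sum:
  assumes "finite I" "Poly_Mapping.keys x \<subseteq> S \<times> I"
  shows "mat_row a x = (\<Sum>j\<in>I. frag_cmul (Poly_Mapping.lookup x (a, j)) (frag_of j))"
  using assms(2) by (intro poly_mapping_eqI)
    (auto simp: lookup_mat_row lookup_sum_frag_of[OF assms(1)] in_keys_iff)

lemma mat_sum:
  assumes "finite I" "finite J" "Poly_Mapping.keys x \<subseteq> I \<times> J"
  shows "x = (\<Sum>i\<in>I. \<Sum>j\<in>J. frag_cmul (Poly_Mapping.lookup x (i, j)) (frag_of (i, j)))"
proof -
  have "x = (\<Sum>p\<in>I\<times>J. frag_cmul (Poly_Mapping.lookup x p) (frag_of p))"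
    using assms by (intro poly_mapping_eqI) (auto simp: lookup_sum_frag_of in_keys_iff)
  then show ?thesis by (simp add: sum.cartesian_product)
qed

lemma mat_sum_rows:
  assumes "finite I" "finite J" "Poly_Mapping.keys x \<subseteq> I \<times> J"
  shows "x = (\<Sum>i\<in>I. outer (frag_of i) (mat_row i x))"
proof -
  have "outer (frag_of i) (mat_row i x) = (\<Sum>j\<in>J. frag_cmul (Poly_Mapping.lookup x (i, j)) (frag_of (i, j)))" for i
    by (simp add: mat_row_sum[OF assms(2,3)] biextend_sum biextend_cmul)
  then show ?thesis using mat_sum[OF assms] by simp
qed

text \<open>The relations that turn the free abelian group on \<open>A\<close> into the abelianization of \<open>A\<close>.\<close>
definition hom_rels :: "('a, 'm) monoid_scheme \<Rightarrow> ('a \<Rightarrow>\<^sub>0 int) set" where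
  "hom_rels A = generate (free_Abelian_group (carrier A))
     {frag_of (a \<otimes>\<^bsub>A\<^esub> a') - frag_of a - frag_of a' | a a'. a \<in> carrier A \<and> a' \<in> carrier A}"

lemma hom_rels_carrier:
  assumes "group A"
  shows "{frag_of (a \<otimes>\<^bsub>A\<^esub> a') - frag_of a - frag_of a' | a a'. a \<in> carrier A \<and> a' \<in> carrier A}
    \<subseteq> carrier (free_Abelian_group (carrier A))"
proof -
  interpret A: group A by fact
  show ?thesis
    by (auto simp del: carrier_free_Abelian_group_iff simp: frag_of_in_free_Abelian_group
        intro!: diff_in_free_Abelian_group)
qed

lemma add_subgroup_hom_rels: "group A \<Longrightarrow> add_subgroup (hom_rels A)"
  unfolding hom_rels_def by (rule add_subgroup_generate[OF hom_rels_carrier])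

lemma add_subgroup_tensor_ker: "group A \<Longrightarrow> group B \<Longrightarrow> add_subgroup (tensor_ker A B)"
  unfolding tensor_ker_def by (rule add_subgroup_generate[OF tensor_rels_carrier])

lemma outer_hom_rels:
  assumes "group A" "Poly_Mapping.keys f \<subseteq> carrier A" "g \<in> hom_rels A"
  shows "outer f g \<in> tensor_ker A A"
proof -
  note K = add_subgroup_tensor_ker[OF assms(1,1)]
  have 1: "outer (frag_of a) g \<in> tensor_ker A A" if "a \<in> carrier A" for a
  proof -
    have "hom_rels A \<subseteq> {g. outer (frag_of a) g \<in> tensor_ker A A}"
      unfolding hom_rels_def
    proof (rule generate_free_subset[OF hom_rels_carrier[OF assms(1)]])
      show "add_subgroup {g. outer (frag_of a) g \<in> tensor_ker A A}"
        using K by (auto simp: add_subgroup_def biextend_diff_right)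
      have "x \<in> tensor_rels A A \<Longrightarrow> x \<in> tensor_ker A A" for x
        unfolding tensor_ker_def by (rule generate.incl)
      then show "{frag_of (a \<otimes>\<^bsub>A\<^esub> a') - frag_of a - frag_of a' | a a'. a \<in> carrier A \<and> a' \<in> carrier A}
        \<subseteq> {g. outer (frag_of a) g \<in> tensor_ker A A}"
        using that by (auto simp: biextend_diff_right tensor_relsI(2))
    qed
    then show ?thesis using assms(3) by auto
  qed
  show ?thesis using assms(2)
    by (induction f rule: frag_induction)
      (auto simp: 1 biextend_diff_left add_subgroup_zero[OF K] add_subgroup_diff[OF K])
qed

text \<open>The relations of \<open>A \<otimes> A\<close> are sums of a matrix with all rows in \<^const>\<open>hom_rels\<close> and a matrix
  with all columns in it.\<close>
lemma tensor_ker_decomp: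
  assumes "group A" "x \<in> tensor_ker A A"
  obtains v w where "x = v + mat_transpose w"
    "Poly_Mapping.keys v \<subseteq> carrier A \<times> carrier A" "Poly_Mapping.keys w \<subseteq> carrier A \<times> carrier A"
    "\<And>a. mat_row a v \<in> hom_rels A" "\<And>a. mat_row a w \<in> hom_rels A"
proof -
  interpret A: group A by fact
  define V where "V = {v. Poly_Mapping.keys v \<subseteq> carrier A \<times> carrier A \<and> (\<forall>a. mat_row a v \<in> hom_rels A)}"
  note R = add_subgroup_hom_rels[OF assms(1)]
  have V: "add_subgroup V"
  proof (rule add_subgroupI)
    show "0 \<in> V" using add_subgroup_zero[OF R] by (simp add: V_def mat_row_def)
    fix x y assume "x \<in> V" "y \<in> V"
    then show "x - y \<in> V"
      using diff_in_free_Abelian_group[of x "carrier A \<times> carrier A" y] add_subgroup_diff[OF R]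
      by (simp add: V_def mat_row_diff)
  qed
  let ?J = "{v + mat_transpose w | v w. v \<in> V \<and> w \<in> V}"
  have J: "add_subgroup ?J"
  proof (rule add_subgroupI)
    show "0 \<in> ?J" using add_subgroup_zero[OF V] by force
    fix x y assume "x \<in> ?J" "y \<in> ?J"
    then obtain v w v' w' where "v \<in> V" "w \<in> V" "v' \<in> V" "w' \<in> V"
      "x = v + mat_transpose w" "y = v' + mat_transpose w'" by auto
    then have "x - y = (v - v') + mat_transpose (w - w')" "v - v' \<in> V" "w - w' \<in> V"
      using add_subgroup_diff[OF V] by (auto simp: mat_transpose_diff)
    then show "x - y \<in> ?J" by blast
  qed
  have gen: "frag_of (a, b \<otimes>\<^bsub>A\<^esub> b') - frag_of (a, b) - frag_of (a, b') \<in> V"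
    if "a \<in> carrier A" "b \<in> carrier A" "b' \<in> carrier A" for a b b'
  proof -
    have "frag_of (a, b \<otimes>\<^bsub>A\<^esub> b') - frag_of (a, b) - frag_of (a, b') \<in> tensor_rels A A"
      using that by (intro tensor_relsI(2))
    then have "Poly_Mapping.keys (frag_of (a, b \<otimes>\<^bsub>A\<^esub> b') - frag_of (a, b) - frag_of (a, b'))
        \<subseteq> carrier A \<times> carrier A"
      using tensor_rels_carrier[OF assms(1,1)] by (meson carrier_free_Abelian_group_iff subsetD)
    moreover have "frag_of (b \<otimes>\<^bsub>A\<^esub> b') - frag_of b - frag_of b' \<in> hom_rels A"
      unfolding hom_rels_def using that by (blast intro: generate.incl)
    ultimately show ?thesis using add_subgroup_zero[OF R] by (auto simp: V_def mat_row_diff)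
  qed
  have "tensor_ker A A \<subseteq> ?J"
    unfolding tensor_ker_def
  proof (rule generate_free_subset[OF tensor_rels_carrier[OF assms(1,1)] J], rule subsetI)
    fix x assume "x \<in> tensor_rels A A"
    then show "x \<in> ?J"
      unfolding tensor_rels_def
    proof (elim UnE CollectE exE conjE)
      fix a b b' assume x: "x = frag_of (a, b \<otimes>\<^bsub>A\<^esub> b') - frag_of (a, b) - frag_of (a, b')"
        and "a \<in> carrier A" "b \<in> carrier A" "b' \<in> carrier A"
      then show "x \<in> ?J" using gen[of a b b'] add_subgroup_zero[OF V]
        by (intro CollectI exI[of _ x] exI[of _ 0]) simp
    next
      fix a a' b assume x: "x = frag_of (a \<otimes>\<^bsub>A\<^esub> a', b) - frag_of (a, b) - frag_of (a', b)"
        and "a \<in> carrier A" "a' \<in> carrier A" "b \<in> carrier A"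
      then show "x \<in> ?J" using gen[of b a a'] add_subgroup_zero[OF V]
        by (intro CollectI exI[of _ 0] exI[of _ "mat_transpose x"]) (simp add: mat_transpose_diff)
    qed
  qed
  with assms(2) obtain v w where "x = v + mat_transpose w" "v \<in> V" "w \<in> V" by auto
  then show thesis by (intro that[of v w]) (auto simp: V_def)
qed

text \<open>The class of a matrix in the exterior square.\<close>
abbreviation wedge_class :: "('a, 'm) monoid_scheme \<Rightarrow> ('a \<times> 'a \<Rightarrow>\<^sub>0 int) \<Rightarrow> ('a \<times> 'a \<Rightarrow>\<^sub>0 int) set set" where
  "wedge_class A u \<equiv> exterior_ker A #>\<^bsub>tensor_product A A\<^esub>
     (tensor_ker A A #>\<^bsub>free_Abelian_group (carrier A \<times> carrier A)\<^esub> u)"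

lemma tensor_class_hom:
  assumes "group A" "group B"
  shows "(\<lambda>u. tensor_ker A B #>\<^bsub>free_Abelian_group (carrier A \<times> carrier B)\<^esub> u)
    \<in> hom (free_Abelian_group (carrier A \<times> carrier B)) (tensor_product A B)"
  using normal.r_coset_hom_Mod[OF tensor_ker_normal[OF assms]] by (simp add: tensor_product_def)

lemma wedge_class_hom:
  assumes "group A"
  shows "wedge_class A \<in> hom (free_Abelian_group (carrier A \<times> carrier A)) (exterior_square A)"
  using hom_compose[OF tensor_class_hom[OF assms assms]
      normal.r_coset_hom_Mod[OF exterior_ker_normal[OF assms]]]
  by (simp add: exterior_square_def o_def)

lemma wedge_class_of: "wedge_class A (frag_of (a, b)) = wedge A a b"
  by (simp add: wedge_def tens_def)

lemma add_subgroup_kernel: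
  assumes "group H" "h \<in> hom (free_Abelian_group S) H"
  shows "add_subgroup {x. Poly_Mapping.keys x \<subseteq> S \<and> h x = \<one>\<^bsub>H\<^esub>}"
proof (rule add_subgroupI)
  interpret h: group_hom "free_Abelian_group S" H h using assms by (simp add: group_homI)
  show "0 \<in> {x. Poly_Mapping.keys x \<subseteq> S \<and> h x = \<one>\<^bsub>H\<^esub>}" using h.hom_one by simp
  fix x y assume "x \<in> {x. Poly_Mapping.keys x \<subseteq> S \<and> h x = \<one>\<^bsub>H\<^esub>}" "y \<in> {x. Poly_Mapping.keys x \<subseteq> S \<and> h x = \<one>\<^bsub>H\<^esub>}"
  then show "x - y \<in> {x. Poly_Mapping.keys x \<subseteq> S \<and> h x = \<one>\<^bsub>H\<^esub>}"
    using h.hom_mult[of x "- y"] h.hom_inv[of y] diff_in_free_Abelian_group[of x S y] by simp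
qed

text \<open>If \<open>u - u\<^sup>T = v + w\<^sup>T\<close> with all rows of \<open>v\<close> and \<open>w\<close> in \<^const>\<open>hom_rels\<close>, then \<open>u\<close> and
  \<open>m = u - v\<close> have the same class, and \<open>m - m\<^sup>T = - (v + w)\<close> since \<open>v + w\<^sup>T\<close> is antisymmetric.  So the
  rows of \<open>m - m\<^sup>T\<close> are relations, and \<open>alternating_core\<close> applies to \<open>m\<close>.\<close>
lemma wedge_class_antisym:
  fixes A :: "('a, 'm) monoid_scheme"
  assumes "group A" "Poly_Mapping.keys u \<subseteq> carrier A \<times> carrier A" "u - mat_transpose u \<in> tensor_ker A A"
  shows "wedge_class A u = \<one>\<^bsub>exterior_square A\<^esub>"
proof -
  interpret A: group A by fact
  interpret E: comm_group "exterior_square A" by (rule comm_group_exterior_square[OF assms(1)])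
  define F where "F = {f :: 'a \<Rightarrow>\<^sub>0 int. Poly_Mapping.keys f \<subseteq> carrier A}"
  define K where "K = {u. Poly_Mapping.keys u \<subseteq> carrier A \<times> carrier A \<and> wedge_class A u = \<one>\<^bsub>exterior_square A\<^esub>}"
  have F: "add_subgroup F" unfolding F_def by (rule add_subgroup_keys)
  note R = add_subgroup_hom_rels[OF assms(1)]
  have K: "add_subgroup K"
    unfolding K_def by (rule add_subgroup_kernel[OF E.is_group wedge_class_hom[OF assms(1)]])
  note TK = normal_imp_subgroup[OF tensor_ker_normal[OF assms(1,1)]]
  have tK: "tensor_ker A A \<subseteq> K"
  proof
    fix x assume x: "x \<in> tensor_ker A A"
    have "tensor_ker A A #>\<^bsub>free_Abelian_group (carrier A \<times> carrier A)\<^esub> x = tensor_ker A A"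
      by (rule subgroup.rcos_const[OF TK group_free_Abelian_group x])
    also have "\<dots> = \<one>\<^bsub>tensor_product A A\<^esub>" by (simp add: tensor_product_def)
    finally have "wedge_class A x = \<one>\<^bsub>exterior_square A\<^esub>"
      using group.coset_mult_one[OF comm_group.axioms(2)[OF comm_group_tensor_product[OF assms(1,1)]]
         subgroup.subset[OF normal_imp_subgroup[OF exterior_ker_normal[OF assms(1)]]]]
      by (simp add: exterior_square_def)
    then show "x \<in> K" using subgroup.mem_carrier[OF TK x] by (simp add: K_def)
  qed
  have FR: "outer f g \<in> K" if "f \<in> F" "g \<in> hom_rels A" for f g
    using outer_hom_rels[OF assms(1)] that tK by (auto simp: F_def)
  have self: "frag_of (a, a) \<in> K" if "a \<in> carrier A" for a
    using that wedge_self[OF assms(1) that] by (simp add: K_def wedge_class_of)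
  have anti1: "frag_of (a, b) + frag_of (b, a) \<in> K" if "a \<in> carrier A" "b \<in> carrier A" for a b
  proof -
    note W = wedge_bimult[OF assms(1)]
    have wb: "wedge A x y \<in> carrier (exterior_square A)" if "x \<in> carrier A" "y \<in> carrier A" for x y
      using bimultD(1)[OF W that] by simp
    have "\<one>\<^bsub>exterior_square A\<^esub> = wedge A (a \<otimes>\<^bsub>A\<^esub> b) (a \<otimes>\<^bsub>A\<^esub> b)"
      using that by (simp add: wedge_self[OF assms(1)])
    also have "\<dots> = wedge A a b \<otimes>\<^bsub>exterior_square A\<^esub> wedge A b a"
      using that bimultD(2)[OF W, of a b "a \<otimes>\<^bsub>A\<^esub> b"] bimultD(3)[OF W, of _ a b]
      by (simp add: wedge_self[OF assms(1)] wb)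
    finally have "wedge_class A (frag_of (a, b)) \<otimes>\<^bsub>exterior_square A\<^esub> wedge_class A (frag_of (b, a)) = \<one>\<^bsub>exterior_square A\<^esub>"
      by (simp add: wedge_class_of)
    then have "wedge_class A (frag_of (a, b) + frag_of (b, a)) = \<one>\<^bsub>exterior_square A\<^esub>"
      using hom_mult[OF wedge_class_hom[OF assms(1)], of "frag_of (a, b)" "frag_of (b, a)"] that by simp
    then show ?thesis using that keys_add[of "frag_of (a, b)" "frag_of (b, a)"] by (auto simp: K_def)
  qed
  have anti: "outer f g + outer g f \<in> K" if "f \<in> F" "g \<in> F" for f g
  proof -
    have "Poly_Mapping.keys f \<subseteq> carrier A" "Poly_Mapping.keys g \<subseteq> carrier A" using that by (auto simp: F_def)
    then show ?thesis
    proof (induction f rule: frag_induction)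
      case (one a)
      show ?case using one(2)
      proof (induction g rule: frag_induction)
        case (diff x y)
        then show ?case using add_subgroup_diff[OF K diff(1,2)]
          by (simp add: biextend_diff_left biextend_diff_right algebra_simps)
      qed (use anti1 one add_subgroup_zero[OF K] in auto)
    next
      case (diff x y)
      then show ?case using add_subgroup_diff[OF K diff(1,2)]
        by (simp add: biextend_diff_left biextend_diff_right algebra_simps)
    qed (use add_subgroup_zero[OF K] in auto)
  qed
  have FF: "outer f f \<in> K" if "f \<in> F" for f
  proof -
    have "Poly_Mapping.keys f \<subseteq> carrier A" using that by (auto simp: F_def)
    then have "f \<in> F \<and> outer f f \<in> K"
    proof (induction f rule: frag_induction)
      case (diff x y)
      then have "(outer x x + outer y y) - (outer x y + outer y x) \<in> K"
        by (intro add_subgroup_diff[OF K] add_subgroup_add[OF K] anti) auto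
      then show ?case using diff add_subgroup_diff[OF F]
        by (simp add: biextend_diff_left biextend_diff_right algebra_simps)
    qed (use self add_subgroup_zero[OF K] in \<open>auto simp: F_def\<close>)
    then show ?thesis by simp
  qed
  obtain v w where vw: "u - mat_transpose u = v + mat_transpose w"
    "Poly_Mapping.keys v \<subseteq> carrier A \<times> carrier A" "Poly_Mapping.keys w \<subseteq> carrier A \<times> carrier A"
    "\<And>a. mat_row a v \<in> hom_rels A" "\<And>a. mat_row a w \<in> hom_rels A"
    by (rule tensor_ker_decomp[OF assms(1,3)]) blast
  define M where "M = u - v"
  have "mat_transpose (u - mat_transpose u) = - (u - mat_transpose u)"
    by (simp add: mat_transpose_diff)
  then have "mat_transpose v + w = - (v + mat_transpose w)"
    by (simp add: vw(1) mat_transpose_add)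
  then have tv: "mat_transpose v = - v - mat_transpose w - w"
    by (metis (no_types) add_diff_cancel_right' minus_add_distrib diff_conv_add_uminus)
  have "M - mat_transpose M = (u - mat_transpose u) - v + mat_transpose v"
    by (simp add: M_def mat_transpose_diff)
  then have "M - mat_transpose M = - (v + w)" by (simp add: vw(1) tv)
  then have "M - mat_transpose M = (0 - v) - w" by simp
  then have rowM: "mat_row a (M - mat_transpose M) \<in> hom_rels A" for a
    unfolding mat_row_diff mat_row_zero
    by (metis R add_subgroup_diff add_subgroup_zero mat_row_diff mat_row_zero vw(4,5))
  have keysM: "Poly_Mapping.keys M \<subseteq> carrier A \<times> carrier A"
    unfolding M_def using assms(2) vw(2) keys_diff[of u v] by blast
  define I where "I = fst ` Poly_Mapping.keys M \<union> snd ` Poly_Mapping.keys M"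
  have fin: "finite I" by (simp add: I_def)
  have IA: "I \<subseteq> carrier A" using keysM by (auto simp: I_def)
  have MI: "Poly_Mapping.keys M \<subseteq> I \<times> I" by (force simp: I_def)
  then have M'I: "Poly_Mapping.keys (M - mat_transpose M) \<subseteq> I \<times> I"
    using keys_mat_transpose[OF MI] keys_diff[of M "mat_transpose M"] by blast
  have "(\<Sum>i\<in>I. \<Sum>j\<in>I. frag_cmul (Poly_Mapping.lookup M (i, j)) (outer (frag_of i) (frag_of j))) \<in> K"
  proof (rule alternating_core[OF F R K FR FF fin, where h = 0 and r = "\<lambda>_. 0"])
    show "frag_of \<in> I \<rightarrow> F" using IA by (auto simp: F_def)
    show "0 \<in> F" by (rule add_subgroup_zero[OF F])
    fix i
    show "(\<Sum>j\<in>I. frag_cmul (Poly_Mapping.lookup M (i, j) - Poly_Mapping.lookup M (j, i)) (frag_of j))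
      - frag_cmul 0 0 \<in> hom_rels A"
      using rowM[of i] mat_row_sum[OF fin M'I, of i] by (simp add: lookup_minus lookup_mat_transpose)
  qed (use add_subgroup_zero[OF K] in auto)
  then have "M \<in> K" using mat_sum[OF fin fin MI] by simp
  moreover have "v \<in> K"
  proof -
    define J where "J = fst ` Poly_Mapping.keys v"
    have J: "finite J" "finite (snd ` Poly_Mapping.keys v)" "Poly_Mapping.keys v \<subseteq> J \<times> snd ` Poly_Mapping.keys v"
      by (force simp: J_def)+
    have "(\<Sum>i\<in>J. outer (frag_of i) (mat_row i v)) \<in> K"
      by (intro add_subgroup_sum[OF K] FR vw) (use vw(2) in \<open>auto simp: J_def F_def\<close>)
    then show ?thesis using mat_sum_rows[OF J] by simp
  qed
  ultimately have "M + v \<in> K" by (rule add_subgroup_add[OF K])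
  then show ?thesis by (simp add: M_def K_def)
qed

text \<open>The map \<open>a \<and> b \<mapsto> a \<otimes> b - b \<otimes> a\<close>.\<close>
definition antisymmetrize ::
  "('a, 'm) monoid_scheme \<Rightarrow> ('a \<times> 'a \<Rightarrow>\<^sub>0 int) set set \<Rightarrow> ('a \<times> 'a \<Rightarrow>\<^sub>0 int) set" where
  "antisymmetrize A = exterior_lift (tensor_product A A)
     (\<lambda>(a, b). tens A A a b \<otimes>\<^bsub>tensor_product A A\<^esub> inv\<^bsub>tensor_product A A\<^esub> tens A A b a)"

lemma antisymmetrize_bimult:
  assumes "group A"
  shows "bimult A A (tensor_product A A)
     (\<lambda>(a, b). tens A A a b \<otimes>\<^bsub>tensor_product A A\<^esub> inv\<^bsub>tensor_product A A\<^esub> tens A A b a)"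
proof -
  interpret T: comm_group "tensor_product A A" by (rule comm_group_tensor_product[OF assms assms])
  note t = bimultD[OF tens_bimult[OF assms assms], simplified]
  show ?thesis
    by (auto simp: bimult_def t T.inv_mult T.m_ac)
qed

lemma antisymmetrize:
  assumes "group A"
  shows "antisymmetrize A \<in> hom (exterior_square A) (tensor_product A A)"
    and "a \<in> carrier A \<Longrightarrow> b \<in> carrier A \<Longrightarrow> antisymmetrize A (wedge A a b) =
       tens A A a b \<otimes>\<^bsub>tensor_product A A\<^esub> inv\<^bsub>tensor_product A A\<^esub> tens A A b a"
    and "inj_on (antisymmetrize A) (carrier (exterior_square A))"
proof -
  interpret T: comm_group "tensor_product A A" by (rule comm_group_tensor_product[OF assms assms])
  interpret E: comm_group "exterior_square A" by (rule comm_group_exterior_square[OF assms])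
  note tc = bimultD(1)[OF tens_bimult[OF assms assms], simplified]
  let ?\<phi> = "\<lambda>(a, b). tens A A a b \<otimes>\<^bsub>tensor_product A A\<^esub> inv\<^bsub>tensor_product A A\<^esub> tens A A b a"
  have alt: "a \<in> carrier A \<Longrightarrow> ?\<phi> (a, a) = \<one>\<^bsub>tensor_product A A\<^esub>" for a
    by (simp add: tc)
  note L = exterior_lift[OF assms T.comm_group_axioms antisymmetrize_bimult[OF assms] alt]
  note TL = tensor_lift[OF assms assms T.comm_group_axioms antisymmetrize_bimult[OF assms]]
  show hom: "antisymmetrize A \<in> hom (exterior_square A) (tensor_product A A)"
    unfolding antisymmetrize_def by (rule L(1))
  show "antisymmetrize A (wedge A a b) =
       tens A A a b \<otimes>\<^bsub>tensor_product A A\<^esub> inv\<^bsub>tensor_product A A\<^esub> tens A A b a"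
    if "a \<in> carrier A" "b \<in> carrier A"
    unfolding antisymmetrize_def using L(3)[OF _ that] by simp
  let ?F = "free_Abelian_group (carrier A \<times> carrier A)"
  let ?c = "\<lambda>u. tensor_ker A A #>\<^bsub>?F\<^esub> u"
  note c = tensor_class_hom[OF assms assms]
  have eval: "antisymmetrize A (wedge_class A u) = ?c (u - mat_transpose u)" if "u \<in> carrier ?F" for u
  proof -
    have "antisymmetrize A (wedge_class A u) = tensor_lift (tensor_product A A) ?\<phi> (?c u)"
      unfolding antisymmetrize_def using L(2)[OF _ hom_in_carrier[OF c that]] by simp
    also have "\<dots> = ?c (u - mat_transpose u)"
    proof (rule hom_eq_on_gens[OF group_free_Abelian_group T.is_group _ _ gens_free _ that,
          of "\<lambda>u. tensor_lift (tensor_product A A) ?\<phi> (?c u)" "\<lambda>u. ?c (u - mat_transpose u)"])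
      show "(\<lambda>u. tensor_lift (tensor_product A A) ?\<phi> (?c u)) \<in> hom ?F (tensor_product A A)"
        using hom_compose[OF c TL(1)] by (simp add: o_def)
      have "(\<lambda>u. u - mat_transpose u) \<in> hom ?F ?F"
      proof (rule homI)
        fix x assume "x \<in> carrier ?F"
        then show "x - mat_transpose x \<in> carrier ?F"
          using keys_mat_transpose[of x] by (intro diff_in_free_Abelian_group) simp_all
      qed (simp add: mat_transpose_add)
      from hom_compose[OF this c] show "(\<lambda>u. ?c (u - mat_transpose u)) \<in> hom ?F (tensor_product A A)"
        by (simp add: o_def)
      fix x assume "x \<in> frag_of ` (carrier A \<times> carrier A)"
      then obtain a b where ab: "a \<in> carrier A" "b \<in> carrier A" "x = frag_of (a, b)" by auto
      have "?c (frag_of (a, b) - frag_of (b, a)) = ?\<phi> (a, b)"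
        using group_hom.hom_mult[OF group_homI[OF group_free_Abelian_group T.is_group c],
            of "frag_of (a, b)" "inv\<^bsub>?F\<^esub> frag_of (b, a)"]
          group_hom.hom_inv[OF group_homI[OF group_free_Abelian_group T.is_group c], of "frag_of (b, a)"] ab
        by (simp add: tens_def)
      then show "tensor_lift (tensor_product A A) ?\<phi> (?c x) = ?c (x - mat_transpose x)"
        using TL(2)[OF ab(1,2)] ab by (simp add: tens_def)
    qed
    finally show ?thesis .
  qed
  interpret h: group_hom "exterior_square A" "tensor_product A A" "antisymmetrize A"
    by (rule group_homI[OF E.is_group T.is_group hom])
  show "inj_on (antisymmetrize A) (carrier (exterior_square A))"
    unfolding h.inj_on_one_iff
  proof (intro allI impI)
    fix x assume "x \<in> carrier (exterior_square A)" and 1: "antisymmetrize A x = \<one>\<^bsub>tensor_product A A\<^esub>"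
    from this(1) obtain t where
      t: "t \<in> carrier (tensor_product A A)" "x = exterior_ker A #>\<^bsub>tensor_product A A\<^esub> t"
      unfolding exterior_square_def by (rule carrier_FactGroupE)
    from t(1) obtain u where u: "u \<in> carrier ?F" "t = ?c u"
      unfolding tensor_product_def by (rule carrier_FactGroupE)
    have uF: "u - mat_transpose u \<in> carrier ?F"
      using u keys_mat_transpose[of u] by (intro diff_in_free_Abelian_group) simp_all
    have "?c (u - mat_transpose u) = tensor_ker A A"
      using 1 eval[OF u(1)] t(2) u(2) by (simp add: tensor_product_def)
    then have "u - mat_transpose u \<in> tensor_ker A A"
      using group.r_coset_eq_self_iff[OF group_free_Abelian_group
          normal_imp_subgroup[OF tensor_ker_normal[OF assms assms]] uF] by simp
    then show "x = \<one>\<^bsub>exterior_square A\<^esub>"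
      using wedge_class_antisym[OF assms, of u] u t by simp
  qed
qed

section \<open>The augmentation ideal\<close>

text \<open>An additive subgroup as a group record.\<close>
abbreviation add_group :: "'a::ab_group_add set \<Rightarrow> 'a monoid" where
  "add_group S \<equiv> \<lparr>carrier = S, monoid.mult = (+), one = 0\<rparr>"

lemma comm_group_add_group:
  assumes "add_subgroup S"
  shows "comm_group (add_group S)"
proof (rule comm_groupI)
  show "\<exists>y\<in>carrier (add_group S). y \<otimes>\<^bsub>add_group S\<^esub> x = \<one>\<^bsub>add_group S\<^esub>" if "x \<in> carrier (add_group S)" for x
    using that add_subgroup_minus[OF assms] by (intro bexI[of _ "- x"]) auto
qed (use assms in \<open>auto simp: add_subgroup_add add_subgroup_zero algebra_simps\<close>)

lemma inv_add_group: "add_subgroup S \<Longrightarrow> x \<in> S \<Longrightarrow> inv\<^bsub>add_group S\<^esub> x = - x"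
  by (rule group.inv_equality[OF comm_group.axioms(2)[OF comm_group_add_group]])
    (auto simp: add_subgroup_minus)

lemma normal_add_group:
  assumes "add_subgroup S" "add_subgroup T" "T \<subseteq> S"
  shows "T \<lhd> add_group S"
proof -
  interpret comm_group "add_group S" by (rule comm_group_add_group[OF assms(1)])
  show ?thesis
    using assms
    by (intro subgroup_imp_normal subgroup.intro)
       (auto simp: add_subgroup_add add_subgroup_zero inv_add_group add_subgroup_minus subset_iff)
qed

lemma add_subgroup_kernel_add_group:
  assumes "add_subgroup S" "group H" "h \<in> hom (add_group S) H"
  shows "add_subgroup {x \<in> S. h x = \<one>\<^bsub>H\<^esub>}"
proof (rule add_subgroupI)
  interpret h: group_hom "add_group S" H h
    using assms comm_group_add_group[OF assms(1)] by (intro group_homI) (auto simp: comm_group_def)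
  show "0 \<in> {x \<in> S. h x = \<one>\<^bsub>H\<^esub>}" using h.hom_one assms(1) by (simp add: add_subgroup_zero)
  fix x y assume "x \<in> {x \<in> S. h x = \<one>\<^bsub>H\<^esub>}" "y \<in> {x \<in> S. h x = \<one>\<^bsub>H\<^esub>}"
  then show "x - y \<in> {x \<in> S. h x = \<one>\<^bsub>H\<^esub>}"
    using h.hom_mult[of x "- y"] h.hom_inv[of y] assms(1)
    by (simp add: inv_add_group add_subgroup_minus add_subgroup_diff)
qed

lemma frag_extend_const: "frag_extend (\<lambda>_. c) x = frag_cmul (augmentation x) c"
  by (rule poly_mapping_eqI)
    (simp add: frag_extend_def augmentation_def lookup_sum sum_distrib_right)

lemma augmentation_diff: "augmentation (x - y) = augmentation x - augmentation y"
proof -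
  have eq: "augmentation x = Poly_Mapping.lookup (frag_extend (\<lambda>_. frag_of ()) x) ()" for x :: "'a \<Rightarrow>\<^sub>0 int"
    by (simp add: frag_extend_const)
  show ?thesis by (simp add: eq frag_extend_diff lookup_minus)
qed

lemma augmentation_of [simp]: "augmentation (frag_of a) = 1"
  by (simp add: augmentation_def)

lemma augmentation_zero [simp]: "augmentation 0 = 0"
  by (simp add: augmentation_def)

lemma carrier_group_ring: "carrier (group_ring G) = {x. Poly_Mapping.keys x \<subseteq> carrier G}"
  by (simp add: group_ring_def)

lemma aug_ideal_iff: "x \<in> aug_ideal G \<longleftrightarrow> Poly_Mapping.keys x \<subseteq> carrier G \<and> augmentation x = 0"
  by (simp add: aug_ideal_def carrier_group_ring)

lemma add_subgroup_aug_ideal: "add_subgroup (aug_ideal G)"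
  using add_subgroup_keys[of "carrier G"]
  by (auto simp: add_subgroup_def aug_ideal_iff augmentation_diff)

text \<open>The generators \<open>a - 1\<close> of the augmentation ideal.\<close>
abbreviation aug_gen :: "('a, 'm) monoid_scheme \<Rightarrow> 'a \<Rightarrow> ('a \<Rightarrow>\<^sub>0 int)" where
  "aug_gen G a \<equiv> frag_of a - frag_of \<one>\<^bsub>G\<^esub>"

lemma aug_gen_in: "\<one>\<^bsub>G\<^esub> \<in> carrier G \<Longrightarrow> a \<in> carrier G \<Longrightarrow> aug_gen G a \<in> aug_ideal G"
  using diff_in_free_Abelian_group[of "frag_of a" "carrier G" "frag_of \<one>\<^bsub>G\<^esub>"]
  by (simp add: aug_ideal_iff augmentation_diff)

lemma aug_ideal_subset:
  assumes "add_subgroup J" "\<And>a. a \<in> carrier G \<Longrightarrow> aug_gen G a \<in> J"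
  shows "aug_ideal G \<subseteq> J"
proof
  fix x assume x: "x \<in> aug_ideal G"
  have "x = frag_extend frag_of x - frag_extend (\<lambda>_. frag_of \<one>\<^bsub>G\<^esub>) x"
    using x frag_expansion[of x] by (simp add: frag_extend_const aug_ideal_iff)
  also have "\<dots> = frag_extend (aug_gen G) x" by (simp add: frag_extend_fun_diff)
  also have "\<dots> \<in> J"
    unfolding frag_extend_def using x assms
    by (intro add_subgroup_sum add_subgroup_cmul) (auto simp: aug_ideal_iff)
  finally show "x \<in> J" .
qed

text \<open>The multiplication of the group ring.\<close>
abbreviation rmult :: "('a, 'm) monoid_scheme \<Rightarrow> ('a \<Rightarrow>\<^sub>0 int) \<Rightarrow> ('a \<Rightarrow>\<^sub>0 int) \<Rightarrow> ('a \<Rightarrow>\<^sub>0 int)" where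
  "rmult G \<equiv> biextend (\<lambda>a b. frag_of (a \<otimes>\<^bsub>G\<^esub> b))"

lemma mult_group_ring: "x \<otimes>\<^bsub>group_ring G\<^esub> y = rmult G x y"
  by (simp add: group_ring_def biextend_def)

lemma add_group_ring: "x \<oplus>\<^bsub>group_ring G\<^esub> y = x + y"
  by (simp add: group_ring_def)

lemma rmult_assoc:
  assumes "group G" "Poly_Mapping.keys x \<subseteq> carrier G" "Poly_Mapping.keys y \<subseteq> carrier G"
    "Poly_Mapping.keys z \<subseteq> carrier G"
  shows "rmult G (rmult G x y) z = rmult G x (rmult G y z)"
proof -
  interpret G: group G by fact
  show ?thesis using assms(2)
  proof (induction x rule: frag_induction)
    case (one a)
    show ?case using assms(3)
    proof (induction y rule: frag_induction)
      case (one b)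
      show ?case using assms(4)
        by (induction z rule: frag_induction)
          (use one \<open>a \<in> carrier G\<close> in \<open>auto simp: biextend_diff_right G.m_assoc\<close>)
    qed (auto simp: biextend_diff_left biextend_diff_right)
  qed (auto simp: biextend_diff_left biextend_diff_right)
qed

lemma rmult_one:
  assumes "group G" "Poly_Mapping.keys x \<subseteq> carrier G"
  shows "rmult G (frag_of \<one>\<^bsub>G\<^esub>) x = x"
proof -
  interpret G: group G by fact
  show ?thesis using assms(2)
    by (induction x rule: frag_induction) (auto simp: biextend_diff_right)
qed

lemma rmult_aug_gen:
  assumes "group G" "a \<in> carrier G" "b \<in> carrier G"
  shows "rmult G (aug_gen G a) (aug_gen G b) = aug_gen G (a \<otimes>\<^bsub>G\<^esub> b) - aug_gen G a - aug_gen G b"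
proof -
  interpret G: group G by fact
  show ?thesis using assms by (simp add: biextend_diff_left biextend_diff_right)
qed

lemma rmult_aug_gen_left:
  assumes "group G" "a \<in> carrier G" "b \<in> carrier G"
  shows "rmult G (rmult G (aug_gen G a) (aug_gen G b)) x
    = rmult G (aug_gen G (a \<otimes>\<^bsub>G\<^esub> b)) x - rmult G (aug_gen G a) x - rmult G (aug_gen G b) x"
  unfolding rmult_aug_gen[OF assms] by (simp only: biextend_diff_left)

lemma rmult_aug_gen_right:
  assumes "group G" "a \<in> carrier G" "b \<in> carrier G"
  shows "rmult G x (rmult G (aug_gen G a) (aug_gen G b))
    = rmult G x (aug_gen G (a \<otimes>\<^bsub>G\<^esub> b)) - rmult G x (aug_gen G a) - rmult G x (aug_gen G b)"
  unfolding rmult_aug_gen[OF assms] by (simp only: biextend_diff_right)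

lemma rmult_aug_ideal:
  assumes "group G" "Poly_Mapping.keys x \<subseteq> carrier G" "y \<in> aug_ideal G"
  shows "rmult G x y \<in> aug_ideal G"
proof -
  interpret G: group G by fact
  note I = add_subgroup_aug_ideal[of G]
  have 1: "rmult G (frag_of a) y \<in> aug_ideal G" if "a \<in> carrier G" for a
  proof -
    have "aug_ideal G \<subseteq> {y. rmult G (frag_of a) y \<in> aug_ideal G}"
    proof (rule aug_ideal_subset)
      show "add_subgroup {y. rmult G (frag_of a) y \<in> aug_ideal G}"
        using I by (simp add: add_subgroup_def biextend_diff_right)
      show "aug_gen G b \<in> {y. rmult G (frag_of a) y \<in> aug_ideal G}" if "b \<in> carrier G" for b
        using add_subgroup_diff[OF I aug_gen_in[of G "a \<otimes>\<^bsub>G\<^esub> b"] aug_gen_in[of G a]] that \<open>a \<in> carrier G\<close>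
        by (simp add: biextend_diff_right)
    qed
    with assms(3) show ?thesis by auto
  qed
  show ?thesis using assms(2)
    by (induction x rule: frag_induction)
      (auto simp: 1 biextend_diff_left add_subgroup_zero[OF I] add_subgroup_diff[OF I])
qed

lemma rmult_in:
  assumes "add_subgroup J"
    and "\<And>a b. a \<in> S \<Longrightarrow> b \<in> carrier G \<Longrightarrow> rmult G (aug_gen G a) (aug_gen G b) \<in> J"
    and "x \<in> aug_ideal (G\<lparr>carrier := S\<rparr>)" "y \<in> aug_ideal G"
  shows "rmult G x y \<in> J"
proof -
  have "aug_ideal G \<subseteq> {y. \<forall>a\<in>S. rmult G (aug_gen G a) y \<in> J}"
    by (rule aug_ideal_subset) (use assms(1,2) in \<open>auto simp: add_subgroup_def biextend_diff_right[of _ _ _ "frag_of _"] biextend_diff_right\<close>)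
  then have 1: "rmult G (aug_gen G a) y \<in> J" if "a \<in> S" for a
    using assms(4) that by auto
  have "aug_ideal (G\<lparr>carrier := S\<rparr>) \<subseteq> {x. rmult G x y \<in> J}"
    by (rule aug_ideal_subset) (use assms(1) 1 in \<open>auto simp: add_subgroup_def biextend_diff_left\<close>)
  then show ?thesis using assms(3) by auto
qed

lemma add_subgroup_ideal_prod:
  assumes "add_subgroup I" "0 \<in> J"
  shows "add_subgroup (ideal_prod (group_ring G) I J)"
proof (rule add_subgroupI)
  show "0 \<in> ideal_prod (group_ring G) I J"
    using ideal_prod.prod[of 0 I 0 J "group_ring G"] assms
    by (simp add: add_subgroup_zero mult_group_ring)
  fix x y assume x: "x \<in> ideal_prod (group_ring G) I J" and "y \<in> ideal_prod (group_ring G) I J"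
  from this(2) have "- y \<in> ideal_prod (group_ring G) I J"
  proof induction
    case (prod i j)
    then show ?case
      using ideal_prod.prod[of "- i" I j J "group_ring G"] add_subgroup_minus[OF assms(1)]
      by (simp add: mult_group_ring biextend_minus)
  next
    case (sum s t)
    then show ?case using ideal_prod.sum[OF sum(3,4)] by (simp add: add_group_ring)
  qed
  from ideal_prod.sum[OF x this] show "x - y \<in> ideal_prod (group_ring G) I J"
    by (simp add: add_group_ring)
qed

lemma ideal_prod_subset:
  assumes "add_subgroup K" "\<And>i j. i \<in> I \<Longrightarrow> j \<in> J \<Longrightarrow> rmult G i j \<in> K"
  shows "ideal_prod (group_ring G) I J \<subseteq> K"
proof
  fix x assume "x \<in> ideal_prod (group_ring G) I J"
  then show "x \<in> K"
    by induction (use assms in \<open>auto simp: mult_group_ring add_group_ring add_subgroup_add\<close>)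
qed

lemma rmult_in_ideal_prod: "i \<in> I \<Longrightarrow> j \<in> J \<Longrightarrow> rmult G i j \<in> ideal_prod (group_ring G) I J"
  using ideal_prod.prod[of i I j J "group_ring G"] by (simp add: mult_group_ring)

lemma add_subgroup_aug_power: "add_subgroup (aug_power G k)"
proof (induction k)
  case 0
  show ?case using add_subgroup_keys by (simp add: carrier_group_ring)
qed (simp add: add_subgroup_ideal_prod add_subgroup_aug_ideal add_subgroup_zero)

lemma aug_power_one:
  assumes "group G"
  shows "aug_power G (Suc 0) = aug_ideal G"
proof
  interpret G: group G by fact
  show "aug_power G (Suc 0) \<subseteq> aug_ideal G"
    using rmult_aug_ideal[OF assms]
    by (simp, intro ideal_prod_subset add_subgroup_aug_ideal) (auto simp: carrier_group_ring)
  show "aug_ideal G \<subseteq> aug_power G (Suc 0)"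
  proof
    fix x assume x: "x \<in> aug_ideal G"
    then have "rmult G (frag_of \<one>\<^bsub>G\<^esub>) x \<in> aug_power G (Suc 0)"
      by (auto intro!: rmult_in_ideal_prod simp: carrier_group_ring)
    then show "x \<in> aug_power G (Suc 0)" using x rmult_one[OF assms] by (simp add: aug_ideal_iff)
  qed
qed

lemma aug_power_three:
  assumes "group G"
  shows "aug_power G 3 = ideal_prod (group_ring G) (ideal_prod (group_ring G) (aug_ideal G) (aug_ideal G)) (aug_ideal G)"
proof -
  have "aug_power G 3 = ideal_prod (group_ring G) (ideal_prod (group_ring G) (aug_power G (Suc 0)) (aug_ideal G)) (aug_ideal G)"
    by (simp add: numeral_3_eq_3)
  then show ?thesis by (simp only: aug_power_one[OF assms])
qed

section \<open>The group \<open>P\<^sub>2(G,B)\<close>\<close>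

lemma P2_ker_eq:
  "P2_ker G B = {x + y | x y. x \<in> ideal_prod (group_ring G) (aug_ideal (G\<lparr>carrier := B\<rparr>)) (aug_ideal G)
     \<and> y \<in> aug_power G 3}"
  unfolding P2_ker_def set_add_def set_mult_def by (auto simp: group_ring_def)

lemma add_subgroup_sumset:
  assumes "add_subgroup S" "add_subgroup T"
  shows "add_subgroup {x + y | x y. x \<in> S \<and> y \<in> T}"
proof (rule add_subgroupI)
  show "0 \<in> {x + y | x y. x \<in> S \<and> y \<in> T}" using assms by (force dest: add_subgroup_zero)
  fix a b assume "a \<in> {x + y | x y. x \<in> S \<and> y \<in> T}" "b \<in> {x + y | x y. x \<in> S \<and> y \<in> T}"
  then obtain x y x' y' where "a = x + y" "b = x' + y'" "x \<in> S" "x' \<in> S" "y \<in> T" "y' \<in> T" by auto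
  then have "a - b = (x - x') + (y - y')" "x - x' \<in> S" "y - y' \<in> T"
    using assms by (auto simp: add_subgroup_diff)
  then show "a - b \<in> {x + y | x y. x \<in> S \<and> y \<in> T}" by blast
qed

lemma add_subgroup_P2_ker: "add_subgroup (P2_ker G B)"
  unfolding P2_ker_eq
  by (intro add_subgroup_sumset add_subgroup_ideal_prod add_subgroup_aug_power add_subgroup_aug_ideal
      add_subgroup_zero)

text \<open>The products \<open>(b - 1)(g - 1)\<close> and \<open>((a - 1)(b - 1))(c - 1)\<close> generate \<open>I(B) I(G) + I\<^sup>3(G)\<close>
  additively.\<close>
lemma P2_ker_subset:
  assumes "group G" "add_subgroup J"
    and "\<And>b g. b \<in> B \<Longrightarrow> g \<in> carrier G \<Longrightarrow> rmult G (aug_gen G b) (aug_gen G g) \<in> J"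
    and "\<And>a b c. a \<in> carrier G \<Longrightarrow> b \<in> carrier G \<Longrightarrow> c \<in> carrier G \<Longrightarrow>
       rmult G (rmult G (aug_gen G a) (aug_gen G b)) (aug_gen G c) \<in> J"
  shows "P2_ker G B \<subseteq> J"
proof -
  have 1: "ideal_prod (group_ring G) (aug_ideal (G\<lparr>carrier := B\<rparr>)) (aug_ideal G) \<subseteq> J"
    by (rule ideal_prod_subset[OF assms(2)], rule rmult_in[OF assms(2,3)]) auto
  let ?J2 = "{x. \<forall>c\<in>carrier G. rmult G x (aug_gen G c) \<in> J}"
  have J2: "add_subgroup ?J2"
    using assms(2) by (auto simp: add_subgroup_def biextend_diff_left)
  have sub2: "ideal_prod (group_ring G) (aug_ideal G) (aug_ideal G) \<subseteq> ?J2"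
    by (rule ideal_prod_subset[OF J2], rule rmult_in[OF J2, of "carrier G"]) (use assms(4) in auto)
  have "rmult G x y \<in> J" if "x \<in> ?J2" "y \<in> aug_ideal G" for x y
  proof -
    have "aug_ideal G \<subseteq> {y. rmult G x y \<in> J}"
      by (rule aug_ideal_subset) (use assms(2) that in \<open>auto simp: add_subgroup_def biextend_diff_right\<close>)
    with that show ?thesis by auto
  qed
  then have "aug_power G 3 \<subseteq> J"
    unfolding aug_power_three[OF assms(1)] using sub2
    by (intro ideal_prod_subset[OF assms(2)]) auto
  with 1 show ?thesis unfolding P2_ker_eq by (auto intro!: add_subgroup_add[OF assms(2)])
qed

lemma P2_ker_memI:
  assumes "group G"
  shows "x \<in> aug_ideal (G\<lparr>carrier := B\<rparr>) \<Longrightarrow> y \<in> aug_ideal G \<Longrightarrow> rmult G x y \<in> P2_ker G B"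
    and "x \<in> aug_ideal G \<Longrightarrow> y \<in> aug_ideal G \<Longrightarrow> z \<in> aug_ideal G \<Longrightarrow> rmult G (rmult G x y) z \<in> P2_ker G B"
proof -
  show "rmult G x y \<in> P2_ker G B" if "x \<in> aug_ideal (G\<lparr>carrier := B\<rparr>)" "y \<in> aug_ideal G"
    unfolding P2_ker_eq using rmult_in_ideal_prod[OF that, of G] add_subgroup_zero[OF add_subgroup_aug_power[of G 3]]
    by force
  show "rmult G (rmult G x y) z \<in> P2_ker G B"
    if "x \<in> aug_ideal G" "y \<in> aug_ideal G" "z \<in> aug_ideal G"
  proof -
    have "rmult G (rmult G x y) z \<in> aug_power G 3"
      unfolding aug_power_three[OF assms] using that by (intro rmult_in_ideal_prod)
    moreover have "0 \<in> ideal_prod (group_ring G) (aug_ideal (G\<lparr>carrier := B\<rparr>)) (aug_ideal G)"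
      by (intro add_subgroup_zero add_subgroup_ideal_prod add_subgroup_aug_ideal)
    ultimately show ?thesis unfolding P2_ker_eq by force
  qed
qed

lemma P2_ker_aug_ideal:
  assumes "group G" "B \<subseteq> carrier G"
  shows "P2_ker G B \<subseteq> aug_ideal G"
proof -
  interpret G: group G by fact
  show ?thesis
  proof (rule P2_ker_subset[OF assms(1) add_subgroup_aug_ideal])
    have *: "rmult G (aug_gen G a) (aug_gen G b) \<in> aug_ideal G" if "a \<in> carrier G" "b \<in> carrier G" for a b
      using that aug_gen_in[of G a] by (intro rmult_aug_ideal[OF assms(1)] aug_gen_in) (auto simp: aug_ideal_iff)
    then show "rmult G (aug_gen G b) (aug_gen G g) \<in> aug_ideal G" if "b \<in> B" "g \<in> carrier G" for b g
      using that assms(2) by blast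
    show "rmult G (rmult G (aug_gen G a) (aug_gen G b)) (aug_gen G c) \<in> aug_ideal G"
      if "a \<in> carrier G" "b \<in> carrier G" "c \<in> carrier G" for a b c
      using that * by (intro rmult_aug_ideal[OF assms(1)] aug_gen_in) (auto simp: aug_ideal_iff)
  qed
qed

text \<open>The multiplication of \<open>P\<^sub>2(G,B)\<close> is well defined even if \<open>B\<close> is not central, since
  \<open>I(G) I(B) I(G)\<close> lies in \<open>I\<^sup>3(G)\<close>.\<close>
lemma P2_ker_absorb:
  assumes "group G" "subgroup B G" "x \<in> P2_ker G B" "y \<in> aug_ideal G"
  shows "rmult G x y \<in> P2_ker G B" and "rmult G y x \<in> P2_ker G B"
proof -
  interpret G: group G by fact
  interpret B: subgroup B G by fact
  let ?K = "P2_ker G B"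
  note K = add_subgroup_P2_ker[of G B]
  let ?J = "{x. \<forall>y\<in>aug_ideal G. rmult G x y \<in> ?K \<and> rmult G y x \<in> ?K}"
  have J: "add_subgroup ?J"
    using K by (simp add: add_subgroup_def biextend_diff_left biextend_diff_right)
  have ag: "aug_gen G a \<in> aug_ideal G" if "a \<in> carrier G" for a
    using that by (intro aug_gen_in) auto
  have keys: "Poly_Mapping.keys x \<subseteq> carrier G" if "x \<in> aug_ideal G" for x
    using that by (simp add: aug_ideal_iff)
  have mult: "rmult G x y \<in> aug_ideal G" if "x \<in> aug_ideal G" "y \<in> aug_ideal G" for x y
    using that by (intro rmult_aug_ideal[OF assms(1)] keys)
  have "?K \<subseteq> ?J"
  proof (rule P2_ker_subset[OF assms(1) J])
    fix b g assume b: "b \<in> B" and g: "g \<in> carrier G"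
    have bB: "aug_gen G b \<in> aug_ideal (G\<lparr>carrier := B\<rparr>)"
      using aug_gen_in[of "G\<lparr>carrier := B\<rparr>" b] b by simp
    have bG: "aug_gen G b \<in> aug_ideal G" using b by (intro ag) auto
    show "rmult G (aug_gen G b) (aug_gen G g) \<in> ?J"
    proof (intro CollectI ballI conjI)
      fix y assume y: "y \<in> aug_ideal G"
      show "rmult G (rmult G (aug_gen G b) (aug_gen G g)) y \<in> ?K"
        by (intro P2_ker_memI(2)[OF assms(1)] bG ag g y)
      show "rmult G y (rmult G (aug_gen G b) (aug_gen G g)) \<in> ?K"
        using P2_ker_memI(2)[OF assms(1) y bG ag[OF g], of B]
        by (simp add: rmult_assoc[OF assms(1) keys[OF y] keys[OF bG] keys[OF ag[OF g]]])
    qed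
  next
    fix a b c assume "a \<in> carrier G" "b \<in> carrier G" "c \<in> carrier G"
    then have a: "aug_gen G a \<in> aug_ideal G" and b: "aug_gen G b \<in> aug_ideal G" and c: "aug_gen G c \<in> aug_ideal G"
      by (auto intro: ag)
    show "rmult G (rmult G (aug_gen G a) (aug_gen G b)) (aug_gen G c) \<in> ?J"
    proof (intro CollectI ballI conjI)
      fix y assume y: "y \<in> aug_ideal G"
      show "rmult G (rmult G (rmult G (aug_gen G a) (aug_gen G b)) (aug_gen G c)) y \<in> ?K"
        by (intro P2_ker_memI(2)[OF assms(1)] mult a b c y)
      show "rmult G y (rmult G (rmult G (aug_gen G a) (aug_gen G b)) (aug_gen G c)) \<in> ?K"
        using P2_ker_memI(2)[OF assms(1) y mult[OF a b] c, of B]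
        by (simp add: rmult_assoc[OF assms(1) keys[OF y] keys[OF mult[OF a b]] keys[OF c]])
    qed
  qed
  then show "rmult G x y \<in> ?K" "rmult G y x \<in> ?K" using assms(3,4) by auto
qed

text \<open>The additive group of the augmentation ideal, of which \<open>P\<^sub>2(G,B)\<close> is a quotient.\<close>
abbreviation aug_group :: "('a, 'm) monoid_scheme \<Rightarrow> ('a \<Rightarrow>\<^sub>0 int) monoid" where
  "aug_group G \<equiv> add_group (aug_ideal G)"

lemma P2_eq: "P2 G B = aug_group G Mod P2_ker G B"
  by (simp add: P2_def P2_ring_def FactRing_def FactGroup_def A_RCOSETS_def RCOSETS_def
      r_coset_def set_add_def set_mult_def group_ring_def)

lemma a_r_coset_group_ring: "K +>\<^bsub>group_ring G\<^esub> x = K #>\<^bsub>aug_group G\<^esub> x"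
  by (simp add: a_r_coset_def r_coset_def group_ring_def)

text \<open>The class \<open>\<rho>(x)\<close> in \<open>P\<^sub>2(G,B)\<close>.\<close>
abbreviation P2_class :: "('a, 'm) monoid_scheme \<Rightarrow> 'a set \<Rightarrow> ('a \<Rightarrow>\<^sub>0 int) \<Rightarrow> ('a \<Rightarrow>\<^sub>0 int) set" where
  "P2_class G B x \<equiv> P2_ker G B #>\<^bsub>aug_group G\<^esub> x"

lemma p2_eq: "p2 G B a = P2_class G B (aug_gen G a)"
  by (simp add: p2_def a_r_coset_group_ring)

lemma P2_ker_normal:
  assumes "group G" "B \<subseteq> carrier G"
  shows "P2_ker G B \<lhd> aug_group G"
  by (intro normal_add_group add_subgroup_aug_ideal add_subgroup_P2_ker P2_ker_aug_ideal assms)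

lemma comm_group_P2:
  assumes "group G" "B \<subseteq> carrier G"
  shows "comm_group (P2 G B)"
  unfolding P2_eq
  by (intro comm_group.abelian_FactGroup comm_group_add_group add_subgroup_aug_ideal
      normal_imp_subgroup P2_ker_normal assms)

lemma gens_aug_group:
  assumes "group G"
  shows "gens (aug_group G) (aug_gen G ` carrier G)"
  unfolding gens_def
proof (intro conjI allI impI)
  interpret G: group G by fact
  show "aug_gen G ` carrier G \<subseteq> carrier (aug_group G)" by (auto intro: aug_gen_in)
  fix J assume J: "subgroup J (aug_group G)" "aug_gen G ` carrier G \<subseteq> J"
  interpret J: subgroup J "aug_group G" by fact
  have "add_subgroup J"
  proof (rule add_subgroupI)
    show "0 \<in> J" using J.one_closed by simp
    fix x y assume x: "x \<in> J" and y: "y \<in> J"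
    have "inv\<^bsub>aug_group G\<^esub> y = - y"
      using J.mem_carrier[OF y] by (simp add: inv_add_group[OF add_subgroup_aug_ideal])
    then show "x - y \<in> J" using J.m_closed[OF x J.m_inv_closed[OF y]] by simp
  qed
  from aug_ideal_subset[OF this] show "carrier (aug_group G) \<subseteq> J" using J(2) by auto
qed

lemma gens_P2:
  assumes "group G" "B \<subseteq> carrier G"
  shows "gens (P2 G B) (p2 G B ` carrier G)"
  using gens_FactGroup[OF P2_ker_normal[OF assms] gens_aug_group[OF assms(1)]]
  by (simp add: P2_eq p2_eq image_image)

text \<open>The product \<open>p\<^sub>2(a) p\<^sub>2(b)\<close>, as the class of \<open>(a - 1)(b - 1)\<close>.\<close>
definition p2_prod :: "('a, 'm) monoid_scheme \<Rightarrow> 'a set \<Rightarrow> 'a \<times> 'a \<Rightarrow> ('a \<Rightarrow>\<^sub>0 int) set" where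
  "p2_prod G B = (\<lambda>(a, b). P2_class G B (rmult G (aug_gen G a) (aug_gen G b)))"

lemma P2_coset_eq:
  assumes "x - y \<in> P2_ker G B"
  shows "P2_class G B x = P2_class G B y"
proof -
  note K = add_subgroup_P2_ker[of G B]
  have 1: "P2_class G B x \<subseteq> P2_class G B y"
    if "x - y \<in> P2_ker G B" for x y
  proof
    fix z assume "z \<in> P2_class G B x"
    then obtain k where k: "k \<in> P2_ker G B" "z = k + x" by (auto simp: r_coset_def)
    then have "z = (k + (x - y)) + y" "k + (x - y) \<in> P2_ker G B"
      using add_subgroup_add[OF K k(1) that] by simp_all
    then show "z \<in> P2_class G B y"
      unfolding r_coset_def by (intro UN_I[of "k + (x - y)"]) simp_all
  qed
  from add_subgroup_minus[OF K assms] have "y - x \<in> P2_ker G B" by simp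
  from 1[OF this] 1[OF assms] show ?thesis by (rule equalityI[rotated])
qed

lemma p2_mult:
  assumes "group G" "subgroup B G" "a \<in> carrier G" "b \<in> carrier G"
  shows "p2 G B a \<otimes>\<^bsub>P2_ring G B\<^esub> p2 G B b = p2_prod G B (a, b)"
proof -
  interpret G: group G by fact
  note K = add_subgroup_P2_ker[of G B]
  have *: "P2_class G B (rmult G x y) = p2_prod G B (a, b)"
    if "x \<in> p2 G B a" "y \<in> p2 G B b" for x y
  proof -
    from that obtain k l where kl: "k \<in> P2_ker G B" "l \<in> P2_ker G B" "x = k + aug_gen G a" "y = l + aug_gen G b"
      unfolding p2_eq r_coset_def by auto
    have a: "aug_gen G a \<in> aug_ideal G" and b: "aug_gen G b \<in> aug_ideal G" using assms by (auto intro: aug_gen_in)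
    have l: "l \<in> aug_ideal G" using P2_ker_aug_ideal[OF assms(1) subgroup.subset[OF assms(2)]] kl by auto
    have "rmult G k l \<in> P2_ker G B" "rmult G k (aug_gen G b) \<in> P2_ker G B" "rmult G (aug_gen G a) l \<in> P2_ker G B"
      by (intro P2_ker_absorb assms kl a b l)+
    then have "rmult G x y - rmult G (aug_gen G a) (aug_gen G b) \<in> P2_ker G B"
      unfolding kl biextend_add(1) biextend_add(2) using K by (simp add: add_subgroup_add)
    from P2_coset_eq[OF this] show ?thesis by (simp add: p2_prod_def)
  qed
  have "p2 G B a \<noteq> {}" "p2 G B b \<noteq> {}" using add_subgroup_zero[OF K] by (auto simp: p2_eq r_coset_def)
  then have "(\<Union>x\<in>p2 G B a. \<Union>y\<in>p2 G B b. P2_class G B (rmult G x y)) = p2_prod G B (a, b)"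
    using * by auto
  moreover have "p2 G B a \<otimes>\<^bsub>P2_ring G B\<^esub> p2 G B b = (\<Union>x\<in>p2 G B a. \<Union>y\<in>p2 G B b. P2_class G B (rmult G x y))"
    unfolding P2_ring_def FactRing_def rcoset_mult_def
    by (simp add: mult_group_ring a_r_coset_def r_coset_def add_group_ring)
  ultimately show ?thesis by simp
qed

lemma P2_class_hom:
  assumes "group G" "B \<subseteq> carrier G"
  shows "P2_class G B \<in> hom (aug_group G) (P2 G B)"
  using normal.r_coset_hom_Mod[OF P2_ker_normal[OF assms]] by (simp add: P2_eq)

lemma P2_class_add:
  assumes "group G" "B \<subseteq> carrier G" "x \<in> aug_ideal G" "y \<in> aug_ideal G"
  shows "P2_class G B (x + y) = P2_class G B x \<otimes>\<^bsub>P2 G B\<^esub> P2_class G B y"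
  using hom_mult[OF P2_class_hom[OF assms(1,2)]] assms(3,4) by simp

lemma P2_class_one:
  assumes "group G" "x \<in> P2_ker G B"
  shows "P2_class G B x = \<one>\<^bsub>P2 G B\<^esub>"
proof -
  have "P2_class G B x = P2_class G B 0"
    by (rule P2_coset_eq) (use assms in simp)
  then show ?thesis by (simp add: P2_eq r_coset_def)
qed

lemma p2_props:
  assumes "group G" "subgroup B G"
  shows "a \<in> carrier G \<Longrightarrow> p2 G B a \<in> carrier (P2 G B)"
    and "bimult G G (P2 G B) (p2_prod G B)"
    and "a \<in> carrier G \<Longrightarrow> b \<in> carrier G \<Longrightarrow>
      p2 G B (a \<otimes>\<^bsub>G\<^esub> b) = p2 G B a \<otimes>\<^bsub>P2 G B\<^esub> p2 G B b \<otimes>\<^bsub>P2 G B\<^esub> p2_prod G B (a, b)"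
    and "a \<in> B \<Longrightarrow> b \<in> carrier G \<Longrightarrow> p2_prod G B (a, b) = \<one>\<^bsub>P2 G B\<^esub>"
proof -
  interpret G: group G by fact
  interpret B: subgroup B G by fact
  note c = P2_class_hom[OF assms(1) B.subset]
  have ag: "aug_gen G a \<in> aug_ideal G" if "a \<in> carrier G" for a
    using that by (intro aug_gen_in) auto
  have agg: "rmult G (aug_gen G a) (aug_gen G b) \<in> aug_ideal G" if "a \<in> carrier G" "b \<in> carrier G" for a b
    using that ag by (intro rmult_aug_ideal[OF assms(1)]) (auto simp: aug_ideal_iff)
  show "p2 G B a \<in> carrier (P2 G B)" if "a \<in> carrier G"
    unfolding p2_eq using hom_in_carrier[OF c] ag[OF that] by simp
  show "p2 G B (a \<otimes>\<^bsub>G\<^esub> b) = p2 G B a \<otimes>\<^bsub>P2 G B\<^esub> p2 G B b \<otimes>\<^bsub>P2 G B\<^esub> p2_prod G B (a, b)"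
    if "a \<in> carrier G" "b \<in> carrier G"
  proof -
    have "aug_gen G (a \<otimes>\<^bsub>G\<^esub> b) = (aug_gen G a + aug_gen G b) + rmult G (aug_gen G a) (aug_gen G b)"
      using that by (simp add: rmult_aug_gen[OF assms(1)])
    then show ?thesis
      unfolding p2_eq p2_prod_def
      using that by (simp only: P2_class_add[OF assms(1) B.subset] ag agg add_subgroup_add[OF add_subgroup_aug_ideal] prod.case)
  qed
  show "p2_prod G B (a, b) = \<one>\<^bsub>P2 G B\<^esub>" if "a \<in> B" "b \<in> carrier G"
    unfolding p2_prod_def using that aug_gen_in[of "G\<lparr>carrier := B\<rparr>" a]
    by (auto intro!: P2_class_one[OF assms(1)] P2_ker_memI(1)[OF assms(1)] ag)
  show "bimult G G (P2 G B) (p2_prod G B)"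
    unfolding bimult_def
  proof (intro conjI ballI)
    fix a b assume a: "a \<in> carrier G" and b: "b \<in> carrier G"
    show "p2_prod G B (a, b) \<in> carrier (P2 G B)"
      unfolding p2_prod_def using hom_in_carrier[OF c] agg[OF a b] by simp
    fix a' assume a': "a' \<in> carrier G"
    have "rmult G (aug_gen G (a \<otimes>\<^bsub>G\<^esub> a')) (aug_gen G b)
      - (rmult G (aug_gen G a) (aug_gen G b) + rmult G (aug_gen G a') (aug_gen G b))
      = rmult G (rmult G (aug_gen G a) (aug_gen G a')) (aug_gen G b)"
      by (simp add: rmult_aug_gen_left[OF assms(1) a a'])
    then have "rmult G (aug_gen G (a \<otimes>\<^bsub>G\<^esub> a')) (aug_gen G b)
      - (rmult G (aug_gen G a) (aug_gen G b) + rmult G (aug_gen G a') (aug_gen G b)) \<in> P2_ker G B"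
      using P2_ker_memI(2)[OF assms(1) ag[OF a] ag[OF a'] ag[OF b]] by simp
    from P2_coset_eq[OF this]
    show "p2_prod G B (a \<otimes>\<^bsub>G\<^esub> a', b) = p2_prod G B (a, b) \<otimes>\<^bsub>P2 G B\<^esub> p2_prod G B (a', b)"
      unfolding p2_prod_def prod.case by (simp only: P2_class_add[OF assms(1) B.subset] agg a a' b)
  next
    fix a b b' assume a: "a \<in> carrier G" and b: "b \<in> carrier G" and b': "b' \<in> carrier G"
    have "rmult G (aug_gen G a) (aug_gen G (b \<otimes>\<^bsub>G\<^esub> b'))
      - (rmult G (aug_gen G a) (aug_gen G b) + rmult G (aug_gen G a) (aug_gen G b'))
      = rmult G (aug_gen G a) (rmult G (aug_gen G b) (aug_gen G b'))"
      by (simp add: rmult_aug_gen_right[OF assms(1) b b'])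
    also have "\<dots> = rmult G (rmult G (aug_gen G a) (aug_gen G b)) (aug_gen G b')"
      using ag a b b' by (subst rmult_assoc[OF assms(1)]) (simp_all add: aug_ideal_iff)
    also have "\<dots> \<in> P2_ker G B" by (intro P2_ker_memI(2)[OF assms(1)] ag a b b')
    finally have "rmult G (aug_gen G a) (aug_gen G (b \<otimes>\<^bsub>G\<^esub> b'))
      - (rmult G (aug_gen G a) (aug_gen G b) + rmult G (aug_gen G a) (aug_gen G b')) \<in> P2_ker G B" .
    from P2_coset_eq[OF this]
    show "p2_prod G B (a, b \<otimes>\<^bsub>G\<^esub> b') = p2_prod G B (a, b) \<otimes>\<^bsub>P2 G B\<^esub> p2_prod G B (a, b')"
      unfolding p2_prod_def prod.case by (simp only: P2_class_add[OF assms(1) B.subset] agg a b' b)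
  qed
qed

text \<open>The universal property of \<open>P\<^sub>2(G,B)\<close>: a map \<open>q\<close> from \<open>G\<close> to an abelian group \<open>E\<close> extends to
  \<open>P\<^sub>2(G,B)\<close> if its deviation \<open>\<beta>\<close> from being multiplicative is bimultiplicative and vanishes on \<open>B\<close>.
  The homomorphism \<open>h\<close> on the augmentation ideal is a parameter because \<^const>\<open>P2_map\<close> is not
  defined by the linear extension of a map on \<open>G\<close> with values in \<open>E\<close>, as \<^const>\<open>rho1\<close> and \<^const>\<open>rho2\<close> are.\<close>
lemma P2_universal:
  assumes "group G" "subgroup B G" "comm_group E" "h \<in> hom (aug_group G) E"
    and h: "\<And>a. a \<in> carrier G \<Longrightarrow> h (aug_gen G a) = q a"
    and \<beta>: "bimult G G E \<beta>"
    and q: "\<And>a b. a \<in> carrier G \<Longrightarrow> b \<in> carrier G \<Longrightarrow>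
      q (a \<otimes>\<^bsub>G\<^esub> b) = q a \<otimes>\<^bsub>E\<^esub> q b \<otimes>\<^bsub>E\<^esub> \<beta> (a, b)"
    and B: "\<And>b g. b \<in> B \<Longrightarrow> g \<in> carrier G \<Longrightarrow> \<beta> (b, g) = \<one>\<^bsub>E\<^esub>"
  shows "coset_map h \<in> hom (P2 G B) E"
    and "a \<in> carrier G \<Longrightarrow> coset_map h (p2 G B a) = q a"
    and "a \<in> carrier G \<Longrightarrow> b \<in> carrier G \<Longrightarrow> coset_map h (p2_prod G B (a, b)) = \<beta> (a, b)"
proof -
  interpret G: group G by fact
  interpret B: subgroup B G by fact
  interpret E: comm_group E by fact
  note I = add_subgroup_aug_ideal[of G]
  interpret h: group_hom "aug_group G" E h
    by (rule group_homI[OF comm_group.axioms(2)[OF comm_group_add_group[OF I]] E.is_group assms(4)])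
  have ag: "aug_gen G a \<in> aug_ideal G" if "a \<in> carrier G" for a
    using that by (intro aug_gen_in) auto
  have agg: "rmult G (aug_gen G a) (aug_gen G b) \<in> aug_ideal G" if "a \<in> carrier G" "b \<in> carrier G" for a b
    using that ag by (intro rmult_aug_ideal[OF assms(1)]) (auto simp: aug_ideal_iff)
  have qc: "q a \<in> carrier E" if "a \<in> carrier G" for a
    using h.hom_closed[of "aug_gen G a"] ag[OF that] by (simp add: h that)
  note \<beta>c = bimultD(1)[OF \<beta>]
  have hd: "h (x - y) = h x \<otimes>\<^bsub>E\<^esub> inv\<^bsub>E\<^esub> h y" if "x \<in> aug_ideal G" "y \<in> aug_ideal G" for x y
    using h.hom_mult[of x "- y"] h.hom_inv[of y] that by (simp add: inv_add_group[OF I] add_subgroup_minus[OF I])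
  have h2: "h (rmult G (aug_gen G a) (aug_gen G b)) = \<beta> (a, b)" if "a \<in> carrier G" "b \<in> carrier G" for a b
  proof -
    have "aug_gen G (a \<otimes>\<^bsub>G\<^esub> b) = aug_gen G a + aug_gen G b + rmult G (aug_gen G a) (aug_gen G b)"
      using that by (simp add: rmult_aug_gen[OF assms(1)])
    then have "q (a \<otimes>\<^bsub>G\<^esub> b) = h (aug_gen G a + aug_gen G b + rmult G (aug_gen G a) (aug_gen G b))"
      using that h[of "a \<otimes>\<^bsub>G\<^esub> b"] by (simp only: G.m_closed)
    also have "\<dots> = q a \<otimes>\<^bsub>E\<^esub> q b \<otimes>\<^bsub>E\<^esub> h (rmult G (aug_gen G a) (aug_gen G b))"
      using that h.hom_mult[of "aug_gen G a + aug_gen G b" "rmult G (aug_gen G a) (aug_gen G b)"]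
        h.hom_mult[of "aug_gen G a" "aug_gen G b"] ag agg add_subgroup_add[OF I ag ag]
      by (simp add: h)
    finally show ?thesis
      using that q[of a b]
        h.hom_closed[of "rmult G (aug_gen G a) (aug_gen G b)"] agg[of a b] by (simp add: qc \<beta>c)
  qed
  have ker: "h n = \<one>\<^bsub>E\<^esub>" if "n \<in> P2_ker G B" for n
  proof -
    have "P2_ker G B \<subseteq> {x \<in> aug_ideal G. h x = \<one>\<^bsub>E\<^esub>}"
    proof (rule P2_ker_subset[OF assms(1) add_subgroup_kernel_add_group[OF I E.is_group assms(4)]])
      fix b g assume "b \<in> B" "g \<in> carrier G"
      then show "rmult G (aug_gen G b) (aug_gen G g) \<in> {x \<in> aug_ideal G. h x = \<one>\<^bsub>E\<^esub>}"
        by (simp add: agg h2 B)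
    next
      fix a b c assume a: "a \<in> carrier G" and b: "b \<in> carrier G" and c: "c \<in> carrier G"
      have eq: "rmult G (rmult G (aug_gen G a) (aug_gen G b)) (aug_gen G c)
        = rmult G (aug_gen G (a \<otimes>\<^bsub>G\<^esub> b)) (aug_gen G c) - rmult G (aug_gen G a) (aug_gen G c)
          - rmult G (aug_gen G b) (aug_gen G c)"
        by (rule rmult_aug_gen_left[OF assms(1) a b])
      show "rmult G (rmult G (aug_gen G a) (aug_gen G b)) (aug_gen G c) \<in> {x \<in> aug_ideal G. h x = \<one>\<^bsub>E\<^esub>}"
        unfolding eq using a b c
        by (simp add: hd h2 agg add_subgroup_diff[OF I] bimultD(2)[OF \<beta>] \<beta>c E.m_assoc E.inv_mult
            E.m_comm[of "\<beta> (a, c)"])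
    qed
    with that show ?thesis by auto
  qed
  note L = P2_ker_normal[OF assms(1) B.subset] E.is_group assms(4) ker
  show "coset_map h \<in> hom (P2 G B) E" unfolding P2_eq by (rule coset_map_hom[OF L])
  show "coset_map h (p2 G B a) = q a" if "a \<in> carrier G"
    unfolding p2_eq using that ag by (subst coset_map_rcoset[OF L]) (auto simp: h)
  show "coset_map h (p2_prod G B (a, b)) = \<beta> (a, b)" if "a \<in> carrier G" "b \<in> carrier G"
    unfolding p2_prod_def prod.case using that agg by (subst coset_map_rcoset[OF L]) (auto simp: h2)
qed

lemma P2_universal_free_lift:
  assumes "group G" "subgroup B G" "comm_group E" "q \<in> carrier G \<rightarrow> carrier E"
    and \<beta>: "bimult G G E \<beta>"
    and q: "\<And>a b. a \<in> carrier G \<Longrightarrow> b \<in> carrier G \<Longrightarrow>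
      q (a \<otimes>\<^bsub>G\<^esub> b) = q a \<otimes>\<^bsub>E\<^esub> q b \<otimes>\<^bsub>E\<^esub> \<beta> (a, b)"
    and B: "\<And>b g. b \<in> B \<Longrightarrow> g \<in> carrier G \<Longrightarrow> \<beta> (b, g) = \<one>\<^bsub>E\<^esub>"
  shows "coset_map (free_lift E q) \<in> hom (P2 G B) E"
    and "a \<in> carrier G \<Longrightarrow> coset_map (free_lift E q) (p2 G B a) = q a"
    and "a \<in> carrier G \<Longrightarrow> b \<in> carrier G \<Longrightarrow> coset_map (free_lift E q) (p2_prod G B (a, b)) = \<beta> (a, b)"
proof -
  interpret G: group G by fact
  interpret E: comm_group E by fact
  have qc: "q a \<in> carrier E" if "a \<in> carrier G" for a using assms(4) that by auto
  have "q \<one>\<^bsub>G\<^esub> \<otimes>\<^bsub>E\<^esub> q \<one>\<^bsub>G\<^esub> = q \<one>\<^bsub>G\<^esub>"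
    using q[of "\<one>\<^bsub>G\<^esub>" "\<one>\<^bsub>G\<^esub>"] bimult_one(1)[OF \<beta> assms(1,1) E.is_group, of "\<one>\<^bsub>G\<^esub>"] qc by simp
  then have q1: "q \<one>\<^bsub>G\<^esub> = \<one>\<^bsub>E\<^esub>" using qc by simp
  note fl = free_lift_hom[OF assms(3,4)]
  interpret h: group_hom "free_Abelian_group (carrier G)" E "free_lift E q"
    by (rule group_homI[OF group_free_Abelian_group E.is_group fl])
  have hom: "free_lift E q \<in> hom (aug_group G) E"
    using fl by (auto simp: hom_def aug_ideal_iff)
  have val: "free_lift E q (aug_gen G a) = q a" if "a \<in> carrier G" for a
    using h.hom_mult[of "frag_of a" "- frag_of \<one>\<^bsub>G\<^esub>"] h.hom_inv[of "frag_of \<one>\<^bsub>G\<^esub>"] that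
    by (simp add: free_lift_of[OF assms(3)] qc q1)
  note U = P2_universal[OF assms(1,2,3) hom val \<beta> q B]
  show "coset_map (free_lift E q) \<in> hom (P2 G B) E" by (rule U(1))
  show "a \<in> carrier G \<Longrightarrow> coset_map (free_lift E q) (p2 G B a) = q a" by (rule U(2))
  show "a \<in> carrier G \<Longrightarrow> b \<in> carrier G \<Longrightarrow> coset_map (free_lift E q) (p2_prod G B (a, b)) = \<beta> (a, b)"
    by (rule U(3))
qed

section \<open>Commutators modulo \<open>\<gamma>\<^sub>3\<close>\<close>

lemma hom_derived_one:
  assumes "group G" "comm_group H" "f \<in> hom G H" "x \<in> derived_subgroup G"
  shows "f x = \<one>\<^bsub>H\<^esub>"
proof -
  interpret H: comm_group H by fact
  interpret f: group_hom G H f by (rule group_homI[OF assms(1) H.is_group assms(3)])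
  have "derived_subgroup G \<subseteq> kernel G H f"
    unfolding derived_def
  proof (rule f.G.generate_subgroup_incl[OF _ f.subgroup_kernel], clarify)
    fix a b assume ab: "a \<in> carrier G" "b \<in> carrier G"
    then have "f (a \<otimes>\<^bsub>G\<^esub> b \<otimes>\<^bsub>G\<^esub> inv\<^bsub>G\<^esub> a \<otimes>\<^bsub>G\<^esub> inv\<^bsub>G\<^esub> b) = f a \<otimes>\<^bsub>H\<^esub> f b \<otimes>\<^bsub>H\<^esub> inv\<^bsub>H\<^esub> f a \<otimes>\<^bsub>H\<^esub> inv\<^bsub>H\<^esub> f b"
      by simp
    also have "f a \<otimes>\<^bsub>H\<^esub> f b = f b \<otimes>\<^bsub>H\<^esub> f a" using ab by (simp add: H.m_comm)
    finally show "a \<otimes>\<^bsub>G\<^esub> b \<otimes>\<^bsub>G\<^esub> inv\<^bsub>G\<^esub> a \<otimes>\<^bsub>G\<^esub> inv\<^bsub>G\<^esub> b \<in> kernel G H f"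
      using ab by (simp add: kernel_def H.m_assoc)
  qed
  with assms(4) show ?thesis by (auto simp: kernel_def)
qed

lemma hom_commutator:
  assumes "group G" "group H" "f \<in> hom G H" "a \<in> carrier G" "b \<in> carrier G"
  shows "f (commutator G a b) = commutator H (f a) (f b)"
proof -
  interpret f: group_hom G H f by (rule group_homI[OF assms(1-3)])
  show ?thesis using assms by (simp add: commutator_def)
qed

context group
begin

lemma inv_mult_cancel_left: "x \<in> carrier G \<Longrightarrow> y \<in> carrier G \<Longrightarrow> inv x \<otimes> (x \<otimes> y) = y"
  by (simp add: m_assoc[symmetric])

lemma mult_inv_cancel_left: "x \<in> carrier G \<Longrightarrow> y \<in> carrier G \<Longrightarrow> x \<otimes> (inv x \<otimes> y) = y"
  by (simp add: m_assoc[symmetric])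

lemmas group_simps = m_assoc inv_mult_group inv_mult_cancel_left mult_inv_cancel_left

lemma commutator_closed [simp]: "a \<in> carrier G \<Longrightarrow> b \<in> carrier G \<Longrightarrow> commutator G a b \<in> carrier G"
  by (simp add: commutator_def)

lemma commutator_in_derived: "a \<in> carrier G \<Longrightarrow> b \<in> carrier G \<Longrightarrow> commutator G a b \<in> derived_subgroup G"
  unfolding derived_def commutator_def by (rule generate.incl) auto

lemma derived_subgroup_subset: "derived_subgroup G \<subseteq> carrier G"
  by (rule derived_in_carrier) simp

lemma commutator_gen_gamma3:
  "g \<in> carrier G \<Longrightarrow> d \<in> derived_subgroup G \<Longrightarrow> commutator G g d \<in> gamma3 G"
  unfolding gamma3_def commutator_subgroup_def by (rule generate.incl) auto

lemma commutator_inv: "a \<in> carrier G \<Longrightarrow> b \<in> carrier G \<Longrightarrow> inv (commutator G a b) = commutator G b a"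
  by (simp add: commutator_def group_simps)

lemma commutator_conj: "g \<in> carrier G \<Longrightarrow> a \<in> carrier G \<Longrightarrow> b \<in> carrier G \<Longrightarrow>
   g \<otimes> commutator G a b \<otimes> inv g = commutator G (g \<otimes> a \<otimes> inv g) (g \<otimes> b \<otimes> inv g)"
  by (simp add: commutator_def group_simps)

lemma commutator_mult_left: "a \<in> carrier G \<Longrightarrow> a' \<in> carrier G \<Longrightarrow> b \<in> carrier G \<Longrightarrow>
   commutator G (a \<otimes> a') b = commutator G a (commutator G a' b) \<otimes> commutator G a' b \<otimes> commutator G a b"
  by (simp add: commutator_def group_simps)

lemma commutator_mult_right: "a \<in> carrier G \<Longrightarrow> b \<in> carrier G \<Longrightarrow> b' \<in> carrier G \<Longrightarrow>
   commutator G a (b \<otimes> b') = commutator G a b \<otimes> commutator G b (commutator G a b') \<otimes> commutator G a b'"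
  by (simp add: commutator_def group_simps)

lemma gamma3_normal: "gamma3 G \<lhd> G"
  unfolding gamma3_def commutator_subgroup_def
proof (rule normal_generateI)
  interpret D: normal "derived_subgroup G" G by (rule derived_self_is_normal)
  show "{commutator G s t |s t. s \<in> carrier G \<and> t \<in> derived_subgroup G} \<subseteq> carrier G"
    using derived_subgroup_subset by auto
  fix h g assume "h \<in> {commutator G s t |s t. s \<in> carrier G \<and> t \<in> derived_subgroup G}" and g: "g \<in> carrier G"
  then obtain s t where st: "h = commutator G s t" "s \<in> carrier G" "t \<in> derived_subgroup G" by auto
  then have "g \<otimes> h \<otimes> inv g = commutator G (g \<otimes> s \<otimes> inv g) (g \<otimes> t \<otimes> inv g)"
    using g derived_subgroup_subset by (simp add: commutator_conj subset_iff)
  moreover have "g \<otimes> t \<otimes> inv g \<in> derived_subgroup G" using g st by (simp add: D.inv_op_closed2)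
  ultimately show "g \<otimes> h \<otimes> inv g \<in> {commutator G s t |s t. s \<in> carrier G \<and> t \<in> derived_subgroup G}"
    using g st by (intro CollectI exI[of _ "g \<otimes> s \<otimes> inv g"] exI[of _ "g \<otimes> t \<otimes> inv g"]) simp
qed

lemma gamma3_subset_derived: "gamma3 G \<subseteq> derived_subgroup G"
  unfolding gamma3_def commutator_subgroup_def
  using derived_subgroup_subset
  by (intro generate_subgroup_incl[OF _ derived_is_subgroup]) (auto intro!: commutator_in_derived)

lemma comm_group_FactGroup_derived:
  assumes "N \<lhd> G" "derived_subgroup G \<subseteq> N"
  shows "comm_group (G Mod N)"
proof (rule group.group_comm_groupI)
  interpret N: normal N G by fact
  show "group (G Mod N)" by (rule N.factorgroup_is_group)
  fix X Y assume "X \<in> carrier (G Mod N)" "Y \<in> carrier (G Mod N)"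
  then obtain x y where xy: "x \<in> carrier G" "y \<in> carrier G" "X = N #> x" "Y = N #> y"
    by (auto simp: carrier_FactGroup)
  have "x \<otimes> y \<otimes> inv (y \<otimes> x) = commutator G x y"
    using xy by (simp add: commutator_def group_simps)
  then have "N #> (x \<otimes> y) = N #> (y \<otimes> x)"
    using xy assms(2) commutator_in_derived[of x y]
    by (subst r_coset_eq_iff[OF N.subgroup_axioms]) auto
  then show "X \<otimes>\<^bsub>G Mod N\<^esub> Y = Y \<otimes>\<^bsub>G Mod N\<^esub> X"
    using xy by (simp add: N.rcos_sum)
qed

lemma central_subgroup_normal:
  assumes "central_subgroup B G"
  shows "B \<lhd> G"
proof -
  have B: "subgroup B G" and c: "\<And>b g. b \<in> B \<Longrightarrow> g \<in> carrier G \<Longrightarrow> b \<otimes> g = g \<otimes> b"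
    using assms by (auto simp: central_subgroup_def)
  show ?thesis
  proof (rule normal_invI[OF B])
    fix x h assume "x \<in> carrier G" "h \<in> B"
    then show "x \<otimes> h \<otimes> inv x \<in> B"
      using subgroup.mem_carrier[OF B] by (simp flip: c add: m_assoc)
  qed
qed

lemma central_mult_normal:
  assumes "central_subgroup B G" "N \<lhd> G"
  shows "B <#> N \<lhd> G"
proof -
  have c: "\<And>b g. b \<in> B \<Longrightarrow> g \<in> carrier G \<Longrightarrow> g \<otimes> b = b \<otimes> g"
    using assms by (auto simp: central_subgroup_def)
  interpret B: normal B G by (rule central_subgroup_normal[OF assms(1)])
  interpret N: normal N G by fact
  have mem: "x \<in> B <#> N \<longleftrightarrow> (\<exists>b\<in>B. \<exists>n\<in>N. x = b \<otimes> n)" for x by (auto simp: set_mult_def)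
  have c': "g \<otimes> (b \<otimes> h) = b \<otimes> (g \<otimes> h)" if "b \<in> B" "g \<in> carrier G" "h \<in> carrier G" for b g h
    using that c[of b g] by (metis B.mem_carrier m_assoc)
  show ?thesis
  proof (rule normal_invI)
    show "subgroup (B <#> N) G"
    proof (rule subgroup.intro)
      show "B <#> N \<subseteq> carrier G" by (auto simp: mem)
      show "\<one> \<in> B <#> N" unfolding mem by (intro bexI[of _ \<one>]) auto
      fix x y assume x: "x \<in> B <#> N" and y: "y \<in> B <#> N"
      then obtain b n b' n' where xy: "b \<in> B" "n \<in> N" "x = b \<otimes> n" "b' \<in> B" "n' \<in> N" "y = b' \<otimes> n'"
        by (auto simp: mem)
      then have "x \<otimes> y = (b \<otimes> b') \<otimes> (n \<otimes> n')"
        by (simp add: m_assoc c' B.mem_carrier)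
      then show "x \<otimes> y \<in> B <#> N" using xy unfolding mem by (intro bexI[of _ "b \<otimes> b'"] bexI[of _ "n \<otimes> n'"]) auto
      have "inv x = inv b \<otimes> inv n" using xy by (simp add: inv_mult_group c)
      then show "inv x \<in> B <#> N" using xy unfolding mem by (intro bexI[of _ "inv b"] bexI[of _ "inv n"]) auto
    qed
    fix g x assume g: "g \<in> carrier G" and "x \<in> B <#> N"
    then obtain b n where x: "b \<in> B" "n \<in> N" "x = b \<otimes> n" by (auto simp: mem)
    then have "g \<otimes> x \<otimes> inv g = b \<otimes> (g \<otimes> n \<otimes> inv g)"
      using g by (simp add: m_assoc c')
    then show "g \<otimes> x \<otimes> inv g \<in> B <#> N"
      unfolding mem using g x N.inv_op_closed2[of g n] by (intro bexI[of _ b] bexI[of _ "g \<otimes> n \<otimes> inv g"]) auto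
  qed
qed

end

lemma bimult_cong:
  assumes "group A" "group B" "bimult A B C \<phi>"
    "\<And>a b. a \<in> carrier A \<Longrightarrow> b \<in> carrier B \<Longrightarrow> \<psi> (a, b) = \<phi> (a, b)"
  shows "bimult A B C \<psi>"
proof -
  interpret A: group A by fact
  interpret B: group B by fact
  show ?thesis using assms(3,4) by (auto simp: bimult_def)
qed

text \<open>A bimultiplicative map that is trivial on \<open>N\<close> in both arguments descends to \<open>G/N\<close>.\<close>
lemma bimult_coset_map:
  assumes "N \<lhd> G" "group C" "bimult G G C \<phi>"
    and "\<And>n g. n \<in> N \<Longrightarrow> g \<in> carrier G \<Longrightarrow> \<phi> (n, g) = \<one>\<^bsub>C\<^esub>"
    and "\<And>n g. n \<in> N \<Longrightarrow> g \<in> carrier G \<Longrightarrow> \<phi> (g, n) = \<one>\<^bsub>C\<^esub>"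
  shows "a \<in> carrier G \<Longrightarrow> b \<in> carrier G \<Longrightarrow>
      coset_map \<phi> ((N #>\<^bsub>G\<^esub> a) \<times> (N #>\<^bsub>G\<^esub> b)) = \<phi> (a, b)"
    and "bimult (G Mod N) (G Mod N) C (\<lambda>(X, Y). coset_map \<phi> (X \<times> Y))"
proof -
  interpret N: normal N G by fact
  interpret C: group C by fact
  have val: "coset_map \<phi> ((N #>\<^bsub>G\<^esub> a) \<times> (N #>\<^bsub>G\<^esub> b)) = \<phi> (a, b)" if ab: "a \<in> carrier G" "b \<in> carrier G" for a b
  proof (rule coset_mapI)
    show "(N #>\<^bsub>G\<^esub> a) \<times> (N #>\<^bsub>G\<^esub> b) \<noteq> {}"
      using N.r_coset_nonempty by simp
    fix z assume "z \<in> (N #>\<^bsub>G\<^esub> a) \<times> (N #>\<^bsub>G\<^esub> b)"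
    then obtain m n where z: "z = (m \<otimes>\<^bsub>G\<^esub> a, n \<otimes>\<^bsub>G\<^esub> b)" and mn: "m \<in> N" "n \<in> N"
      by (auto simp: r_coset_def)
    have m: "m \<in> carrier G" and n: "n \<in> carrier G" using mn by (auto simp: N.mem_carrier)
    have "\<phi> z = \<phi> (m, n \<otimes>\<^bsub>G\<^esub> b) \<otimes>\<^bsub>C\<^esub> (\<phi> (a, n) \<otimes>\<^bsub>C\<^esub> \<phi> (a, b))"
      unfolding z using ab m n by (simp add: bimultD(2)[OF assms(3)] bimultD(3)[OF assms(3), of a])
    then show "\<phi> z = \<phi> (a, b)"
      using ab m n mn assms(4,5) bimultD(1)[OF assms(3)] by simp
  qed
  then show "a \<in> carrier G \<Longrightarrow> b \<in> carrier G \<Longrightarrow>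
      coset_map \<phi> ((N #>\<^bsub>G\<^esub> a) \<times> (N #>\<^bsub>G\<^esub> b)) = \<phi> (a, b)" .
  show "bimult (G Mod N) (G Mod N) C (\<lambda>(X, Y). coset_map \<phi> (X \<times> Y))"
    unfolding bimult_def
    by (auto simp: carrier_FactGroup N.rcos_sum val bimultD[OF assms(3)])
qed

text \<open>A group with a central subgroup.  In the locale, \<open>D = G'\<close>, \<open>\<gamma> = \<gamma>\<^sub>3(G)\<close>, \<open>M = BG'\<close>, \<open>A = G/BG'\<close>,
  \<open>C = BG'/\<gamma>\<^sub>3(G)\<close>, \<open>T = A \<otimes> A\<close>, \<open>W = A \<and> A\<close>, \<open>P = P\<^sub>2(G,B)\<close>, and \<open>\<beta>(a, b) = p\<^sub>2(a) p\<^sub>2(b)\<close>.\<close>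
locale central_pair = group G for G (structure) +
  fixes B
  assumes central: "central_subgroup B G"
begin

abbreviation "D \<equiv> derived_subgroup G"
abbreviation "\<gamma> \<equiv> gamma3 G"
abbreviation "M \<equiv> BG' G B"
abbreviation "A \<equiv> G_mod_BG' G B"
abbreviation "C \<equiv> BG'_mod_gamma3 G B"
abbreviation "T \<equiv> tensor_square_quot G B"
abbreviation "W \<equiv> exterior_square_quot G B"
abbreviation "P \<equiv> P2 G B"
abbreviation "\<beta> \<equiv> p2_prod G B"

lemma subgroup_B: "subgroup B G"
  using central by (simp add: central_subgroup_def)

sublocale B: normal B G by (rule central_subgroup_normal[OF central])
sublocale D: normal D G by (rule derived_self_is_normal)
sublocale \<gamma>: normal \<gamma> G by (rule gamma3_normal)
sublocale M: normal M G unfolding BG'_def by (rule central_mult_normal[OF central D.normal_axioms])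

lemma B_comm: "b \<in> B \<Longrightarrow> g \<in> carrier G \<Longrightarrow> b \<otimes> g = g \<otimes> b"
  using central unfolding central_subgroup_def by blast

lemma M_iff: "x \<in> M \<longleftrightarrow> (\<exists>b\<in>B. \<exists>d\<in>D. x = b \<otimes> d)"
  by (auto simp: BG'_def set_mult_def)

lemma B_subset_M: "B \<subseteq> M"
proof
  fix b assume "b \<in> B"
  then show "b \<in> M" unfolding M_iff by (intro bexI[of _ b] bexI[of _ \<one>]) auto
qed

lemma D_subset_M: "D \<subseteq> M"
proof
  fix d assume "d \<in> D"
  then show "d \<in> M" unfolding M_iff by (intro bexI[of _ \<one>] bexI[of _ d]) auto
qed

lemma \<gamma>_subset_M: "\<gamma> \<subseteq> M" using gamma3_subset_derived D_subset_M by blast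

lemma commutator_M_right:
  assumes "g \<in> carrier G" "m \<in> M" shows "commutator G g m \<in> \<gamma>"
proof -
  obtain b d where m: "b \<in> B" "d \<in> D" "m = b \<otimes> d" using assms(2) by (auto simp: M_iff)
  have c: "g \<otimes> (b \<otimes> h) = b \<otimes> (g \<otimes> h)" if "h \<in> carrier G" "g \<in> carrier G" for g h
    using that m B_comm[of b g] by (metis B.mem_carrier m_assoc)
  have "commutator G g m = b \<otimes> (commutator G g d \<otimes> inv b)"
    using assms(1) m by (simp add: commutator_def group_simps c)
  also have "\<dots> = commutator G g d"
    using assms(1) m B_comm[of "inv b" "commutator G g d"]
    by (simp add: B.mem_carrier mult_inv_cancel_left flip: B_comm)
  also have "\<dots> \<in> \<gamma>" using assms(1) m(2) by (rule commutator_gen_gamma3)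
  finally show ?thesis .
qed

lemma commutator_M_left:
  assumes "g \<in> carrier G" "m \<in> M" shows "commutator G m g \<in> \<gamma>"
  using \<gamma>.m_inv_closed[OF commutator_M_right[OF assms]] assms
  by (simp add: commutator_inv)

lemma A_eq: "A = G Mod M" by (simp add: G_mod_BG'_def)

lemma comm_group_A: "comm_group A"
  unfolding A_eq by (rule comm_group_FactGroup_derived[OF M.normal_axioms D_subset_M])

lemma group_A: "group A" by (rule comm_group.axioms(2)[OF comm_group_A])

lemma T_eq: "T = tensor_product A A" by (simp add: tensor_square_quot_def)
lemma W_eq: "W = exterior_square A" by (simp add: exterior_square_quot_def)

lemma comm_group_T: "comm_group T" unfolding T_eq by (rule comm_group_tensor_product[OF group_A group_A])
lemma comm_group_W: "comm_group W" unfolding W_eq by (rule comm_group_exterior_square[OF group_A])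
lemma comm_group_P: "comm_group P" by (rule comm_group_P2[OF is_group B.subset])

sublocale T: comm_group T by (rule comm_group_T)
sublocale W: comm_group W by (rule comm_group_W)
sublocale P: comm_group P by (rule comm_group_P)

lemma \<gamma>_normal_M: "\<gamma> \<lhd> G\<lparr>carrier := M\<rparr>"
  by (rule normal_restrict_supergroup[OF M.subgroup_axioms \<gamma>.normal_axioms \<gamma>_subset_M])

lemma carrier_C: "carrier C = (\<lambda>x. \<gamma> #> x) ` M"
  by (simp add: BG'_mod_gamma3_def carrier_FactGroup)

lemma mult_C: "x \<in> carrier G \<Longrightarrow> y \<in> carrier G \<Longrightarrow> (\<gamma> #> x) \<otimes>\<^bsub>C\<^esub> (\<gamma> #> y) = \<gamma> #> (x \<otimes> y)"
  by (simp add: BG'_mod_gamma3_def \<gamma>.rcos_sum)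

lemma one_C: "\<one>\<^bsub>C\<^esub> = \<gamma>"
  by (simp add: BG'_mod_gamma3_def)

lemma \<gamma>_coset_one: "x \<in> \<gamma> \<Longrightarrow> \<gamma> #> x = \<one>\<^bsub>C\<^esub>"
  by (simp add: one_C \<gamma>.rcos_const[OF is_group])

lemma comm_group_C: "comm_group C"
proof (rule group.group_comm_groupI)
  show "group C" unfolding BG'_mod_gamma3_def by (rule normal.factorgroup_is_group[OF \<gamma>_normal_M])
  fix X Y assume "X \<in> carrier C" "Y \<in> carrier C"
  then obtain x y where xy: "x \<in> M" "y \<in> M" "X = \<gamma> #> x" "Y = \<gamma> #> y"
    by (auto simp: carrier_C)
  then have x: "x \<in> carrier G" and y: "y \<in> carrier G" by (auto simp: M.mem_carrier)
  have "x \<otimes> y \<otimes> inv (y \<otimes> x) = commutator G x y"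
    using x y by (simp add: commutator_def group_simps)
  then have "\<gamma> #> (x \<otimes> y) = \<gamma> #> (y \<otimes> x)"
    using commutator_M_right[OF x xy(2)] x y by (subst r_coset_eq_iff[OF \<gamma>.subgroup_axioms]) auto
  then show "X \<otimes>\<^bsub>C\<^esub> Y = Y \<otimes>\<^bsub>C\<^esub> X" using x y xy by (simp add: mult_C)
qed

sublocale C: comm_group C by (rule comm_group_C)

lemma commutator_in_M: "a \<in> carrier G \<Longrightarrow> b \<in> carrier G \<Longrightarrow> commutator G a b \<in> M"
  using commutator_in_derived D_subset_M by blast

lemma commutator_class_closed:
  "a \<in> carrier G \<Longrightarrow> b \<in> carrier G \<Longrightarrow> \<gamma> #> commutator G a b \<in> carrier C"
  using commutator_in_M by (auto simp: carrier_C)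

lemma commutator_bimult: "bimult G G C (\<lambda>(a, b). \<gamma> #> commutator G a b)"
proof -
  have eq: "\<gamma> #> (c \<otimes> x) = \<gamma> #> x" if "c \<in> \<gamma>" "x \<in> carrier G" for c x
    using that by (metis coset_mult_assoc \<gamma>.mem_carrier \<gamma>.rcos_const \<gamma>.subset is_group)
  show ?thesis
  proof (rule bimultI)
    fix a a' b assume a: "a \<in> carrier G" and a': "a' \<in> carrier G" and b: "b \<in> carrier G"
    have "\<gamma> #> commutator G (a \<otimes> a') b = \<gamma> #> (commutator G a' b \<otimes> commutator G a b)"
      using a b a' commutator_gen_gamma3[OF a commutator_in_derived[OF a' b]]
      by (simp add: commutator_mult_left m_assoc eq)
    also have "\<dots> = (\<gamma> #> commutator G a b) \<otimes>\<^bsub>C\<^esub> (\<gamma> #> commutator G a' b)"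
      using a b a' C.m_comm[OF commutator_class_closed[OF a b] commutator_class_closed[OF a' b]]
      by (simp add: mult_C)
    finally show "\<gamma> #> commutator G (a \<otimes> a') b = \<dots>" .
  next
    fix a b b' assume a: "a \<in> carrier G" and b: "b \<in> carrier G" and b': "b' \<in> carrier G"
    have "\<gamma> #> commutator G a (b \<otimes> b')
       = (\<gamma> #> commutator G a b) \<otimes>\<^bsub>C\<^esub> (\<gamma> #> (commutator G b (commutator G a b') \<otimes> commutator G a b'))"
      using a b b' by (simp add: commutator_mult_right m_assoc mult_C)
    also have "\<gamma> #> (commutator G b (commutator G a b') \<otimes> commutator G a b') = \<gamma> #> commutator G a b'"
      using a b b' commutator_gen_gamma3[OF b commutator_in_derived[OF a b']] by (simp add: eq)
    finally show "\<gamma> #> commutator G a (b \<otimes> b') = (\<gamma> #> commutator G a b) \<otimes>\<^bsub>C\<^esub> (\<gamma> #> commutator G a b')" .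
  qed (rule commutator_class_closed)
qed

lemma gens_T: "gens T {tens A A (M #> a) (M #> b) | a b. a \<in> carrier G \<and> b \<in> carrier G}"
proof -
  have "{tens A A X Y | X Y. X \<in> carrier A \<and> Y \<in> carrier A}
     = {tens A A (M #> a) (M #> b) | a b. a \<in> carrier G \<and> b \<in> carrier G}"
    unfolding A_eq carrier_FactGroup by blast
  then show ?thesis using gens_tensor[OF group_A group_A] by (simp add: T_eq)
qed

lemma gens_W: "gens W {wedge A (M #> a) (M #> b) | a b. a \<in> carrier G \<and> b \<in> carrier G}"
proof -
  have "{wedge A X Y | X Y. X \<in> carrier A \<and> Y \<in> carrier A}
     = {wedge A (M #> a) (M #> b) | a b. a \<in> carrier G \<and> b \<in> carrier G}"
    unfolding A_eq carrier_FactGroup by blast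
  then show ?thesis using gens_exterior[OF group_A] by (simp add: W_eq)
qed

lemma hom_eq_T:
  assumes "group Q" "u \<in> hom T Q" "v \<in> hom T Q" "t \<in> carrier T"
    and "\<And>a b. a \<in> carrier G \<Longrightarrow> b \<in> carrier G \<Longrightarrow>
      u (tens A A (M #> a) (M #> b)) = v (tens A A (M #> a) (M #> b))"
  shows "u t = v t"
  using hom_eq_on_gens[OF T.is_group assms(1-3) gens_T _ assms(4)] assms(5) by blast

lemma hom_eq_W:
  assumes "group Q" "u \<in> hom W Q" "v \<in> hom W Q" "x \<in> carrier W"
    and "\<And>a b. a \<in> carrier G \<Longrightarrow> b \<in> carrier G \<Longrightarrow>
      u (wedge A (M #> a) (M #> b)) = v (wedge A (M #> a) (M #> b))"
  shows "u x = v x"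
  using hom_eq_on_gens[OF W.is_group assms(1-3) gens_W _ assms(4)] assms(5) by blast

lemma hom_eq_P:
  assumes "group Q" "u \<in> hom P Q" "v \<in> hom P Q" "z \<in> carrier P"
    and "\<And>a. a \<in> carrier G \<Longrightarrow> u (p2 G B a) = v (p2 G B a)"
  shows "u z = v z"
  using hom_eq_on_gens[OF P.is_group assms(1-3) gens_P2[OF is_group B.subset] _ assms(4)] assms(5) by blast

lemma M_coset_closed: "a \<in> carrier G \<Longrightarrow> M #> a \<in> carrier A"
  by (auto simp: A_eq carrier_FactGroup)

lemma c2:
  shows c2_hom: "c2 G B \<in> hom W C"
    and c2_wedge: "a \<in> carrier G \<Longrightarrow> b \<in> carrier G \<Longrightarrow>
      c2 G B (wedge A (M #> a) (M #> b)) = \<gamma> #> commutator G a b"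
proof -
  note L = bimult_coset_map[OF M.normal_axioms C.is_group commutator_bimult]
  have 1: "(case (n, g) of (a, b) \<Rightarrow> \<gamma> #> commutator G a b) = \<one>\<^bsub>C\<^esub>" if "n \<in> M" "g \<in> carrier G" for n g
    using \<gamma>_coset_one[OF commutator_M_left[OF that(2,1)]] by simp
  have 2: "(case (g, n) of (a, b) \<Rightarrow> \<gamma> #> commutator G a b) = \<one>\<^bsub>C\<^esub>" if "n \<in> M" "g \<in> carrier G" for n g
    using \<gamma>_coset_one[OF commutator_M_right[OF that(2,1)]] by simp
  note L = L[OF 1 2]
  have alt: "(case (X, X) of (X, Y) \<Rightarrow> coset_map (\<lambda>(a, b). \<gamma> #> commutator G a b) (X \<times> Y)) = \<one>\<^bsub>C\<^esub>"
    if "X \<in> carrier A" for X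
  proof -
    from that obtain x where x: "x \<in> carrier G" "X = M #> x" by (auto simp: A_eq carrier_FactGroup)
    have "commutator G x x = \<one>" using x by (simp add: commutator_def m_assoc)
    then show ?thesis using x \<gamma>_coset_one[OF \<gamma>.one_closed] by (simp add: L(1))
  qed
  note E = exterior_lift[OF group_A C.comm_group_axioms L(2)[folded A_eq] alt]
  show "c2 G B \<in> hom W C" unfolding c2_def W_eq by (rule E(1))
  show "c2 G B (wedge A (M #> a) (M #> b)) = \<gamma> #> commutator G a b" if "a \<in> carrier G" "b \<in> carrier G"
    unfolding c2_def using that by (simp add: E(3) M_coset_closed L(1))
qed

lemma l2_eq: "l2 G B = antisymmetrize A"
  by (simp add: l2_def antisymmetrize_def T_eq Let_def)

lemma l2:
  shows l2_hom: "l2 G B \<in> hom W T"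
    and l2_wedge: "X \<in> carrier A \<Longrightarrow> Y \<in> carrier A \<Longrightarrow>
      l2 G B (wedge A X Y) = tens A A X Y \<otimes>\<^bsub>T\<^esub> inv\<^bsub>T\<^esub> tens A A Y X"
    and l2_inj: "inj_on (l2 G B) (carrier W)"
  using antisymmetrize[OF group_A] by (simp_all add: l2_eq T_eq W_eq)

section \<open>The maps into \<open>P\<^sub>2(G,B)\<close>\<close>

lemmas p2_closed = p2_props(1)[OF is_group subgroup_B]
lemmas \<beta>_bimult = p2_props(2)[OF is_group subgroup_B]
lemmas p2_times = p2_props(3)[OF is_group subgroup_B]
lemmas \<beta>_B_left = p2_props(4)[OF is_group subgroup_B]
lemmas \<beta>_closed = bimultD(1)[OF \<beta>_bimult]

lemma \<beta>_B_right:
  assumes "b \<in> B" "g \<in> carrier G" shows "\<beta> (g, b) = \<one>\<^bsub>P\<^esub>"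
proof -
  have b: "b \<in> carrier G" using assms(1) by (rule B.mem_carrier)
  have "p2 G B g \<otimes>\<^bsub>P\<^esub> p2 G B b \<otimes>\<^bsub>P\<^esub> \<beta> (g, b) = p2 G B g \<otimes>\<^bsub>P\<^esub> p2 G B b \<otimes>\<^bsub>P\<^esub> \<beta> (b, g)"
    using p2_times[OF assms(2) b] p2_times[OF b assms(2)] B_comm[OF assms]
      P.m_comm[OF p2_closed[OF assms(2)] p2_closed[OF b]] by simp
  then have "\<beta> (g, b) = \<beta> (b, g)" using assms(2) b by (simp add: p2_closed \<beta>_closed)
  then show ?thesis using \<beta>_B_left[OF assms] by simp
qed

text \<open>In each argument, \<open>\<beta>\<close> is a homomorphism to an abelian group, so that it vanishes on \<open>G'\<close>.\<close>
lemma \<beta>_M_left: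
  assumes "m \<in> M" "g \<in> carrier G" shows "\<beta> (m, g) = \<one>\<^bsub>P\<^esub>"
proof -
  obtain b d where m: "b \<in> B" "d \<in> D" "m = b \<otimes> d" using assms(1) by (auto simp: M_iff)
  show ?thesis
    using m assms(2) hom_derived_one[OF is_group P.comm_group_axioms bimult_hom(1)[OF \<beta>_bimult assms(2)] m(2)]
    by (simp add: bimultD(2)[OF \<beta>_bimult] \<beta>_B_left)
qed

lemma \<beta>_M_right:
  assumes "m \<in> M" "g \<in> carrier G" shows "\<beta> (g, m) = \<one>\<^bsub>P\<^esub>"
proof -
  obtain b d where m: "b \<in> B" "d \<in> D" "m = b \<otimes> d" using assms(1) by (auto simp: M_iff)
  show ?thesis
    using m assms(2) hom_derived_one[OF is_group P.comm_group_axioms bimult_hom(2)[OF \<beta>_bimult assms(2)] m(2)]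
    by (simp add: bimultD(3)[OF \<beta>_bimult] \<beta>_B_right)
qed

lemma mu2:
  shows mu2_hom: "mu2 G B \<in> hom T P"
    and mu2_tens: "a \<in> carrier G \<Longrightarrow> b \<in> carrier G \<Longrightarrow> mu2 G B (tens A A (M #> a) (M #> b)) = \<beta> (a, b)"
proof -
  let ?\<phi> = "\<lambda>(a, b). p2 G B a \<otimes>\<^bsub>P2_ring G B\<^esub> p2 G B b"
  have eq: "?\<phi> (a, b) = \<beta> (a, b)" if "a \<in> carrier G" "b \<in> carrier G" for a b
    using p2_mult[OF is_group subgroup_B that] by simp
  have 1: "?\<phi> (n, g) = \<one>\<^bsub>P\<^esub>" "?\<phi> (g, n) = \<one>\<^bsub>P\<^esub>" if "n \<in> M" "g \<in> carrier G" for n g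
    using that eq[of n g] eq[of g n] by (simp_all add: \<beta>_M_left \<beta>_M_right)
  note L = bimult_coset_map[OF M.normal_axioms P.is_group bimult_cong[OF is_group is_group \<beta>_bimult eq] 1]
  note E = tensor_lift[OF group_A group_A P.comm_group_axioms L(2)[folded A_eq]]
  show "mu2 G B \<in> hom T P" unfolding mu2_def T_eq by (rule E(1))
  show "mu2 G B (tens A A (M #> a) (M #> b)) = \<beta> (a, b)" if "a \<in> carrier G" "b \<in> carrier G"
    unfolding mu2_def
    using that by (simp add: E(2) M_coset_closed L(1) p2_mult[OF is_group subgroup_B])
qed

lemma p2_mult_M:
  assumes "x \<in> M" "y \<in> carrier G" shows "p2 G B (x \<otimes> y) = p2 G B x \<otimes>\<^bsub>P\<^esub> p2 G B y"
  using assms by (simp add: p2_times \<beta>_M_left p2_closed)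

lemma p2_hom_M: "p2 G B \<in> hom (G\<lparr>carrier := M\<rparr>) P"
  by (rule homI) (auto simp: p2_closed p2_mult_M)

lemma p2_one: "p2 G B \<one> = \<one>\<^bsub>P\<^esub>"
  using hom_one[OF p2_hom_M M.subgroup_is_group[OF is_group] P.is_group] by simp

text \<open>Compare \<open>p\<^sub>2\<close> on both sides of \<open>[a, b]ba = ab\<close>.\<close>
lemma p2_commutator:
  assumes "a \<in> carrier G" "b \<in> carrier G"
  shows "p2 G B (commutator G a b) = \<beta> (a, b) \<otimes>\<^bsub>P\<^esub> inv\<^bsub>P\<^esub> \<beta> (b, a)"
proof -
  have "commutator G a b \<otimes> (b \<otimes> a) = a \<otimes> b"
    using assms by (simp add: commutator_def group_simps)
  then have "p2 G B (commutator G a b) \<otimes>\<^bsub>P\<^esub> p2 G B (b \<otimes> a) = p2 G B (a \<otimes> b)"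
    using p2_mult_M[OF commutator_in_M[OF assms], of "b \<otimes> a"] assms by simp
  then have "p2 G B (commutator G a b) \<otimes>\<^bsub>P\<^esub> \<beta> (b, a) \<otimes>\<^bsub>P\<^esub> (p2 G B b \<otimes>\<^bsub>P\<^esub> p2 G B a)
     = \<beta> (a, b) \<otimes>\<^bsub>P\<^esub> (p2 G B b \<otimes>\<^bsub>P\<^esub> p2 G B a)"
    using assms by (simp add: p2_times p2_closed \<beta>_closed P.m_ac)
  then have "p2 G B (commutator G a b) \<otimes>\<^bsub>P\<^esub> \<beta> (b, a) = \<beta> (a, b)"
    using assms by (simp add: p2_closed \<beta>_closed)
  then show ?thesis
    using assms by (simp add: p2_closed \<beta>_closed P.inv_solve_right)
qed

lemma p2_\<gamma>: "x \<in> \<gamma> \<Longrightarrow> p2 G B x = \<one>\<^bsub>P\<^esub>"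
proof -
  interpret p: group_hom "G\<lparr>carrier := M\<rparr>" P "p2 G B"
    by (rule group_homI[OF M.subgroup_is_group[OF is_group] P.is_group p2_hom_M])
  have K: "subgroup (kernel (G\<lparr>carrier := M\<rparr>) P (p2 G B)) G"
    by (rule incl_subgroup[OF M.subgroup_axioms p.subgroup_kernel])
  have "\<gamma> \<subseteq> kernel (G\<lparr>carrier := M\<rparr>) P (p2 G B)"
    unfolding gamma3_def commutator_subgroup_def
  proof (rule generate_subgroup_incl[OF _ K], clarify)
    fix g d assume g: "g \<in> carrier G" and d: "d \<in> D"
    have "d \<in> M" using d D_subset_M by auto
    then show "commutator G g d \<in> kernel (G\<lparr>carrier := M\<rparr>) P (p2 G B)"
      using g d by (simp add: kernel_def commutator_in_M p2_commutator \<beta>_M_left \<beta>_M_right)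
  qed
  then show "x \<in> \<gamma> \<Longrightarrow> p2 G B x = \<one>\<^bsub>P\<^esub>" by (auto simp: kernel_def)
qed

lemma p2_bar:
  shows p2_bar_hom: "p2_bar G B \<in> hom C P"
    and p2_bar_coset: "x \<in> M \<Longrightarrow> p2_bar G B (\<gamma> #> x) = p2 G B x"
proof -
  note L = \<gamma>_normal_M P.is_group p2_hom_M p2_\<gamma>
  show "p2_bar G B \<in> hom C P"
    unfolding p2_bar_def BG'_mod_gamma3_def by (rule coset_map_hom[OF L])
  show "p2_bar G B (\<gamma> #> x) = p2 G B x" if "x \<in> M"
    unfolding p2_bar_def using coset_map_rcoset[OF L, of x] that by simp
qed

text \<open>By \<open>p\<^sub>2(ab) = p\<^sub>2(a) + p\<^sub>2(b) + p\<^sub>2(a) p\<^sub>2(b)\<close>, the elements of this form are a subgroup.\<close>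
lemma p2_decomp:
  assumes "z \<in> carrier P"
  obtains a t where "a \<in> carrier G" "t \<in> carrier T" "z = p2 G B a \<otimes>\<^bsub>P\<^esub> mu2 G B t"
proof -
  interpret mu: group_hom T P "mu2 G B" by (rule group_homI[OF T.is_group P.is_group mu2_hom])
  note tc = bimultD(1)[OF tens_bimult[OF group_A group_A], folded T_eq, simplified]
  let ?J = "{p2 G B a \<otimes>\<^bsub>P\<^esub> mu2 G B t | a t. a \<in> carrier G \<and> t \<in> carrier T}"
  have J: "subgroup ?J P"
  proof (rule subgroup.intro)
    show "?J \<subseteq> carrier P" by (auto simp: p2_closed)
    show "\<one>\<^bsub>P\<^esub> \<in> ?J" by (intro CollectI exI[of _ \<one>] exI[of _ "\<one>\<^bsub>T\<^esub>"]) (simp add: p2_one)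
    fix x y assume "x \<in> ?J" "y \<in> ?J"
    then obtain a s b t where xy: "a \<in> carrier G" "s \<in> carrier T" "x = p2 G B a \<otimes>\<^bsub>P\<^esub> mu2 G B s"
      "b \<in> carrier G" "t \<in> carrier T" "y = p2 G B b \<otimes>\<^bsub>P\<^esub> mu2 G B t" by auto
    let ?t = "\<lambda>a b. tens A A (M #> a) (M #> b)"
    have ab: "?t a b \<in> carrier T" using xy by (auto intro!: tc M_coset_closed)
    have "p2 G B a \<otimes>\<^bsub>P\<^esub> p2 G B b = p2 G B (a \<otimes> b) \<otimes>\<^bsub>P\<^esub> inv\<^bsub>P\<^esub> mu2 G B (?t a b)"
      using xy by (simp add: p2_times mu2_tens p2_closed \<beta>_closed P.m_assoc)
    then have "x \<otimes>\<^bsub>P\<^esub> y = p2 G B (a \<otimes> b) \<otimes>\<^bsub>P\<^esub> mu2 G B (inv\<^bsub>T\<^esub> ?t a b \<otimes>\<^bsub>T\<^esub> s \<otimes>\<^bsub>T\<^esub> t)"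
      using xy ab by (simp add: p2_closed P.m_ac)
    then show "x \<otimes>\<^bsub>P\<^esub> y \<in> ?J" using xy ab by blast
    have ai: "?t a (inv a) \<in> carrier T" using xy by (auto intro!: tc M_coset_closed)
    have "p2 G B a \<otimes>\<^bsub>P\<^esub> (p2 G B (inv a) \<otimes>\<^bsub>P\<^esub> mu2 G B (?t a (inv a))) = \<one>\<^bsub>P\<^esub>"
      using xy p2_times[of a "inv a"] by (simp add: mu2_tens p2_one p2_closed \<beta>_closed P.m_assoc)
    then have "inv\<^bsub>P\<^esub> p2 G B a = p2 G B (inv a) \<otimes>\<^bsub>P\<^esub> mu2 G B (?t a (inv a))"
      using xy ai by (intro P.inv_equality) (simp_all add: p2_closed P.m_comm[of _ "p2 G B a"])
    then have "inv\<^bsub>P\<^esub> x = p2 G B (inv a) \<otimes>\<^bsub>P\<^esub> mu2 G B (?t a (inv a) \<otimes>\<^bsub>T\<^esub> inv\<^bsub>T\<^esub> s)"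
      using xy ai by (simp add: p2_closed P.inv_mult P.m_assoc)
    then show "inv\<^bsub>P\<^esub> x \<in> ?J" using xy ai by blast
  qed
  have "p2 G B a \<in> ?J" if "a \<in> carrier G" for a
    using that by (intro CollectI exI[of _ a] exI[of _ "\<one>\<^bsub>T\<^esub>"]) (simp add: p2_closed)
  then have "z \<in> ?J"
    using gens_subgroup[OF gens_P2[OF is_group B.subset] J _ assms] by blast
  then show thesis using that by auto
qed

section \<open>An extension of \<open>G\<close> by the tensor square\<close>

text \<open>The map \<open>(a, b) \<mapsto> aM \<otimes> bM\<close>.\<close>
definition \<tau> :: "'a \<times> 'a \<Rightarrow> ('a set \<times> 'a set \<Rightarrow>\<^sub>0 int) set" where
  "\<tau> = (\<lambda>(a, b). tens A A (M #> a) (M #> b))"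

lemma \<tau>_bimult: "bimult G G T \<tau>"
  using bimult_compose[OF tens_bimult[OF group_A group_A] id_hom M.r_coset_hom_Mod[folded A_eq] M.r_coset_hom_Mod[folded A_eq]]
  by (simp add: \<tau>_def T_eq)

lemmas \<tau>_closed = bimultD(1)[OF \<tau>_bimult]
lemmas \<tau>_mult = bimultD(2,3)[OF \<tau>_bimult]

lemma \<tau>_M: "m \<in> M \<Longrightarrow> g \<in> carrier G \<Longrightarrow> \<tau> (m, g) = \<one>\<^bsub>T\<^esub>" "m \<in> M \<Longrightarrow> g \<in> carrier G \<Longrightarrow> \<tau> (g, m) = \<one>\<^bsub>T\<^esub>"
proof -
  have 1: "M #> m = \<one>\<^bsub>A\<^esub>" if "m \<in> M" for m
    using that by (simp add: A_eq M.rcos_const[OF is_group])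
  note b1 = bimult_one[OF tens_bimult[OF group_A group_A] group_A group_A T.is_group[unfolded T_eq], folded T_eq, simplified]
  show "m \<in> M \<Longrightarrow> g \<in> carrier G \<Longrightarrow> \<tau> (m, g) = \<one>\<^bsub>T\<^esub>" "m \<in> M \<Longrightarrow> g \<in> carrier G \<Longrightarrow> \<tau> (g, m) = \<one>\<^bsub>T\<^esub>"
    by (simp_all add: \<tau>_def 1 b1 M_coset_closed)
qed

text \<open>The central extension of \<open>G\<close> by \<open>T\<close> whose 2-cocycle is the inverse of \<open>\<tau>\<close>.  In it,
  \<open>(ab, 1) = (a, 1) (b, 1) (1, \<tau>(a, b))\<close>, which has the shape of the rule for \<open>p\<^sub>2(ab)\<close>.\<close>
definition tensor_ext :: "('a \<times> ('a set \<times> 'a set \<Rightarrow>\<^sub>0 int) set) monoid" where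
  "tensor_ext = \<lparr>carrier = carrier G \<times> carrier T,
     monoid.mult = (\<lambda>(a, s) (b, t). (a \<otimes> b, s \<otimes>\<^bsub>T\<^esub> t \<otimes>\<^bsub>T\<^esub> inv\<^bsub>T\<^esub> \<tau> (a, b))),
     one = (\<one>, \<one>\<^bsub>T\<^esub>)\<rparr>"

lemma tensor_ext_simps [simp]:
  "carrier tensor_ext = carrier G \<times> carrier T"
  "(a, s) \<otimes>\<^bsub>tensor_ext\<^esub> (b, t) = (a \<otimes> b, s \<otimes>\<^bsub>T\<^esub> t \<otimes>\<^bsub>T\<^esub> inv\<^bsub>T\<^esub> \<tau> (a, b))"
  "\<one>\<^bsub>tensor_ext\<^esub> = (\<one>, \<one>\<^bsub>T\<^esub>)"
  by (simp_all add: tensor_ext_def)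

lemma group_tensor_ext: "group tensor_ext"
proof (rule groupI)
  fix x y z assume "x \<in> carrier tensor_ext" "y \<in> carrier tensor_ext" "z \<in> carrier tensor_ext"
  then show "x \<otimes>\<^bsub>tensor_ext\<^esub> y \<otimes>\<^bsub>tensor_ext\<^esub> z = x \<otimes>\<^bsub>tensor_ext\<^esub> (y \<otimes>\<^bsub>tensor_ext\<^esub> z)"
    by (auto simp: m_assoc \<tau>_mult \<tau>_closed T.inv_mult T.m_ac)
next
  fix x assume "x \<in> carrier tensor_ext"
  then obtain a s where x: "x = (a, s)" "a \<in> carrier G" "s \<in> carrier T" by auto
  show "\<exists>y\<in>carrier tensor_ext. y \<otimes>\<^bsub>tensor_ext\<^esub> x = \<one>\<^bsub>tensor_ext\<^esub>"
    using x \<tau>_closed[of "inv a" a]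
    by (intro bexI[of _ "(inv a, inv\<^bsub>T\<^esub> s \<otimes>\<^bsub>T\<^esub> \<tau> (inv a, a))"]) (auto simp: T.m_ac)
qed (auto simp: \<tau>_closed \<tau>_M)

sublocale X: group tensor_ext by (rule group_tensor_ext)

text \<open>The commutator of \<open>(a, s)\<close> and \<open>(b, t)\<close> is \<open>([a, b], - l\<^sub>2(aM \<and> bM))\<close>, with \<open>T\<close> written
  additively.\<close>
lemma derived_tensor_ext:
  assumes "(g, s) \<in> derived_subgroup tensor_ext"
  obtains x where "x \<in> carrier W" "\<gamma> #> g = c2 G B x" "s = inv\<^bsub>T\<^esub> l2 G B x"
proof -
  interpret c: group_hom W C "c2 G B" by (rule group_homI[OF W.is_group C.is_group c2_hom])
  interpret l: group_hom W T "l2 G B" by (rule group_homI[OF W.is_group T.is_group l2_hom])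
  let ?N = "{(g, s). g \<in> M \<and> (\<exists>x\<in>carrier W. \<gamma> #> g = c2 G B x \<and> s = inv\<^bsub>T\<^esub> l2 G B x)}"
  have NI: "(g, inv\<^bsub>T\<^esub> l2 G B x) \<in> ?N" if "g \<in> M" "x \<in> carrier W" "\<gamma> #> g = c2 G B x" for g x
    using that by blast
  have N: "subgroup ?N tensor_ext"
  proof (rule X.subgroupI)
    show "?N \<subseteq> carrier tensor_ext" by (auto simp: M.mem_carrier)
    have "(\<one>, inv\<^bsub>T\<^esub> l2 G B \<one>\<^bsub>W\<^esub>) \<in> ?N"
      by (rule NI) (simp_all only: M.one_closed W.one_closed c.hom_one \<gamma>_coset_one[OF \<gamma>.one_closed])
    then show "?N \<noteq> {}" by blast
    fix p assume "p \<in> ?N"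
    then obtain g x where p: "p = (g, inv\<^bsub>T\<^esub> l2 G B x)" "g \<in> M" "x \<in> carrier W" "\<gamma> #> g = c2 G B x" by auto
    have gG: "g \<in> carrier G" using p by (simp add: M.mem_carrier)
    have "\<gamma> #> inv g = inv\<^bsub>C\<^esub> (\<gamma> #> g)"
      using mult_C[of "inv g" g] p gG \<gamma>_coset_one[OF \<gamma>.one_closed] carrier_C
      by (intro C.inv_equality[symmetric]) auto
    then have inv: "\<gamma> #> inv g = c2 G B (inv\<^bsub>W\<^esub> x)" using p by simp
    have "inv\<^bsub>tensor_ext\<^esub> p = (inv g, inv\<^bsub>T\<^esub> l2 G B (inv\<^bsub>W\<^esub> x))"
      using p gG by (intro X.inv_equality) (auto simp: \<tau>_M)
    then show "inv\<^bsub>tensor_ext\<^esub> p \<in> ?N" using p inv NI[of "inv g" "inv\<^bsub>W\<^esub> x"] by simp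
    fix q assume "q \<in> ?N"
    then obtain h y where q: "q = (h, inv\<^bsub>T\<^esub> l2 G B y)" "h \<in> M" "y \<in> carrier W" "\<gamma> #> h = c2 G B y" by auto
    have "\<gamma> #> (g \<otimes> h) = c2 G B (x \<otimes>\<^bsub>W\<^esub> y)"
      using p q by (simp add: M.mem_carrier flip: mult_C)
    moreover have "p \<otimes>\<^bsub>tensor_ext\<^esub> q = (g \<otimes> h, inv\<^bsub>T\<^esub> l2 G B (x \<otimes>\<^bsub>W\<^esub> y))"
      using p q by (simp add: \<tau>_M M.mem_carrier T.inv_mult)
    ultimately show "p \<otimes>\<^bsub>tensor_ext\<^esub> q \<in> ?N" using p q NI[of "g \<otimes> h" "x \<otimes>\<^bsub>W\<^esub> y"] by simp
  qed
  have "derived_subgroup tensor_ext \<subseteq> ?N"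
    unfolding derived_def
  proof (rule X.generate_subgroup_incl[OF _ N], rule subsetI)
    fix z assume "z \<in> derived_set tensor_ext (carrier tensor_ext)"
    then obtain a s b t where "(a, s) \<in> carrier tensor_ext" "(b, t) \<in> carrier tensor_ext"
      and z: "z = (a, s) \<otimes>\<^bsub>tensor_ext\<^esub> (b, t) \<otimes>\<^bsub>tensor_ext\<^esub> inv\<^bsub>tensor_ext\<^esub> (a, s) \<otimes>\<^bsub>tensor_ext\<^esub> inv\<^bsub>tensor_ext\<^esub> (b, t)"
      by (elim UN_E singletonE) (metis prod.collapse)
    then have ab: "a \<in> carrier G" "b \<in> carrier G" "s \<in> carrier T" "t \<in> carrier T" by auto
    let ?k = "(commutator G a b, inv\<^bsub>T\<^esub> (\<tau> (a, b) \<otimes>\<^bsub>T\<^esub> inv\<^bsub>T\<^esub> \<tau> (b, a)))"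
    have kc: "?k \<in> carrier tensor_ext" using ab by (simp add: \<tau>_closed)
    have "commutator G a b \<otimes> (b \<otimes> a) = a \<otimes> b" using ab by (simp add: commutator_def group_simps)
    moreover have "inv\<^bsub>T\<^esub> (\<tau> (a, b) \<otimes>\<^bsub>T\<^esub> inv\<^bsub>T\<^esub> \<tau> (b, a)) \<otimes>\<^bsub>T\<^esub> (t \<otimes>\<^bsub>T\<^esub> s \<otimes>\<^bsub>T\<^esub> inv\<^bsub>T\<^esub> \<tau> (b, a))
      = s \<otimes>\<^bsub>T\<^esub> t \<otimes>\<^bsub>T\<^esub> inv\<^bsub>T\<^esub> \<tau> (a, b)"
      using ab \<tau>_closed[of b a] \<tau>_closed[of a b]
        T.mult_inv_cancel_left[of "\<tau> (b, a)" "inv\<^bsub>T\<^esub> \<tau> (a, b) \<otimes>\<^bsub>T\<^esub> (s \<otimes>\<^bsub>T\<^esub> t)"]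
      by (simp add: T.inv_mult T.m_ac)
    ultimately have "?k \<otimes>\<^bsub>tensor_ext\<^esub> ((b, t) \<otimes>\<^bsub>tensor_ext\<^esub> (a, s)) = (a, s) \<otimes>\<^bsub>tensor_ext\<^esub> (b, t)"
      using ab by (simp add: \<tau>_M(1)[OF commutator_in_M] \<tau>_closed)
    then have "(a, s) \<otimes>\<^bsub>tensor_ext\<^esub> (b, t) \<otimes>\<^bsub>tensor_ext\<^esub> inv\<^bsub>tensor_ext\<^esub> (a, s) \<otimes>\<^bsub>tensor_ext\<^esub> inv\<^bsub>tensor_ext\<^esub> (b, t)
       = ?k \<otimes>\<^bsub>tensor_ext\<^esub> ((b, t) \<otimes>\<^bsub>tensor_ext\<^esub> (a, s)) \<otimes>\<^bsub>tensor_ext\<^esub> inv\<^bsub>tensor_ext\<^esub> (a, s) \<otimes>\<^bsub>tensor_ext\<^esub> inv\<^bsub>tensor_ext\<^esub> (b, t)"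
      by simp
    also have "\<dots> = ?k"
      using ab kc X.m_closed X.inv_closed
      by (simp only: X.m_assoc X.mult_inv_cancel_left X.r_inv X.r_one tensor_ext_simps(1) mem_Sigma_iff X.m_closed
          X.inv_closed \<open>(a, s) \<in> carrier tensor_ext\<close> \<open>(b, t) \<in> carrier tensor_ext\<close>)
    finally have eq: "(a, s) \<otimes>\<^bsub>tensor_ext\<^esub> (b, t) \<otimes>\<^bsub>tensor_ext\<^esub> inv\<^bsub>tensor_ext\<^esub> (a, s) \<otimes>\<^bsub>tensor_ext\<^esub> inv\<^bsub>tensor_ext\<^esub> (b, t) = ?k" .
    let ?w = "wedge A (M #> a) (M #> b)"
    have w: "?w \<in> carrier W"
      using bimultD(1)[OF wedge_bimult[OF group_A]] ab by (simp add: W_eq M_coset_closed)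
    have "?k \<in> ?N"
      using NI[OF commutator_in_M[OF ab(1,2)] w c2_wedge[OF ab(1,2), symmetric]]
        l2_wedge[OF M_coset_closed M_coset_closed, OF ab(1,2)]
      by (simp only: \<tau>_def prod.case)
    then show "z \<in> ?N" unfolding z eq .
  qed
  with assms that show thesis by auto
qed

text \<open>The kernel of \<open>(p\<^sub>2i, \<mu>\<^sub>2)\<close> is contained in the image of \<open>(c\<^sub>2, -l\<^sub>2)\<^sup>t\<close>: the homomorphism from
  \<open>P\<^sub>2(G,B)\<close> to the abelianization of \<open>tensor_ext\<close> maps \<open>p\<^sub>2(u) + \<mu>\<^sub>2(t)\<close> to the class of \<open>(u, t)\<close>, so
  that \<open>(u, t)\<close> is a product of commutators.\<close>
lemma relation_from_P2:
  assumes "u \<in> M" "t \<in> carrier T" "p2 G B u \<otimes>\<^bsub>P\<^esub> mu2 G B t = \<one>\<^bsub>P\<^esub>"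
  obtains x where "x \<in> carrier W" "\<gamma> #> u = c2 G B x" "t = inv\<^bsub>T\<^esub> l2 G B x"
proof -
  let ?D = "derived_subgroup tensor_ext"
  let ?E = "tensor_ext Mod ?D"
  interpret XD: normal ?D tensor_ext by (rule X.derived_self_is_normal)
  interpret E: comm_group ?E by (rule X.derived_quot_is_comm_group)
  define q where "q a = ?D #>\<^bsub>tensor_ext\<^esub> (a, \<one>\<^bsub>T\<^esub>)" for a
  define j where "j s = ?D #>\<^bsub>tensor_ext\<^esub> (\<one>, s)" for s
  note c = XD.r_coset_hom_Mod
  have cc: "?D #>\<^bsub>tensor_ext\<^esub> (x \<otimes>\<^bsub>tensor_ext\<^esub> y) = (?D #>\<^bsub>tensor_ext\<^esub> x) \<otimes>\<^bsub>?E\<^esub> (?D #>\<^bsub>tensor_ext\<^esub> y)"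
    if "x \<in> carrier tensor_ext" "y \<in> carrier tensor_ext" for x y
    using hom_mult[OF c that] .
  have j: "j \<in> hom T ?E"
  proof (rule homI)
    show "j s \<in> carrier ?E" if "s \<in> carrier T" for s
      using that hom_in_carrier[OF c, of "(\<one>, s)"] by (simp add: j_def)
    show "j (s \<otimes>\<^bsub>T\<^esub> s') = j s \<otimes>\<^bsub>?E\<^esub> j s'" if "s \<in> carrier T" "s' \<in> carrier T" for s s'
      using that cc[of "(\<one>, s)" "(\<one>, s')"] by (simp add: j_def \<tau>_M)
  qed
  have qj: "q a \<otimes>\<^bsub>?E\<^esub> j s = ?D #>\<^bsub>tensor_ext\<^esub> (a, s)" if "a \<in> carrier G" "s \<in> carrier T" for a s
    using that cc[of "(a, \<one>\<^bsub>T\<^esub>)" "(\<one>, s)"] by (simp add: q_def j_def \<tau>_M)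
  have qc: "q \<in> carrier G \<rightarrow> carrier ?E"
    using hom_in_carrier[OF c] by (auto simp: q_def)
  have bj: "bimult G G ?E (\<lambda>p. j (\<tau> p))"
    using bimult_compose[OF \<tau>_bimult j id_hom id_hom] by (simp add: case_prod_unfold)
  have q: "q (a \<otimes> b) = q a \<otimes>\<^bsub>?E\<^esub> q b \<otimes>\<^bsub>?E\<^esub> j (\<tau> (a, b))" if "a \<in> carrier G" "b \<in> carrier G" for a b
  proof -
    have "q a \<otimes>\<^bsub>?E\<^esub> q b = ?D #>\<^bsub>tensor_ext\<^esub> (a \<otimes> b, inv\<^bsub>T\<^esub> \<tau> (a, b))"
      using that cc[of "(a, \<one>\<^bsub>T\<^esub>)" "(b, \<one>\<^bsub>T\<^esub>)"] by (simp add: q_def \<tau>_closed)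
    then show ?thesis
      using that cc[of "(a \<otimes> b, inv\<^bsub>T\<^esub> \<tau> (a, b))" "(\<one>, \<tau> (a, b))"]
      by (simp add: q_def j_def \<tau>_closed \<tau>_M)
  qed
  have jB: "j (\<tau> (b, g)) = \<one>\<^bsub>?E\<^esub>" if "b \<in> B" "g \<in> carrier G" for b g
    using that \<tau>_M(1)[of b g] B_subset_M hom_one[OF j T.is_group E.is_group] by auto
  note U = P2_universal_free_lift[OF is_group subgroup_B E.comm_group_axioms qc bj q jB]
  let ?f = "coset_map (free_lift ?E q)"
  have f: "?f \<in> hom P ?E" by (rule U(1))
  interpret f: group_hom P ?E ?f by (rule group_homI[OF P.is_group E.is_group f])
  interpret mu: group_hom T P "mu2 G B" by (rule group_homI[OF T.is_group P.is_group mu2_hom])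
  have fmu: "?f (mu2 G B s) = j s" if "s \<in> carrier T" for s
  proof -
    have "(\<lambda>s. ?f (mu2 G B s)) \<in> hom T ?E"
      using Group.hom_compose[OF mu2_hom f] by (simp add: o_def)
    then show ?thesis
    proof (rule hom_eq_T[OF E.is_group _ j that])
      fix a b assume "a \<in> carrier G" "b \<in> carrier G"
      then show "?f (mu2 G B (tens A A (M #> a) (M #> b))) = j (tens A A (M #> a) (M #> b))"
        using U(3)[of a b] by (simp add: mu2_tens \<tau>_def)
    qed
  qed
  have uG: "u \<in> carrier G" using assms(1) by (rule M.mem_carrier)
  have "\<one>\<^bsub>?E\<^esub> = ?f (p2 G B u \<otimes>\<^bsub>P\<^esub> mu2 G B t)" by (simp only: assms(3) f.hom_one)
  also have "\<dots> = q u \<otimes>\<^bsub>?E\<^esub> j t"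
    using assms(2) uG by (simp only: f.hom_mult p2_closed mu.hom_closed U(2) fmu)
  also have "\<dots> = ?D #>\<^bsub>tensor_ext\<^esub> (u, t)" using uG assms(2) by (rule qj)
  finally have "(u, t) \<in> ?D"
    using X.r_coset_eq_self_iff[OF XD.subgroup_axioms, of "(u, t)"] uG assms(2) by simp
  from derived_tensor_ext[OF this that] show thesis .
qed

end

section \<open>Exactness\<close>

lemma comm_group_subgroup:
  assumes "comm_group K" "subgroup S K"
  shows "comm_group (K\<lparr>carrier := S\<rparr>)"
proof -
  interpret K: comm_group K by fact
  show ?thesis
    using K.subgroup_imp_group[OF assms(2)] subgroup.mem_carrier[OF assms(2)]
    by (intro group.group_comm_groupI) (auto intro: K.m_comm)
qed

lemma hom_subset: "h \<in> hom K L \<Longrightarrow> S \<subseteq> carrier K \<Longrightarrow> h \<in> hom (K\<lparr>carrier := S\<rparr>) L"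
  by (simp add: hom_def Pi_iff subset_iff)

lemma epi_on_gens:
  assumes "group K" "group L" "h \<in> hom K L" "gens L Y" "\<And>y. y \<in> Y \<Longrightarrow> \<exists>x\<in>carrier K. h x = y"
  shows "h \<in> epi K L"
proof -
  interpret h: group_hom K L h by (rule group_homI[OF assms(1-3)])
  have "Y \<subseteq> h ` carrier K" using assms(5) by force
  then have "carrier L \<subseteq> h ` carrier K"
    using gens_subgroup[OF assms(4) h.img_is_subgroup] by blast
  then show ?thesis using assms(3) by (auto simp: epi_def)
qed

lemma add_subgroup_vimage_frag_extend:
  "add_subgroup J \<Longrightarrow> add_subgroup {x. frag_extend f x \<in> J}"
  by (simp add: add_subgroup_def frag_extend_diff)

lemma P2_map:
  assumes "group G" "subgroup B G" "group H" "subgroup C H" "f \<in> hom G H" "f ` B \<subseteq> C"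
  shows "P2_map H C f \<in> hom (P2 G B) (P2 H C)"
    and "a \<in> carrier G \<Longrightarrow> P2_map H C f (p2 G B a) = p2 H C (f a)"
    and "a \<in> carrier G \<Longrightarrow> b \<in> carrier G \<Longrightarrow>
      P2_map H C f (p2_prod G B (a, b)) = p2_prod H C (f a, f b)"
proof -
  interpret G: group G by fact
  interpret H: group H by fact
  interpret C: subgroup C H by fact
  interpret f: group_hom G H f by (rule group_homI[OF assms(1,3,5)])
  define e where "e = frag_extend (\<lambda>a. frag_of (f a))"
  have gen: "e (aug_gen G a) = aug_gen H (f a)" for a
    by (simp add: e_def frag_extend_diff f.hom_one)
  have "aug_ideal G \<subseteq> {x. e x \<in> aug_ideal H}"
    unfolding e_def
    by (rule aug_ideal_subset[OF add_subgroup_vimage_frag_extend[OF add_subgroup_aug_ideal]])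
      (use aug_gen_in[of H] gen in \<open>auto simp: e_def\<close>)
  then have "e \<in> hom (aug_group G) (aug_group H)"
    by (auto simp: hom_def e_def frag_extend_add)
  from hom_compose[OF this P2_class_hom[OF assms(3) C.subset]]
  have h: "(\<lambda>x. P2_ker H C +>\<^bsub>group_ring H\<^esub> frag_extend (\<lambda>a. frag_of (f a)) x) \<in> hom (aug_group G) (P2 H C)"
    by (simp add: o_def e_def a_r_coset_group_ring)
  have v: "P2_ker H C +>\<^bsub>group_ring H\<^esub> frag_extend (\<lambda>a. frag_of (f a)) (aug_gen G a) = p2 H C (f a)" for a
    using gen[of a] by (simp add: p2_def e_def)
  note p = p2_props[OF assms(3,4)]
  have b: "bimult G G (P2 H C) (\<lambda>(a, b). p2_prod H C (f a, f b))"
    using bimult_compose[OF p(2) id_hom assms(5) assms(5)] by simp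
  have q: "p2 H C (f (a \<otimes>\<^bsub>G\<^esub> b)) = p2 H C (f a) \<otimes>\<^bsub>P2 H C\<^esub> p2 H C (f b) \<otimes>\<^bsub>P2 H C\<^esub> (\<lambda>(a, b). p2_prod H C (f a, f b)) (a, b)"
    if "a \<in> carrier G" "b \<in> carrier G" for a b
    using that p(3)[of "f a" "f b"] by simp
  have B: "(\<lambda>(a, b). p2_prod H C (f a, f b)) (b, g) = \<one>\<^bsub>P2 H C\<^esub>" if "b \<in> B" "g \<in> carrier G" for b g
    using that p(4)[of "f b" "f g"] assms(6) by auto
  note U = P2_universal[OF assms(1,2) comm_group_P2[OF assms(3) C.subset] h v b q B]
  show "P2_map H C f \<in> hom (P2 G B) (P2 H C)" unfolding P2_map_def by (rule U(1))
  show "P2_map H C f (p2 G B a) = p2 H C (f a)" if "a \<in> carrier G"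
    unfolding P2_map_def using that by (simp add: U(2))
  show "P2_map H C f (p2_prod G B (a, b)) = p2_prod H C (f a, f b)" if "a \<in> carrier G" "b \<in> carrier G"
    unfolding P2_map_def using that by (simp add: U(3))
qed

context central_pair
begin

sublocale mu: group_hom T P "mu2 G B" by (rule group_homI[OF T.is_group P.is_group mu2_hom])
sublocale pb: group_hom C P "p2_bar G B" by (rule group_homI[OF C.is_group P.is_group p2_bar_hom])
sublocale c: group_hom W C "c2 G B" by (rule group_homI[OF W.is_group C.is_group c2_hom])
sublocale l: group_hom W T "l2 G B" by (rule group_homI[OF W.is_group T.is_group l2_hom])

lemma tens_closed: "a \<in> carrier G \<Longrightarrow> b \<in> carrier G \<Longrightarrow> tens A A (M #> a) (M #> b) \<in> carrier T"
  using \<tau>_closed[of a b] by (simp add: \<tau>_def)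

lemma P2_relation:
  assumes "x \<in> carrier W"
  shows "p2_bar G B (c2 G B x) = mu2 G B (l2 G B x)"
proof (rule hom_eq_W[OF P.is_group _ _ assms, of "\<lambda>x. p2_bar G B (c2 G B x)" "\<lambda>x. mu2 G B (l2 G B x)"])
  show "(\<lambda>x. p2_bar G B (c2 G B x)) \<in> hom W P"
    using Group.hom_compose[OF c2_hom p2_bar_hom] by (simp add: o_def)
  show "(\<lambda>x. mu2 G B (l2 G B x)) \<in> hom W P"
    using Group.hom_compose[OF l2_hom mu2_hom] by (simp add: o_def)
  fix a b assume "a \<in> carrier G" "b \<in> carrier G"
  then show "p2_bar G B (c2 G B (wedge A (M #> a) (M #> b))) = mu2 G B (l2 G B (wedge A (M #> a) (M #> b)))"
    by (simp add: c2_wedge l2_wedge M_coset_closed p2_bar_coset commutator_in_M p2_commutator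
        mu2_tens tens_closed)
qed

lemma relation_at_one:
  assumes "t \<in> carrier T" "mu2 G B t = \<one>\<^bsub>P\<^esub>"
  obtains x where "x \<in> carrier W" "c2 G B x = \<one>\<^bsub>C\<^esub>" "t = l2 G B x"
proof -
  from assms have "p2 G B \<one> \<otimes>\<^bsub>P\<^esub> mu2 G B t = \<one>\<^bsub>P\<^esub>" by (simp add: p2_one)
  from relation_from_P2[OF M.one_closed assms(1) this]
  obtain x where x: "x \<in> carrier W" "\<gamma> #> \<one> = c2 G B x" "t = inv\<^bsub>T\<^esub> l2 G B x" .
  have "c2 G B (inv\<^bsub>W\<^esub> x) = \<one>\<^bsub>C\<^esub>"
    using x(1) x(2)[symmetric] \<gamma>_coset_one[OF \<gamma>.one_closed] by simp
  with x show thesis by (intro that[of "inv\<^bsub>W\<^esub> x"]) simp_all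
qed

lemma p2_D:
  assumes "d \<in> D" shows "p2 G B d \<in> mu2 G B ` carrier T"
proof -
  interpret p: group_hom "G\<lparr>carrier := M\<rparr>" P "p2 G B"
    by (rule group_homI[OF M.subgroup_is_group[OF is_group] P.is_group p2_hom_M])
  let ?J = "{x \<in> M. p2 G B x \<in> mu2 G B ` carrier T}"
  interpret I: subgroup "mu2 G B ` carrier T" P by (rule mu.img_is_subgroup)
  have "subgroup ?J (G\<lparr>carrier := M\<rparr>)"
    using p.G.inv_closed p.hom_inv by (intro subgroup.intro) (auto simp: p2_mult_M p2_one simp del: m_inv_consistent)
  then have J: "subgroup ?J G" by (rule incl_subgroup[OF M.subgroup_axioms])
  have "D \<subseteq> ?J"
    unfolding derived_def
  proof (rule generate_subgroup_incl[OF _ J], rule subsetI)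
    fix z assume "z \<in> derived_set G (carrier G)"
    then obtain a b where ab: "a \<in> carrier G" "b \<in> carrier G" "z = commutator G a b"
      by (auto simp: commutator_def)
    have "p2 G B z = mu2 G B (tens A A (M #> a) (M #> b)) \<otimes>\<^bsub>P\<^esub> inv\<^bsub>P\<^esub> mu2 G B (tens A A (M #> b) (M #> a))"
      using ab by (simp add: p2_commutator mu2_tens)
    then have "p2 G B z \<in> mu2 G B ` carrier T"
      using ab tens_closed by (metis I.m_closed I.m_inv_closed image_eqI)
    then show "z \<in> ?J" using ab commutator_in_M by simp
  qed
  with assms show ?thesis by auto
qed

text \<open>The projections of \<open>P\<^sub>2(G,B)\<close> onto abelian quotients of \<open>G\<close>, which include both \<open>\<rho>\<^sub>1\<close> and
  \<open>\<rho>\<^sub>2\<close>.\<close>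
lemma P2_projection:
  assumes "N \<lhd> G" "D \<subseteq> N"
  defines "\<rho> \<equiv> coset_map (free_lift (G Mod N) (\<lambda>a. N #> a))"
  shows "\<rho> \<in> epi P (G Mod N)"
    and "a \<in> carrier G \<Longrightarrow> \<rho> (p2 G B a) = N #> a"
    and "t \<in> carrier T \<Longrightarrow> \<rho> (mu2 G B t) = \<one>\<^bsub>G Mod N\<^esub>"
    and "z \<in> carrier P \<Longrightarrow> \<rho> z = \<one>\<^bsub>G Mod N\<^esub> \<Longrightarrow>
      \<exists>a\<in>N. \<exists>t\<in>carrier T. z = p2 G B a \<otimes>\<^bsub>P\<^esub> mu2 G B t"
proof -
  interpret N: normal N G by fact
  interpret Q: comm_group "G Mod N" by (rule comm_group_FactGroup_derived[OF assms(1,2)])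
  have q: "(\<lambda>a. N #> a) \<in> carrier G \<rightarrow> carrier (G Mod N)" by (auto simp: carrier_FactGroup)
  have b: "bimult G G (G Mod N) (\<lambda>_. \<one>\<^bsub>G Mod N\<^esub>)" unfolding bimult_def using Q.one_closed Q.l_one by metis
  have qm: "N #> (a \<otimes> b) = (N #> a) \<otimes>\<^bsub>G Mod N\<^esub> (N #> b) \<otimes>\<^bsub>G Mod N\<^esub> \<one>\<^bsub>G Mod N\<^esub>"
    if "a \<in> carrier G" "b \<in> carrier G" for a b
    using hom_mult[OF N.r_coset_hom_Mod that] q that Q.r_one[of "(N #> a) \<otimes>\<^bsub>G Mod N\<^esub> (N #> b)"] by fastforce
  note U = P2_universal_free_lift[OF is_group subgroup_B Q.comm_group_axioms q b qm refl]
  have hom: "\<rho> \<in> hom P (G Mod N)" unfolding \<rho>_def by (rule U(1))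
  show val: "\<rho> (p2 G B a) = N #> a" if "a \<in> carrier G" for a unfolding \<rho>_def using that by (simp add: U(2))
  show "\<rho> \<in> epi P (G Mod N)"
    using hom val p2_closed by (fastforce simp: epi_def carrier_FactGroup dest: hom_in_carrier)
  show mu: "\<rho> (mu2 G B t) = \<one>\<^bsub>G Mod N\<^esub>" if "t \<in> carrier T" for t
  proof (rule hom_eq_T[OF Q.is_group _ _ that, of "\<lambda>t. \<rho> (mu2 G B t)" "\<lambda>_. \<one>\<^bsub>G Mod N\<^esub>"])
    show "(\<lambda>t. \<rho> (mu2 G B t)) \<in> hom T (G Mod N)"
      using Group.hom_compose[OF mu2_hom hom] by (simp add: o_def)
    show "(\<lambda>_. \<one>\<^bsub>G Mod N\<^esub>) \<in> hom T (G Mod N)" by (rule homI) (use Q.one_closed Q.l_one in auto)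
    fix a b assume "a \<in> carrier G" "b \<in> carrier G"
    then show "\<rho> (mu2 G B (tens A A (M #> a) (M #> b))) = \<one>\<^bsub>G Mod N\<^esub>"
      unfolding \<rho>_def using U(3)[of a b] by (simp add: mu2_tens)
  qed
  show "\<exists>a\<in>N. \<exists>t\<in>carrier T. z = p2 G B a \<otimes>\<^bsub>P\<^esub> mu2 G B t"
    if z: "z \<in> carrier P" and 1: "\<rho> z = \<one>\<^bsub>G Mod N\<^esub>"
  proof -
    obtain a t where at: "a \<in> carrier G" "t \<in> carrier T" "z = p2 G B a \<otimes>\<^bsub>P\<^esub> mu2 G B t"
      by (rule p2_decomp[OF z])
    have "\<rho> z = N #> a"
      using at val[of a] mu[of t] hom_mult[OF hom p2_closed[OF at(1)] mu.hom_closed[OF at(2)]]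
        Q.r_one[of "N #> a"] q by auto
    then have "a \<in> N" using 1 r_coset_eq_self_iff[OF N.subgroup_axioms at(1)] by simp
    with at show ?thesis by blast
  qed
qed

lemmas rho1_props = P2_projection[OF D.normal_axioms subset_refl, folded rho1_def[of G B]]
lemmas rho2_props = P2_projection[OF M.normal_axioms D_subset_M, folded A_eq, folded rho2_def[of G B]]

lemma comm_group_Ker_c2: "comm_group (Ker_c2 G B)"
  unfolding Ker_c2_def by (rule comm_group_subgroup[OF comm_group_W c.subgroup_kernel])

lemma carrier_Ker_c2: "carrier (Ker_c2 G B) = {x \<in> carrier W. c2 G B x = \<one>\<^bsub>C\<^esub>}"
  by (simp add: Ker_c2_def kernel_def)

lemma exact_sequence1:
  "exact4 (Ker_c2 G B) T P (abelianization G) (l2 G B) (mu2 G B) (rho1 G B)"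
proof -
  have lh: "l2 G B \<in> hom (Ker_c2 G B) T"
    using l2_hom by (auto simp: hom_def Ker_c2_def kernel_def)
  have mon: "l2 G B \<in> mon (Ker_c2 G B) T"
    using lh inj_on_subset[OF l2_inj] by (auto simp: mon_def carrier_Ker_c2)
  have ex1: "l2 G B ` carrier (Ker_c2 G B) = kernel T P (mu2 G B)"
  proof (intro equalityI subsetI)
    fix t assume "t \<in> l2 G B ` carrier (Ker_c2 G B)"
    then obtain x where x: "x \<in> carrier W" "c2 G B x = \<one>\<^bsub>C\<^esub>" "t = l2 G B x" by (auto simp: carrier_Ker_c2)
    then show "t \<in> kernel T P (mu2 G B)"
      using P2_relation[OF x(1)] by (simp add: kernel_def)
  next
    fix t assume "t \<in> kernel T P (mu2 G B)"
    then have t: "t \<in> carrier T" "mu2 G B t = \<one>\<^bsub>P\<^esub>" by (auto simp: kernel_def)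
    obtain x where "x \<in> carrier W" "c2 G B x = \<one>\<^bsub>C\<^esub>" "t = l2 G B x"
      by (rule relation_at_one[OF t])
    then show "t \<in> l2 G B ` carrier (Ker_c2 G B)" by (auto simp: carrier_Ker_c2)
  qed
  have ex2: "mu2 G B ` carrier T = kernel P (abelianization G) (rho1 G B)"
  proof (intro equalityI subsetI)
    fix z assume "z \<in> kernel P (abelianization G) (rho1 G B)"
    then have "z \<in> carrier P" "rho1 G B z = \<one>\<^bsub>abelianization G\<^esub>" by (auto simp: kernel_def)
    from rho1_props(4)[OF this] obtain d t where "d \<in> D" "t \<in> carrier T" "z = p2 G B d \<otimes>\<^bsub>P\<^esub> mu2 G B t" by blast
    then show "z \<in> mu2 G B ` carrier T"
      using subgroup.m_closed[OF mu.img_is_subgroup p2_D] by auto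
  qed (auto simp: kernel_def rho1_props(3))
  have "rho1 G B \<in> hom P (abelianization G)" using rho1_props(1) by (simp add: epi_def)
  with ex1 ex2 lh mon show ?thesis
    unfolding exact4_def exact_at_def
    using comm_group_Ker_c2 comm_group_T comm_group_P derived_quot_is_comm_group mu2_hom rho1_props(1) by blast
qed

lemma comm_group_DirProd: "comm_group H \<Longrightarrow> comm_group K \<Longrightarrow> comm_group (H \<times>\<times> K)"
  by (rule group.group_comm_groupI) (auto simp: comm_group_def comm_monoid.m_comm DirProd_group)

lemma c2_l2_hom: "c2_l2 G B \<in> hom W (C \<times>\<times> T)"
proof -
  have "(\<lambda>x. inv\<^bsub>T\<^esub> l2 G B x) \<in> hom W T"
    by (rule homI) (simp_all add: T.inv_mult)
  then have "(\<lambda>x. (c2 G B x, inv\<^bsub>T\<^esub> l2 G B x)) \<in> hom W (C \<times>\<times> T)"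
    using c2_hom by (simp add: hom_paired)
  then show ?thesis by (simp add: c2_l2_def[abs_def])
qed

lemma p2i_mu2_hom: "p2i_mu2 G B \<in> hom (C \<times>\<times> T) P"
  by (rule homI) (auto simp: p2i_mu2_def P.m_ac)

lemma exact_sequence2:
  "exact4 W (C \<times>\<times> T) P A (c2_l2 G B) (p2i_mu2 G B) (rho2 G B)"
proof -
  have "inj_on (c2_l2 G B) (carrier W)"
  proof (rule inj_onI)
    fix x y assume xy: "x \<in> carrier W" "y \<in> carrier W" "c2_l2 G B x = c2_l2 G B y"
    then have "inv\<^bsub>T\<^esub> l2 G B x = inv\<^bsub>T\<^esub> l2 G B y" by (simp add: c2_l2_def)
    then have "l2 G B x = l2 G B y" using xy by (metis T.inv_inv l.hom_closed)
    then show "x = y" using xy l2_inj by (auto dest: inj_onD)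
  qed
  then have mon: "c2_l2 G B \<in> mon W (C \<times>\<times> T)" using c2_l2_hom by (simp add: mon_def)
  have ex1: "c2_l2 G B ` carrier W = kernel (C \<times>\<times> T) P (p2i_mu2 G B)"
  proof (intro equalityI subsetI)
    fix z assume "z \<in> c2_l2 G B ` carrier W"
    then obtain x where "x \<in> carrier W" "z = c2_l2 G B x" by auto
    then show "z \<in> kernel (C \<times>\<times> T) P (p2i_mu2 G B)"
      by (simp add: kernel_def c2_l2_def p2i_mu2_def P2_relation)
  next
    fix z assume "z \<in> kernel (C \<times>\<times> T) P (p2i_mu2 G B)"
    then obtain u t where z: "u \<in> M" "t \<in> carrier T" "z = (\<gamma> #> u, t)" "p2i_mu2 G B z = \<one>\<^bsub>P\<^esub>"
      by (auto simp: kernel_def carrier_C)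
    then have "p2 G B u \<otimes>\<^bsub>P\<^esub> mu2 G B t = \<one>\<^bsub>P\<^esub>" by (simp add: p2i_mu2_def p2_bar_coset)
    from relation_from_P2[OF z(1,2) this] obtain x where
      "x \<in> carrier W" "\<gamma> #> u = c2 G B x" "t = inv\<^bsub>T\<^esub> l2 G B x" .
    then show "z \<in> c2_l2 G B ` carrier W" unfolding z(3) by (auto simp: c2_l2_def)
  qed
  have ex2: "p2i_mu2 G B ` carrier (C \<times>\<times> T) = kernel P A (rho2 G B)"
  proof (intro equalityI subsetI)
    fix z assume "z \<in> p2i_mu2 G B ` carrier (C \<times>\<times> T)"
    then obtain u t where z: "u \<in> M" "t \<in> carrier T" "z = p2 G B u \<otimes>\<^bsub>P\<^esub> mu2 G B t"
      by (auto simp: carrier_C p2i_mu2_def p2_bar_coset)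
    have u: "u \<in> carrier G" using z(1) by (rule M.mem_carrier)
    have "rho2 G B \<in> hom P A" using rho2_props(1) by (simp add: epi_def)
    then have "rho2 G B z = (M #> u) \<otimes>\<^bsub>A\<^esub> \<one>\<^bsub>A\<^esub>"
      using z u by (simp add: hom_mult p2_closed rho2_props(2,3))
    also have "M #> u = \<one>\<^bsub>A\<^esub>" using z(1) by (simp add: A_eq M.rcos_const[OF is_group])
    finally show "z \<in> kernel P A (rho2 G B)"
      using z u monoid.l_one[OF group.is_monoid[OF group_A] monoid.one_closed[OF group.is_monoid[OF group_A]]]
      by (simp add: kernel_def p2_closed)
  next
    fix z assume "z \<in> kernel P A (rho2 G B)"
    then have "z \<in> carrier P" "rho2 G B z = \<one>\<^bsub>A\<^esub>" by (auto simp: kernel_def)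
    from rho2_props(4)[OF this] obtain u t where z: "u \<in> M" "t \<in> carrier T" "z = p2 G B u \<otimes>\<^bsub>P\<^esub> mu2 G B t" by blast
    then have "z = p2i_mu2 G B (\<gamma> #> u, t)" by (simp add: p2i_mu2_def p2_bar_coset)
    then show "z \<in> p2i_mu2 G B ` carrier (C \<times>\<times> T)" using z by (auto simp: carrier_C)
  qed
  have "rho2 G B \<in> hom P A" using rho2_props(1) by (simp add: epi_def)
  with ex1 ex2 mon show ?thesis
    unfolding exact4_def exact_at_def
    using comm_group_W comm_group_DirProd[OF comm_group_C comm_group_T] comm_group_P comm_group_A
      c2_l2_hom p2i_mu2_hom rho2_props(1) by blast
qed

text \<open>The group \<open>B\<gamma>\<^sub>3(G)/\<gamma>\<^sub>3(G)\<close>, which is a subgroup of \<open>C\<close>.\<close>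
abbreviation "B\<gamma> \<equiv> Bgamma3_mod_gamma3 G B"

lemma carrier_B\<gamma>: "carrier B\<gamma> = (\<lambda>x. \<gamma> #> x) ` B"
proof -
  have "\<gamma> #> (b \<otimes> c) = \<gamma> #> b" if "b \<in> B" "c \<in> \<gamma>" for b c
  proof -
    have "b \<otimes> c = c \<otimes> b" by (rule B_comm[OF that(1) \<gamma>.mem_carrier[OF that(2)]])
    then have "\<gamma> #> (b \<otimes> c) = \<gamma> #> c #> b"
      using that by (simp add: \<gamma>.mem_carrier B.mem_carrier coset_mult_assoc \<gamma>.subset)
    then show ?thesis using that by (simp add: \<gamma>.rcos_const[OF is_group])
  qed
  then have 1: "(\<lambda>x. \<gamma> #> x) ` (B <#> \<gamma>) \<subseteq> (\<lambda>x. \<gamma> #> x) ` B"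
    by (force simp: set_mult_def)
  have "B \<subseteq> B <#> \<gamma>"
  proof
    fix b assume "b \<in> B"
    then have "b \<otimes> \<one> \<in> B <#> \<gamma>"
      unfolding set_mult_def by (intro UN_I[of b] UN_I[of \<one>] singletonI \<gamma>.one_closed)
    then show "b \<in> B <#> \<gamma>" using \<open>b \<in> B\<close> by (simp add: B.mem_carrier)
  qed
  from equalityI[OF 1 image_mono[OF this]]
  have "(\<lambda>x. \<gamma> #> x) ` (B <#> \<gamma>) = (\<lambda>x. \<gamma> #> x) ` B" .
  then show ?thesis
    unfolding Bgamma3_mod_gamma3_def carrier_FactGroup by simp
qed

lemma B\<gamma>_eq: "B\<gamma> = C\<lparr>carrier := (\<lambda>x. \<gamma> #> x) ` B\<rparr>"
proof -
  have "B\<gamma> = C\<lparr>carrier := carrier B\<gamma>\<rparr>"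
    by (simp add: Bgamma3_mod_gamma3_def BG'_mod_gamma3_def FactGroup_def set_mult_def[abs_def])
  then show ?thesis by (simp only: carrier_B\<gamma>)
qed

lemma subgroup_B\<gamma>: "subgroup ((\<lambda>x. \<gamma> #> x) ` B) C"
proof -
  interpret h: group_hom "G\<lparr>carrier := M\<rparr>" C "\<lambda>x. \<gamma> #> x"
    by (rule group_homI[OF M.subgroup_is_group[OF is_group] C.is_group])
      (rule homI, auto simp: carrier_C mult_C M.mem_carrier)
  show ?thesis
    by (rule h.subgroup_img_is_subgroup[OF subgroup_incl[OF subgroup_B M.subgroup_axioms B_subset_M]])
qed

lemma p2_bar_inj: "inj_on (p2_bar G B) (carrier C)"
  unfolding pb.inj_on_one_iff
proof (intro allI impI)
  fix X assume "X \<in> carrier C" and 1: "p2_bar G B X = \<one>\<^bsub>P\<^esub>"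
  then obtain u where u: "u \<in> M" "X = \<gamma> #> u" by (auto simp: carrier_C)
  then have "p2 G B u \<otimes>\<^bsub>P\<^esub> mu2 G B \<one>\<^bsub>T\<^esub> = \<one>\<^bsub>P\<^esub>" using 1 by (simp add: p2_bar_coset)
  from relation_from_P2[OF u(1) T.one_closed this] obtain x where
    x: "x \<in> carrier W" "\<gamma> #> u = c2 G B x" "\<one>\<^bsub>T\<^esub> = inv\<^bsub>T\<^esub> l2 G B x" .
  then have "l2 G B x = l2 G B \<one>\<^bsub>W\<^esub>"
    by (metis T.inv_inv T.inv_one l.hom_closed l.hom_one)
  then have "x = \<one>\<^bsub>W\<^esub>" by (rule inj_onD[OF l2_inj _ x(1) W.one_closed])
  then show "X = \<one>\<^bsub>C\<^esub>" using x(2) u(2) by simp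
qed

text \<open>Exactness in the middle holds because the projection of \<open>P\<^sub>2(G,B)\<close> to its quotient by \<open>p\<^sub>2(B)\<close>
  factors through \<open>P\<^sub>2(G/B)\<close>: the map \<open>aB \<mapsto> p\<^sub>2(a) + p\<^sub>2(B)\<close> satisfies the assumptions of the universal
  property of \<open>P\<^sub>2(G/B)\<close>.\<close>
lemma exact_sequence3:
  "exact3 B\<gamma> P (P2 (G Mod B) {\<one>\<^bsub>G Mod B\<^esub>}) (p2_bar G B)
     (P2_map (G Mod B) {\<one>\<^bsub>G Mod B\<^esub>} (\<lambda>a. B #> a))"
proof -
  let ?Q = "G Mod B" let ?P' = "P2 ?Q {\<one>\<^bsub>?Q\<^esub>}" let ?f = "P2_map ?Q {\<one>\<^bsub>?Q\<^esub>} (\<lambda>a. B #> a)"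
  interpret Q: group ?Q by (rule B.factorgroup_is_group)
  have BQ: "(\<lambda>a. B #> a) ` B \<subseteq> {\<one>\<^bsub>?Q\<^esub>}" by (auto simp: B.rcos_const[OF is_group])
  note f = P2_map[OF is_group subgroup_B Q.is_group Q.triv_subgroup B.r_coset_hom_Mod BQ]
  interpret P': comm_group ?P' by (rule comm_group_P2[OF Q.is_group]) (use Q.one_closed in simp)
  have comm_B\<gamma>: "comm_group B\<gamma>" unfolding B\<gamma>_eq by (rule comm_group_subgroup[OF comm_group_C subgroup_B\<gamma>])
  have B\<gamma>C: "carrier B\<gamma> \<subseteq> carrier C" unfolding carrier_B\<gamma> using subgroup.subset[OF subgroup_B\<gamma>] .
  have ph: "p2_bar G B \<in> hom B\<gamma> P"
    using hom_subset[OF p2_bar_hom] B\<gamma>C unfolding B\<gamma>_eq by simp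
  have mon: "p2_bar G B \<in> mon B\<gamma> P" using ph inj_on_subset[OF p2_bar_inj B\<gamma>C] by (simp add: mon_def)
  have epi: "?f \<in> epi P ?P'"
  proof (rule epi_on_gens[OF P.is_group P'.is_group f(1) gens_P2[OF Q.is_group]])
    fix y assume "y \<in> p2 ?Q {\<one>\<^bsub>?Q\<^esub>} ` carrier ?Q"
    then obtain a where "a \<in> carrier G" "y = p2 ?Q {\<one>\<^bsub>?Q\<^esub>} (B #> a)" by (auto simp: carrier_FactGroup)
    then show "\<exists>x\<in>carrier P. ?f x = y"
      using f(2)[of a] by (intro bexI[of _ "p2 G B a"]) (simp_all add: p2_closed)
  qed (use Q.one_closed in simp)
  define J where "J = p2_bar G B ` carrier B\<gamma>"
  have J: "subgroup J P"
    unfolding J_def carrier_B\<gamma> by (rule pb.subgroup_img_is_subgroup[OF subgroup_B\<gamma>])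
  have p2J: "p2 G B b \<in> J" if "b \<in> B" for b
    using that B_subset_M p2_bar_coset[of b] by (force simp: J_def carrier_B\<gamma>)
  interpret JN: normal J P by (rule P.subgroup_imp_normal[OF J])
  let ?E = "P Mod J"
  interpret E: comm_group ?E by (rule P.abelian_FactGroup[OF J])
  note jh = JN.r_coset_hom_Mod
  \<comment> \<open>The map \<open>G/B \<rightarrow> P/J\<close> to which the universal property of \<open>P\<^sub>2(G/B)\<close> is applied.\<close>
  define q where "q = coset_map (\<lambda>a. J #>\<^bsub>P\<^esub> p2 G B a)"
  have jmult: "J #>\<^bsub>P\<^esub> (x \<otimes>\<^bsub>P\<^esub> y) = (J #>\<^bsub>P\<^esub> x) \<otimes>\<^bsub>?E\<^esub> (J #>\<^bsub>P\<^esub> y)" if "x \<in> carrier P" "y \<in> carrier P" for x y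
    using hom_mult[OF jh that] .
  have jc: "J #>\<^bsub>P\<^esub> x \<in> carrier ?E" if "x \<in> carrier P" for x using hom_in_carrier[OF jh that] .
  have jone: "J #>\<^bsub>P\<^esub> x = \<one>\<^bsub>?E\<^esub>" if "x \<in> J" for x
    using JN.rcos_const[OF P.is_group that] by simp
  have qv: "q (B #> a) = J #>\<^bsub>P\<^esub> p2 G B a" if a: "a \<in> carrier G" for a
    unfolding q_def
  proof (rule coset_mapI[OF B.r_coset_nonempty])
    fix x assume "x \<in> B #> a"
    then obtain b where b: "b \<in> B" "x = b \<otimes> a" by (rule r_coset_memE)
    then have "p2 G B x = p2 G B b \<otimes>\<^bsub>P\<^esub> p2 G B a"
      using a subsetD[OF B_subset_M b(1)] by (simp add: p2_mult_M)
    then show "J #>\<^bsub>P\<^esub> p2 G B x = J #>\<^bsub>P\<^esub> p2 G B a"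
      using b a by (simp add: jmult p2_closed B.mem_carrier jone[OF p2J] jc del: mult_FactGroup one_FactGroup)
  qed
  have qc: "q \<in> carrier ?Q \<rightarrow> carrier ?E" by (auto simp: carrier_FactGroup[of G B] qv jc p2_closed)
  have b: "bimult G G ?E (\<lambda>p. J #>\<^bsub>P\<^esub> \<beta> p)"
    using bimult_compose[OF \<beta>_bimult jh id_hom id_hom] by (simp add: case_prod_unfold)
  have bB: "J #>\<^bsub>P\<^esub> \<beta> (n, g) = \<one>\<^bsub>?E\<^esub>" "J #>\<^bsub>P\<^esub> \<beta> (g, n) = \<one>\<^bsub>?E\<^esub>" if "n \<in> B" "g \<in> carrier G" for n g
    using that jone[OF JN.one_closed] by (simp_all add: \<beta>_B_left \<beta>_B_right)
  note L = bimult_coset_map[OF B.normal_axioms E.is_group b bB]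
  let ?\<psi> = "\<lambda>(X, Y). coset_map (\<lambda>p. J #>\<^bsub>P\<^esub> \<beta> p) (X \<times> Y)"
  have \<psi>: "bimult ?Q ?Q ?E ?\<psi>" by (rule L(2))
  have qm: "q (X \<otimes>\<^bsub>?Q\<^esub> Y) = q X \<otimes>\<^bsub>?E\<^esub> q Y \<otimes>\<^bsub>?E\<^esub> ?\<psi> (X, Y)"
    if XY: "X \<in> carrier ?Q" "Y \<in> carrier ?Q" for X Y
  proof -
    from XY obtain x y where xy: "x \<in> carrier G" "y \<in> carrier G" "X = B #> x" "Y = B #> y"
      by (auto simp: carrier_FactGroup)
    have "?\<psi> (X, Y) = J #>\<^bsub>P\<^esub> \<beta> (x, y)" using xy by (simp add: L(1))
    moreover have "q (X \<otimes>\<^bsub>?Q\<^esub> Y) = J #>\<^bsub>P\<^esub> p2 G B (x \<otimes> y)" using xy qv[of "x \<otimes> y"] by (simp add: B.rcos_sum)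
    ultimately show ?thesis
      using xy by (simp add: qv p2_times jmult p2_closed \<beta>_closed del: mult_FactGroup)
  qed
  have \<psi>1: "?\<psi> (X, Y) = \<one>\<^bsub>?E\<^esub>" if "X \<in> {\<one>\<^bsub>?Q\<^esub>}" "Y \<in> carrier ?Q" for X Y
    using bimult_one(1)[OF \<psi> Q.is_group Q.is_group E.is_group that(2)] that(1) by simp
  note U = P2_universal_free_lift[OF Q.is_group Q.triv_subgroup E.comm_group_axioms qc \<psi> qm \<psi>1]
  let ?g = "coset_map (free_lift ?E q)"
  have g: "?g \<in> hom ?P' ?E" by (rule U(1))
  have gf: "?g (?f z) = J #>\<^bsub>P\<^esub> z" if "z \<in> carrier P" for z
  proof (rule hom_eq_P[OF E.is_group _ jh that, of "\<lambda>z. ?g (?f z)"])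
    show "(\<lambda>z. ?g (?f z)) \<in> hom P ?E" using Group.hom_compose[OF f(1) g] by (simp add: o_def)
    fix a assume a: "a \<in> carrier G"
    then have "B #> a \<in> carrier ?Q" by (auto simp: carrier_FactGroup)
    then have "?g (p2 ?Q {\<one>\<^bsub>?Q\<^esub>} (B #> a)) = q (B #> a)" by (rule U(2)[rotated -1])
    then show "?g (?f (p2 G B a)) = J #>\<^bsub>P\<^esub> p2 G B a"
      unfolding f(2)[OF a] qv[OF a] .
  qed
  have ex: "p2_bar G B ` carrier B\<gamma> = kernel P ?P' ?f"
    unfolding J_def[symmetric]
  proof (intro equalityI subsetI)
    fix z assume z: "z \<in> J"
    then obtain b where b: "b \<in> B" "z = p2 G B b"
      using B_subset_M p2_bar_coset by (force simp: J_def carrier_B\<gamma>)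
    have "?f z = p2 ?Q {\<one>\<^bsub>?Q\<^esub>} \<one>\<^bsub>?Q\<^esub>"
      using b f(2)[of b] BQ by (simp add: B.mem_carrier image_subset_iff)
    also have "\<dots> = \<one>\<^bsub>?P'\<^esub>"
      unfolding p2_def using P2_class_one[OF Q.is_group add_subgroup_zero[OF add_subgroup_P2_ker]]
      by (simp add: a_r_coset_group_ring)
    finally show "z \<in> kernel P ?P' ?f" using z JN.subset by (auto simp: kernel_def)
  next
    fix z assume "z \<in> kernel P ?P' ?f"
    then have z: "z \<in> carrier P" "?f z = \<one>\<^bsub>?P'\<^esub>" by (auto simp: kernel_def)
    then have "J #>\<^bsub>P\<^esub> z = J"
      using gf[OF z(1)] hom_one[OF g P'.is_group E.is_group] by simp
    then show "z \<in> J" using P.r_coset_eq_self_iff[OF J z(1)] by simp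
  qed
  show ?thesis
    unfolding exact3_def exact_at_def
    using comm_B\<gamma> comm_group_P P'.comm_group_axioms mon ph f(1) ex epi by blast
qed

end

section \<open>Naturality\<close>

lemma tensor_map:
  assumes "group A" "group A'" "h \<in> hom A A'"
  shows "tensor_map A' h \<in> hom (tensor_product A A) (tensor_product A' A')"
    and "a \<in> carrier A \<Longrightarrow> b \<in> carrier A \<Longrightarrow> tensor_map A' h (tens A A a b) = tens A' A' (h a) (h b)"
proof -
  note b = bimult_compose[OF tens_bimult[OF assms(2,2)] id_hom assms(3,3)]
  note L = tensor_lift[OF assms(1,1) comm_group_tensor_product[OF assms(2,2)] b]
  show "tensor_map A' h \<in> hom (tensor_product A A) (tensor_product A' A')"
    unfolding tensor_map_def using L(1) by simp
  show "tensor_map A' h (tens A A a b) = tens A' A' (h a) (h b)" if "a \<in> carrier A" "b \<in> carrier A"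
    unfolding tensor_map_def using L(2)[OF that] by simp
qed

lemma exterior_map:
  assumes "group A" "group A'" "h \<in> hom A A'"
  shows "exterior_map A' h \<in> hom (exterior_square A) (exterior_square A')"
    and "a \<in> carrier A \<Longrightarrow> b \<in> carrier A \<Longrightarrow> exterior_map A' h (wedge A a b) = wedge A' (h a) (h b)"
proof -
  note b = bimult_compose[OF wedge_bimult[OF assms(2)] id_hom assms(3,3)]
  have alt: "(case (a, a) of (a, b) \<Rightarrow> case (h a, h b) of (a, b) \<Rightarrow> wedge A' a b) = \<one>\<^bsub>exterior_square A'\<^esub>"
    if "a \<in> carrier A" for a
    using wedge_self[OF assms(2) hom_in_carrier[OF assms(3) that]] by simp
  note L = exterior_lift[OF assms(1) comm_group_exterior_square[OF assms(2)] b alt]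
  show "exterior_map A' h \<in> hom (exterior_square A) (exterior_square A')"
    unfolding exterior_map_def using L(1) by simp
  show "exterior_map A' h (wedge A a b) = wedge A' (h a) (h b)" if "a \<in> carrier A" "b \<in> carrier A"
    unfolding exterior_map_def using L(3)[OF _ that] by simp
qed

text \<open>A homomorphism of pairs.  The vertical maps of the squares are all induced by \<open>f\<close>.\<close>
locale central_pair_hom = G: central_pair G B + H: central_pair H C
  for G :: "('a, 'm) monoid_scheme" and B and H :: "('b, 'n) monoid_scheme" and C +
  fixes f
  assumes f_hom: "f \<in> hom G H" and f_B: "f ` B \<subseteq> C"
begin

sublocale f: group_hom G H f by (rule group_homI[OF G.is_group H.is_group f_hom])

lemma f_D: "f ` G.D \<subseteq> H.D"
proof -
  have "f ` G.D = derived H (f ` carrier G)" by (simp add: f.derived_img)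
  also have "\<dots> \<subseteq> H.D" by (rule H.mono_derived) auto
  finally show ?thesis .
qed

lemma f_commutator: "a \<in> carrier G \<Longrightarrow> b \<in> carrier G \<Longrightarrow> f (commutator G a b) = commutator H (f a) (f b)"
  by (rule hom_commutator[OF G.is_group H.is_group f_hom])

lemma f_\<gamma>: "f ` G.\<gamma> \<subseteq> H.\<gamma>"
proof -
  have "subgroup {x \<in> carrier G. f x \<in> H.\<gamma>} G"
    by (rule subgroup.intro) auto
  moreover have "{commutator G s t |s t. s \<in> carrier G \<and> t \<in> G.D} \<subseteq> {x \<in> carrier G. f x \<in> H.\<gamma>}"
  proof (clarify, intro conjI)
    fix s t assume s: "s \<in> carrier G" and t: "t \<in> G.D"
    have tG: "t \<in> carrier G" using t G.derived_subgroup_subset by auto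
    show "commutator G s t \<in> carrier G" using s tG by simp
    have "f t \<in> H.D" using t f_D by auto
    then show "f (commutator G s t) \<in> H.\<gamma>"
      using s tG by (simp add: f_commutator H.commutator_gen_gamma3)
  qed
  ultimately have "G.\<gamma> \<subseteq> {x \<in> carrier G. f x \<in> H.\<gamma>}"
    unfolding gamma3_def[of G] commutator_subgroup_def by (rule G.generate_subgroup_incl[rotated])
  then show ?thesis by auto
qed

lemma f_M: "f ` G.M \<subseteq> H.M"
proof (rule image_subsetI)
  fix m assume "m \<in> G.M"
  then obtain b d where m: "b \<in> B" "d \<in> G.D" "m = b \<otimes>\<^bsub>G\<^esub> d" by (auto simp: G.M_iff)
  then have "f m = f b \<otimes>\<^bsub>H\<^esub> f d" by (simp add: G.B.mem_carrier G.D.mem_carrier)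
  moreover have "f b \<in> C" "f d \<in> H.D" using m f_B f_D by auto
  ultimately show "f m \<in> H.M" unfolding H.M_iff by blast
qed

abbreviation "fab \<equiv> quot_map H H.D f"
abbreviation "fq \<equiv> quot_map H H.M f"
abbreviation "fg3 \<equiv> quot_map H H.\<gamma> f"
abbreviation "ft \<equiv> tensor_map H.A fq"
abbreviation "fe \<equiv> exterior_map H.A fq"
abbreviation "fP \<equiv> P2_map H C f"
abbreviation "fB \<equiv> quot_map H C f"
abbreviation "fPq \<equiv> P2_map (H Mod C) {\<one>\<^bsub>H Mod C\<^esub>} fB"

lemmas fab = quot_map_rcoset[OF G.D.normal_axioms H.D.normal_axioms f_hom f_D]
lemmas fq = quot_map_rcoset[OF G.M.normal_axioms H.M.normal_axioms f_hom f_M, folded G.A_eq H.A_eq]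
lemmas fB = quot_map_rcoset[OF G.B.normal_axioms H.B.normal_axioms f_hom f_B]
lemmas fab_hom = fab(2)[OF G.one_closed]
lemmas fq_hom = fq(2)[OF G.one_closed]
lemmas fB_hom = fB(2)[OF G.one_closed]
lemmas fP = P2_map[OF G.is_group G.subgroup_B H.is_group H.subgroup_B f_hom f_B]
lemmas ft = tensor_map[OF G.group_A H.group_A fq_hom, folded G.T_eq H.T_eq]
lemmas fe = exterior_map[OF G.group_A H.group_A fq_hom, folded G.W_eq H.W_eq]

lemma fg3:
  shows fg3_hom: "fg3 \<in> hom G.C H.C"
    and fg3_coset: "x \<in> G.M \<Longrightarrow> fg3 (G.\<gamma> #>\<^bsub>G\<^esub> x) = H.\<gamma> #>\<^bsub>H\<^esub> f x"
proof -
  have fM: "f \<in> hom (G\<lparr>carrier := G.M\<rparr>) (H\<lparr>carrier := H.M\<rparr>)"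
    using f_M by (auto simp: hom_def G.M.mem_carrier)
  have eq: "quot_map (H\<lparr>carrier := H.M\<rparr>) H.\<gamma> f = fg3"
    by (simp add: quot_map_def)
  note q = quot_map_rcoset[OF G.\<gamma>_normal_M H.\<gamma>_normal_M fM f_\<gamma>, unfolded eq]
  show "fg3 \<in> hom G.C H.C"
    using q(2)[of "\<one>\<^bsub>G\<^esub>"] by (simp add: BG'_mod_gamma3_def)
  show "fg3 (G.\<gamma> #>\<^bsub>G\<^esub> x) = H.\<gamma> #>\<^bsub>H\<^esub> f x" if "x \<in> G.M"
    using q(1)[of x] that by simp
qed

lemma f_closed_M: "x \<in> G.M \<Longrightarrow> f x \<in> H.M" using f_M by auto

lemma square_l2:
  assumes "x \<in> carrier G.W" shows "ft (l2 G B x) = l2 H C (fe x)"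
proof (rule G.hom_eq_W[OF H.T.is_group _ _ assms, of "\<lambda>x. ft (l2 G B x)" "\<lambda>x. l2 H C (fe x)"])
  show "(\<lambda>x. ft (l2 G B x)) \<in> hom G.W H.T"
    using hom_compose[OF G.l2_hom ft(1)] by (simp add: o_def)
  show "(\<lambda>x. l2 H C (fe x)) \<in> hom G.W H.T"
    using hom_compose[OF fe(1) H.l2_hom] by (simp add: o_def)
  interpret t: group_hom G.T H.T ft by (rule group_homI[OF G.T.is_group H.T.is_group ft(1)])
  fix a b assume "a \<in> carrier G" "b \<in> carrier G"
  then show "ft (l2 G B (wedge G.A (G.M #>\<^bsub>G\<^esub> a) (G.M #>\<^bsub>G\<^esub> b))) = l2 H C (fe (wedge G.A (G.M #>\<^bsub>G\<^esub> a) (G.M #>\<^bsub>G\<^esub> b)))"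
    by (simp add: G.l2_wedge H.l2_wedge G.M_coset_closed H.M_coset_closed fe(2) ft(2) fq(1) G.tens_closed)
qed

lemma square_c2:
  assumes "x \<in> carrier G.W" shows "fg3 (c2 G B x) = c2 H C (fe x)"
proof (rule G.hom_eq_W[OF H.C.is_group _ _ assms, of "\<lambda>x. fg3 (c2 G B x)" "\<lambda>x. c2 H C (fe x)"])
  show "(\<lambda>x. fg3 (c2 G B x)) \<in> hom G.W H.C"
    using hom_compose[OF G.c2_hom fg3_hom] by (simp add: o_def)
  show "(\<lambda>x. c2 H C (fe x)) \<in> hom G.W H.C"
    using hom_compose[OF fe(1) H.c2_hom] by (simp add: o_def)
  fix a b assume "a \<in> carrier G" "b \<in> carrier G"
  then show "fg3 (c2 G B (wedge G.A (G.M #>\<^bsub>G\<^esub> a) (G.M #>\<^bsub>G\<^esub> b))) = c2 H C (fe (wedge G.A (G.M #>\<^bsub>G\<^esub> a) (G.M #>\<^bsub>G\<^esub> b)))"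
    by (simp add: G.c2_wedge H.c2_wedge G.M_coset_closed fe(2) fq(1) fg3_coset G.commutator_in_M f_commutator)
qed

lemma square_mu2:
  assumes "t \<in> carrier G.T" shows "fP (mu2 G B t) = mu2 H C (ft t)"
proof (rule G.hom_eq_T[OF H.P.is_group _ _ assms, of "\<lambda>t. fP (mu2 G B t)" "\<lambda>t. mu2 H C (ft t)"])
  show "(\<lambda>t. fP (mu2 G B t)) \<in> hom G.T H.P"
    using hom_compose[OF G.mu2_hom fP(1)] by (simp add: o_def)
  show "(\<lambda>t. mu2 H C (ft t)) \<in> hom G.T H.P"
    using hom_compose[OF ft(1) H.mu2_hom] by (simp add: o_def)
  fix a b assume "a \<in> carrier G" "b \<in> carrier G"
  then show "fP (mu2 G B (tens G.A G.A (G.M #>\<^bsub>G\<^esub> a) (G.M #>\<^bsub>G\<^esub> b))) = mu2 H C (ft (tens G.A G.A (G.M #>\<^bsub>G\<^esub> a) (G.M #>\<^bsub>G\<^esub> b)))"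
    by (simp add: G.mu2_tens H.mu2_tens G.M_coset_closed ft(2) fq(1) fP(3))
qed

lemma square_p2_bar:
  assumes "X \<in> carrier G.C" shows "fP (p2_bar G B X) = p2_bar H C (fg3 X)"
proof -
  from assms obtain x where x: "x \<in> G.M" "X = G.\<gamma> #>\<^bsub>G\<^esub> x" by (auto simp: G.carrier_C)
  then show ?thesis
    by (simp add: G.p2_bar_coset H.p2_bar_coset fg3_coset f_closed_M fP(2) G.M.mem_carrier)
qed

lemma square_rho1:
  assumes "z \<in> carrier G.P" shows "fab (rho1 G B z) = rho1 H C (fP z)"
proof (rule G.hom_eq_P[OF H.derived_quot_is_group _ _ assms, of "\<lambda>z. fab (rho1 G B z)" "\<lambda>z. rho1 H C (fP z)"])
  have h: "rho1 G B \<in> hom G.P (abelianization G)" "rho1 H C \<in> hom H.P (abelianization H)"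
    using G.rho1_props(1) H.rho1_props(1) by (auto simp: epi_def)
  show "(\<lambda>z. fab (rho1 G B z)) \<in> hom G.P (abelianization H)"
    using hom_compose[OF h(1) fab_hom] by (simp add: o_def)
  show "(\<lambda>z. rho1 H C (fP z)) \<in> hom G.P (abelianization H)"
    using hom_compose[OF fP(1) h(2)] by (simp add: o_def)
qed (simp_all add: G.rho1_props(2) H.rho1_props(2) fab(1) fP(2))

lemma square_rho2:
  assumes "z \<in> carrier G.P" shows "fq (rho2 G B z) = rho2 H C (fP z)"
proof (rule G.hom_eq_P[OF H.group_A _ _ assms, of "\<lambda>z. fq (rho2 G B z)" "\<lambda>z. rho2 H C (fP z)"])
  have h: "rho2 G B \<in> hom G.P G.A" "rho2 H C \<in> hom H.P H.A"
    using G.rho2_props(1) H.rho2_props(1) by (auto simp: epi_def)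
  show "(\<lambda>z. fq (rho2 G B z)) \<in> hom G.P H.A"
    using hom_compose[OF h(1) fq_hom] by (simp add: o_def)
  show "(\<lambda>z. rho2 H C (fP z)) \<in> hom G.P H.A"
    using hom_compose[OF fP(1) h(2)] by (simp add: o_def)
qed (simp_all add: G.rho2_props(2) H.rho2_props(2) fq(1) fP(2))

lemma fe_Ker: "fe \<in> hom (Ker_c2 G B) (Ker_c2 H C)"
proof -
  interpret g: group_hom G.C H.C fg3 by (rule group_homI[OF G.C.is_group H.C.is_group fg3_hom])
  show ?thesis
    using fe(1) square_c2 by (auto simp: hom_def Ker_c2_def kernel_def Pi_iff simp flip: square_c2)
qed

lemma fg3_B\<gamma>: "fg3 \<in> hom G.B\<gamma> H.B\<gamma>"
proof -
  have "fg3 X \<in> carrier H.B\<gamma>" if "X \<in> carrier G.B\<gamma>" for X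
    using that f_B G.B_subset_M by (auto simp: G.carrier_B\<gamma> H.carrier_B\<gamma> fg3_coset subset_iff image_subset_iff)
  moreover have "carrier G.B\<gamma> \<subseteq> carrier G.C"
    unfolding G.carrier_B\<gamma> using subgroup.subset[OF G.subgroup_B\<gamma>] .
  ultimately show ?thesis
    using fg3_hom unfolding G.B\<gamma>_eq H.B\<gamma>_eq by (simp add: hom_def Pi_iff subset_iff)
qed

lemma squares:
  "commutes (Ker_c2 G B) G.T (Ker_c2 H C) H.T (l2 G B) (l2 H C) fe ft"
  "commutes G.T G.P H.T H.P (mu2 G B) (mu2 H C) ft fP"
  "commutes G.P (abelianization G) H.P (abelianization H) (rho1 G B) (rho1 H C) fP fab"
  "commutes G.W (G.C \<times>\<times> G.T) H.W (H.C \<times>\<times> H.T) (c2_l2 G B) (c2_l2 H C) fe (map_prod fg3 ft)"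
  "commutes (G.C \<times>\<times> G.T) G.P (H.C \<times>\<times> H.T) H.P (p2i_mu2 G B) (p2i_mu2 H C) (map_prod fg3 ft) fP"
  "commutes G.P G.A H.P H.A (rho2 G B) (rho2 H C) fP fq"
  "commutes G.B\<gamma> G.P H.B\<gamma> H.P (p2_bar G B) (p2_bar H C) fg3 fP"
proof -
  interpret t: group_hom G.T H.T ft by (rule group_homI[OF G.T.is_group H.T.is_group ft(1)])
  interpret p: group_hom G.P H.P fP by (rule group_homI[OF G.P.is_group H.P.is_group fP(1)])
  have prod: "map_prod fg3 ft \<in> hom (G.C \<times>\<times> G.T) (H.C \<times>\<times> H.T)"
    using fg3_hom ft(1) by (simp add: map_prod_def hom_paired2 G.C.is_group G.T.is_group)
  show "commutes (Ker_c2 G B) G.T (Ker_c2 H C) H.T (l2 G B) (l2 H C) fe ft"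
    using fe_Ker ft(1) square_l2 by (simp add: commutes_def G.carrier_Ker_c2)
  show "commutes G.T G.P H.T H.P (mu2 G B) (mu2 H C) ft fP"
    using ft(1) fP(1) square_mu2 by (simp add: commutes_def)
  show "commutes G.P (abelianization G) H.P (abelianization H) (rho1 G B) (rho1 H C) fP fab"
    using fP(1) fab_hom square_rho1 by (simp add: commutes_def)
  show "commutes G.W (G.C \<times>\<times> G.T) H.W (H.C \<times>\<times> H.T) (c2_l2 G B) (c2_l2 H C) fe (map_prod fg3 ft)"
    using fe(1) prod by (simp add: commutes_def c2_l2_def square_c2 square_l2)
  show "commutes (G.C \<times>\<times> G.T) G.P (H.C \<times>\<times> H.T) H.P (p2i_mu2 G B) (p2i_mu2 H C) (map_prod fg3 ft) fP"
    using prod fP(1) by (auto simp: commutes_def p2i_mu2_def square_mu2 square_p2_bar)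
  show "commutes G.P G.A H.P H.A (rho2 G B) (rho2 H C) fP fq"
    using fP(1) fq_hom square_rho2 by (simp add: commutes_def)
  have "carrier G.B\<gamma> \<subseteq> carrier G.C"
    unfolding G.carrier_B\<gamma> using subgroup.subset[OF G.subgroup_B\<gamma>] .
  then show "commutes G.B\<gamma> G.P H.B\<gamma> H.P (p2_bar G B) (p2_bar H C) fg3 fP"
    using fg3_B\<gamma> fP(1) square_p2_bar by (auto simp: commutes_def)
qed

lemma square_P2_projection:
  "commutes G.P (P2 (G Mod B) {\<one>\<^bsub>G Mod B\<^esub>}) H.P (P2 (H Mod C) {\<one>\<^bsub>H Mod C\<^esub>})
     (P2_map (G Mod B) {\<one>\<^bsub>G Mod B\<^esub>} (\<lambda>a. B #>\<^bsub>G\<^esub> a))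
     (P2_map (H Mod C) {\<one>\<^bsub>H Mod C\<^esub>} (\<lambda>a. C #>\<^bsub>H\<^esub> a)) fP fPq"
proof -
  let ?Q = "G Mod B" and ?R = "H Mod C"
  interpret Q: group ?Q by (rule G.B.factorgroup_is_group)
  interpret R: group ?R by (rule H.B.factorgroup_is_group)
  interpret fB: group_hom ?Q ?R fB by (rule group_homI[OF Q.is_group R.is_group fB_hom])
  have 1: "(\<lambda>a. B #>\<^bsub>G\<^esub> a) ` B \<subseteq> {\<one>\<^bsub>?Q\<^esub>}" by (auto simp: G.B.rcos_const[OF G.is_group])
  have 2: "(\<lambda>a. C #>\<^bsub>H\<^esub> a) ` C \<subseteq> {\<one>\<^bsub>?R\<^esub>}" by (auto simp: H.B.rcos_const[OF H.is_group])
  have 3: "fB ` {\<one>\<^bsub>?Q\<^esub>} \<subseteq> {\<one>\<^bsub>?R\<^esub>}" using fB.hom_one by simp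
  note g = P2_map[OF G.is_group G.subgroup_B Q.is_group Q.triv_subgroup G.B.r_coset_hom_Mod 1]
  note h = P2_map[OF H.is_group H.subgroup_B R.is_group R.triv_subgroup H.B.r_coset_hom_Mod 2]
  note k = P2_map[OF Q.is_group Q.triv_subgroup R.is_group R.triv_subgroup fB_hom 3]
  let ?g = "P2_map ?Q {\<one>\<^bsub>?Q\<^esub>} (\<lambda>a. B #>\<^bsub>G\<^esub> a)" and ?h = "P2_map ?R {\<one>\<^bsub>?R\<^esub>} (\<lambda>a. C #>\<^bsub>H\<^esub> a)"
  have R1: "{\<one>\<^bsub>?R\<^esub>} \<subseteq> carrier ?R" using R.one_closed by simp
  have eq: "fPq (?g z) = ?h (fP z)" if "z \<in> carrier G.P" for z
  proof (rule G.hom_eq_P[OF comm_group.axioms(2)[OF comm_group_P2[OF R.is_group R1]] _ _ that,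
        of "\<lambda>z. fPq (?g z)" "\<lambda>z. ?h (fP z)"])
    show "(\<lambda>z. fPq (?g z)) \<in> hom G.P (P2 ?R {\<one>\<^bsub>?R\<^esub>})"
      using hom_compose[OF g(1) k(1)] by (simp only: o_def)
    show "(\<lambda>z. ?h (fP z)) \<in> hom G.P (P2 ?R {\<one>\<^bsub>?R\<^esub>})"
      using hom_compose[OF fP(1) h(1)] by (simp only: o_def)
    fix a assume a: "a \<in> carrier G"
    then have Ba: "B #>\<^bsub>G\<^esub> a \<in> carrier ?Q" by (auto simp: carrier_FactGroup)
    show "fPq (?g (p2 G B a)) = ?h (fP (p2 G B a))"
      unfolding g(2)[OF a] k(2)[OF Ba] fP(2)[OF a] h(2)[OF f.hom_closed[OF a]] fB(1)[OF a] ..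
  qed
  show ?thesis
    unfolding commutes_def using fP(1) k(1) eq by blast
qed

end

section \<open>The exact sequences\<close>

theorem theorem2p10:
  fixes G :: "('a, 'm) monoid_scheme" and B :: "'a set"
  assumes "group G" and "central_subgroup B G"
  shows
    "exact4 (Ker_c2 G B) (tensor_square_quot G B) (P2 G B) (abelianization G)
       (l2 G B) (mu2 G B) (rho1 G B) \<and>
     exact4 (exterior_square_quot G B) (BG'_mod_gamma3 G B \<times>\<times> tensor_square_quot G B)
       (P2 G B) (G_mod_BG' G B)
       (c2_l2 G B) (p2i_mu2 G B) (rho2 G B) \<and>
     exact3 (Bgamma3_mod_gamma3 G B) (P2 G B) (P2 (G Mod B) {\<one>\<^bsub>G Mod B\<^esub>})
       (p2_bar G B) (P2_map (G Mod B) {\<one>\<^bsub>G Mod B\<^esub>} (\<lambda>a. B #>\<^bsub>G\<^esub> a)) \<and>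
     (\<forall>a\<in>carrier G. rho1 G B (p2 G B a) = derived_subgroup G #>\<^bsub>G\<^esub> a) \<and>
     (\<forall>a\<in>carrier G. rho2 G B (p2 G B a) = BG' G B #>\<^bsub>G\<^esub> a) \<and>
     (\<forall>(H :: ('b, 'n) monoid_scheme) C f.
        group H \<and> central_subgroup C H \<and> f \<in> hom G H \<and> f ` B \<subseteq> C \<longrightarrow>
        (let fab = quot_map H (derived_subgroup H) f;
             fq = quot_map H (BG' H C) f;
             fg3 = quot_map H (gamma3 H) f;
             ft = tensor_map (G_mod_BG' H C) fq;
             fe = exterior_map (G_mod_BG' H C) fq;
             fP = P2_map H C f;
             fPq = P2_map (H Mod C) {\<one>\<^bsub>H Mod C\<^esub>} (quot_map H C f)
         in
           commutes (Ker_c2 G B) (tensor_square_quot G B) (Ker_c2 H C) (tensor_square_quot H C)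
             (l2 G B) (l2 H C) fe ft \<and>
           commutes (tensor_square_quot G B) (P2 G B) (tensor_square_quot H C) (P2 H C)
             (mu2 G B) (mu2 H C) ft fP \<and>
           commutes (P2 G B) (abelianization G) (P2 H C) (abelianization H)
             (rho1 G B) (rho1 H C) fP fab \<and>
           commutes (exterior_square_quot G B) (BG'_mod_gamma3 G B \<times>\<times> tensor_square_quot G B)
             (exterior_square_quot H C) (BG'_mod_gamma3 H C \<times>\<times> tensor_square_quot H C)
             (c2_l2 G B) (c2_l2 H C) fe (map_prod fg3 ft) \<and>
           commutes (BG'_mod_gamma3 G B \<times>\<times> tensor_square_quot G B) (P2 G B)
             (BG'_mod_gamma3 H C \<times>\<times> tensor_square_quot H C) (P2 H C)
             (p2i_mu2 G B) (p2i_mu2 H C) (map_prod fg3 ft) fP \<and>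
           commutes (P2 G B) (G_mod_BG' G B) (P2 H C) (G_mod_BG' H C)
             (rho2 G B) (rho2 H C) fP fq \<and>
           commutes (Bgamma3_mod_gamma3 G B) (P2 G B) (Bgamma3_mod_gamma3 H C) (P2 H C)
             (p2_bar G B) (p2_bar H C) fg3 fP \<and>
           commutes (P2 G B) (P2 (G Mod B) {\<one>\<^bsub>G Mod B\<^esub>}) (P2 H C) (P2 (H Mod C) {\<one>\<^bsub>H Mod C\<^esub>})
             (P2_map (G Mod B) {\<one>\<^bsub>G Mod B\<^esub>} (\<lambda>a. B #>\<^bsub>G\<^esub> a))
             (P2_map (H Mod C) {\<one>\<^bsub>H Mod C\<^esub>} (\<lambda>a. C #>\<^bsub>H\<^esub> a)) fP fPq))"
proof -
  interpret G: central_pair G B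
    using assms by (simp add: central_pair_def central_pair_axioms_def)
  have natural: "central_pair_hom G B H C f"
    if "group H" "central_subgroup C H" "f \<in> hom G H" "f ` B \<subseteq> C"
    for H :: "('b, 'n) monoid_scheme" and C f
    using assms that
    by (simp add: central_pair_hom_def central_pair_hom_axioms_def central_pair_def central_pair_axioms_def)
  show ?thesis
    unfolding Let_def
    using G.exact_sequence1 G.exact_sequence2 G.exact_sequence3 G.rho1_props(2) G.rho2_props(2)
      central_pair_hom.squares[OF natural] central_pair_hom.square_P2_projection[OF natural]
    by (intro conjI allI impI ballI) (simp_all only: simp_thms)
qed

end
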